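(* Let $(X,\mathsf d,\mu)$ and $(X_n,\mathsf d_n,\mu_n)$, $n\in\mathbb N$, be complete separable metric spaces with Borel probability measures having finite fourth moments, such that $\lim_n GW_4(X,X_n)=0$. For each $n$ let $\gamma_n\in\Pi(\mu,\mu_n)$ be a minimizer in the definition of $GW_4(X,X_n)$, and let $\boldsymbol\gamma$ be a Borel probability measure on $X^\infty:=X\times\prod_nX_n$ whose projection on $X\times X_n$ equals $\gamma_n$ for every $n$. Let $T$ be the centered operator associated with $(X,\mathsf d,\mu)$, and let $M^m$ (resp. $M^m_n$) be any MDS map of $(X,\mathsf d,\mu)$ (resp. $(X_n,\mathsf d_n,\mu_n)$) into $\mathbb R^m$ (see context), regarded as functions on $X^\infty$ depending only on the coordinate in $X$ (resp. $X_n$). If $m\in\mathbb N$ is such that $\lambda_m^+(T)>\lambda_{m+1}^+(T)$, then \[ \min_{Q\in O(m)}\|M^m-QM^m_n\|_{L^2(X^\infty,\boldsymbol\gamma)}\to0\qquad\text{as }n\to\infty, \] where $O(m)$ is the orthogonal group on $\mathbb R^m$. Moreover, if the eigenvalue $\lambda_j^+(T)$ has multiplicity $1$ for all $1\le j\le m$, then for every $n$ there exists a diagonal matrix $D_n\in\mathbb R^{m\times m}$ with diagonal elements in $\{-1,1\}$ such that \[ \lim_{n\to\infty}\|M^m-D_nM^m_n\|_{L^2(X^\infty,\boldsymbol\gamma)}=0. \]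
   Context: Finite fourth moment means $\int_X\mathsf d^4(x_0,y)\,d\mu(y)<\infty$ for some $x_0\in X$. $\Pi(\mu,\mu_n)$ is the set of Borel probability measures on $X\times X_n$ with marginals $\mu$ and $\mu_n$. The Gromov--Kantorovich distance of order $p$ is defined by \[ GW_p^p(X,X_n):=\inf_{\gamma\in\Pi(\mu,\mu_n)}\int_{(X\times X_n)^2}|\mathsf d(x,y)-\mathsf d_n(x',y')|^p\,d\gamma(x,x')\,d\gamma(y,y'). \] For a metric measure space $(X,\mathsf d,\mu)$ with finite fourth moment, let $\mathsf k(x,y):=-\frac12\mathsf d^2(x,y)$, $(Kg)(x):=\int_X\mathsf k(x,y)g(y)\,d\mu(y)$, $Pg:=g-\int_Xg\,d\mu$ and $T:=PKP$ on $L^2(X,\mu)$, which is a self-adjoint Hilbert--Schmidt operator. Let $\lambda_1^+(T)\ge\lambda_2^+(T)\ge\dots>0$ be its positive eigenvalues counted with multiplicity and $u_j^+(T)\in L^2(X,\mu)$ corresponding orthonormal eigenfunctions; if there are only $J<\infty$ positive eigenvalues, set $\lambda_j^+(T):=0$ for $j>J$. An MDS map into $\mathbb R^m$ is $M^m(x):=(\sqrt{\lambda_j^+(T)}\,u_j^+(T)(x))_{j=1,\dots,m}$, with $j$-th component equal to $0$ for $j>J$. $M_n^m$ is defined in the same way from $(X_n,\mathsf d_n,\mu_n)$. *)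

theory Defs
  imports "HOL-Probability.Probability"
begin

section \<open>Metric measure spaces\<close>

definition borel_sigma :: "'a topology \<Rightarrow> 'a measure" where
  "borel_sigma T = sigma (topspace T) {U. openin T U}"

definition mm_space :: "'a set \<Rightarrow> ('a \<Rightarrow> 'a \<Rightarrow> real) \<Rightarrow> 'a measure \<Rightarrow> bool" where
  "mm_space X d \<mu> \<longleftrightarrow>
     Metric_space X d \<and> Metric_space.mcomplete X d \<and>
     separable_space (Metric_space.mtopology X d) \<and>
     prob_space \<mu> \<and> sets \<mu> = sets (borel_sigma (Metric_space.mtopology X d))"

definition finite_fourth_moment :: "'a set \<Rightarrow> ('a \<Rightarrow> 'a \<Rightarrow> real) \<Rightarrow> 'a measure \<Rightarrow> bool" where
  "finite_fourth_moment X d \<mu> \<longleftrightarrow>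
     (\<exists>x0\<in>X. (\<integral>\<^sup>+ y. ennreal (d x0 y ^ 4) \<partial>\<mu>) < \<infinity>)"

section \<open>Gromov--Kantorovich distance\<close>

definition couplings ::
  "'a set \<Rightarrow> ('a \<Rightarrow> 'a \<Rightarrow> real) \<Rightarrow> 'a measure \<Rightarrow> 'b set \<Rightarrow> ('b \<Rightarrow> 'b \<Rightarrow> real) \<Rightarrow> 'b measure \<Rightarrow>
   ('a \<times> 'b) measure set" where
  "couplings X d \<mu> Y e \<nu> =
     {\<gamma>. prob_space \<gamma> \<and>
         sets \<gamma> = sets (borel_sigma
           (prod_topology (Metric_space.mtopology X d) (Metric_space.mtopology Y e))) \<and>
         distr \<gamma> \<mu> fst = \<mu> \<and> distr \<gamma> \<nu> snd = \<nu>}"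

text \<open>Powers with a positive real exponent, taking \<open>\<infinity>\<close> to \<open>\<infinity>\<close>; used with exponent \<open>1 / p\<close>
  to form \<open>p\<close>-th roots.\<close>

definition ennreal_rpow :: "ennreal \<Rightarrow> real \<Rightarrow> ennreal" where
  "ennreal_rpow a r = (if a = \<infinity> then \<infinity> else ennreal (enn2real a powr r))"

definition GW_cost ::
  "real \<Rightarrow> ('a \<Rightarrow> 'a \<Rightarrow> real) \<Rightarrow> ('b \<Rightarrow> 'b \<Rightarrow> real) \<Rightarrow> ('a \<times> 'b) measure \<Rightarrow> ennreal" where
  "GW_cost p d e \<gamma> =
     (\<integral>\<^sup>+ ((x, x'), (y, y')). ennreal (\<bar>d x y - e x' y'\<bar> powr p) \<partial>(\<gamma> \<Otimes>\<^sub>M \<gamma>))"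

definition GW ::
  "real \<Rightarrow> 'a set \<Rightarrow> ('a \<Rightarrow> 'a \<Rightarrow> real) \<Rightarrow> 'a measure \<Rightarrow>
   'b set \<Rightarrow> ('b \<Rightarrow> 'b \<Rightarrow> real) \<Rightarrow> 'b measure \<Rightarrow> ennreal" where
  "GW p X d \<mu> Y e \<nu> =
     ennreal_rpow (INF \<gamma>\<in>couplings X d \<mu> Y e \<nu>. GW_cost p d e \<gamma>) (1 / p)"

section \<open>The centered operator and its positive spectrum\<close>

text \<open>Elements of \<open>L\<^sup>2\<close> are represented by square-integrable functions; equality in \<open>L\<^sup>2\<close> is
  equality almost everywhere.\<close>

definition L2_space :: "'a measure \<Rightarrow> ('a \<Rightarrow> real) set" where
  "L2_space \<mu> = {g \<in> borel_measurable \<mu>. integrable \<mu> (\<lambda>x. (g x)\<^sup>2)}"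

definition mds_kernel :: "('a \<Rightarrow> 'a \<Rightarrow> real) \<Rightarrow> 'a \<Rightarrow> 'a \<Rightarrow> real" where
  "mds_kernel d x y = - (1 / 2) * (d x y)\<^sup>2"

definition kernel_op :: "('a \<Rightarrow> 'a \<Rightarrow> real) \<Rightarrow> 'a measure \<Rightarrow> ('a \<Rightarrow> real) \<Rightarrow> 'a \<Rightarrow> real" where
  "kernel_op d \<mu> g = (\<lambda>x. \<integral>y. mds_kernel d x y * g y \<partial>\<mu>)"

definition centering :: "'a measure \<Rightarrow> ('a \<Rightarrow> real) \<Rightarrow> 'a \<Rightarrow> real" where
  "centering \<mu> g = (\<lambda>x. g x - (\<integral>y. g y \<partial>\<mu>))"

definition mds_op :: "('a \<Rightarrow> 'a \<Rightarrow> real) \<Rightarrow> 'a measure \<Rightarrow> ('a \<Rightarrow> real) \<Rightarrow> 'a \<Rightarrow> real" where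
  "mds_op d \<mu> g = centering \<mu> (kernel_op d \<mu> (centering \<mu> g))"

definition eigenspace ::
  "'a measure \<Rightarrow> (('a \<Rightarrow> real) \<Rightarrow> 'a \<Rightarrow> real) \<Rightarrow> real \<Rightarrow> ('a \<Rightarrow> real) set" where
  "eigenspace \<mu> T \<kappa> = {g \<in> L2_space \<mu>. AE x in \<mu>. T g x = \<kappa> * g x}"

definition L2_independent :: "'a measure \<Rightarrow> nat \<Rightarrow> (nat \<Rightarrow> 'a \<Rightarrow> real) \<Rightarrow> bool" where
  "L2_independent \<mu> k f \<longleftrightarrow>
     (\<forall>c :: nat \<Rightarrow> real. (AE x in \<mu>. (\<Sum>i<k. c i * f i x) = 0) \<longrightarrow> (\<forall>i<k. c i = 0))"

text \<open>The dimension of the eigenspace as a subspace of \<open>L\<^sup>2\<close>; it is \<open>0\<close> if \<open>\<kappa>\<close> is not an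
  eigenvalue.\<close>

definition eigen_multiplicity ::
  "'a measure \<Rightarrow> (('a \<Rightarrow> real) \<Rightarrow> 'a \<Rightarrow> real) \<Rightarrow> real \<Rightarrow> enat" where
  "eigen_multiplicity \<mu> T \<kappa> =
     Sup {enat k | k. \<exists>f. (\<forall>i<k. f i \<in> eigenspace \<mu> T \<kappa>) \<and> L2_independent \<mu> k f}"

text \<open>\<open>lam 1 \<ge> lam 2 \<ge> \<dots>\<close> lists the positive eigenvalues of \<open>T\<close>, each as often as its
  multiplicity. If there are only \<open>J\<close> of them, this forces \<open>lam j = 0\<close> for all \<open>j > J\<close>. The
  index starts at \<open>1\<close>; the value \<open>lam 0\<close> is irrelevant.\<close>

definition positive_eigenvalues ::
  "'a measure \<Rightarrow> (('a \<Rightarrow> real) \<Rightarrow> 'a \<Rightarrow> real) \<Rightarrow> (nat \<Rightarrow> real) \<Rightarrow> bool" where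
  "positive_eigenvalues \<mu> T lam \<longleftrightarrow>
     (\<forall>i\<ge>1. \<forall>j\<ge>i. lam j \<le> lam i) \<and> (\<forall>j\<ge>1. 0 \<le> lam j) \<and>
     (\<forall>\<kappa>>0. finite {j. 1 \<le> j \<and> lam j = \<kappa>} \<and>
            enat (card {j. 1 \<le> j \<and> lam j = \<kappa>}) = eigen_multiplicity \<mu> T \<kappa>)"

definition orthonormal_eigenfunctions ::
  "'a measure \<Rightarrow> (('a \<Rightarrow> real) \<Rightarrow> 'a \<Rightarrow> real) \<Rightarrow> (nat \<Rightarrow> real) \<Rightarrow> (nat \<Rightarrow> 'a \<Rightarrow> real) \<Rightarrow> bool" where
  "orthonormal_eigenfunctions \<mu> T lam u \<longleftrightarrow>
     (\<forall>j\<ge>1. lam j > 0 \<longrightarrow> u j \<in> eigenspace \<mu> T (lam j)) \<and>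
     (\<forall>i\<ge>1. \<forall>j\<ge>1. lam i > 0 \<longrightarrow> lam j > 0 \<longrightarrow>
        (\<integral>x. u i x * u j x \<partial>\<mu>) = (if i = j then 1 else 0))"

section \<open>MDS maps\<close>

text \<open>The coordinates of \<open>real ^ 'm\<close> are numbered \<open>1, \<dots>, CARD('m)\<close> by a bijection \<open>idx\<close>. For
  \<open>j > J\<close> the function \<open>u j\<close> is unconstrained, and the component is \<open>0\<close> because \<open>lam j = 0\<close>.\<close>

definition mds_map ::
  "('m::finite \<Rightarrow> nat) \<Rightarrow> 'a set \<Rightarrow> ('a \<Rightarrow> 'a \<Rightarrow> real) \<Rightarrow> 'a measure \<Rightarrow> ('a \<Rightarrow> real ^ 'm) \<Rightarrow> bool" where
  "mds_map idx X d \<mu> M \<longleftrightarrow>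
     (\<exists>lam u. positive_eigenvalues \<mu> (mds_op d \<mu>) lam \<and>
        orthonormal_eigenfunctions \<mu> (mds_op d \<mu>) lam u \<and>
        (\<forall>x\<in>X. M x = (\<chi> i. sqrt (lam (idx i)) * u (idx i) x)))"

definition L2_norm :: "'c measure \<Rightarrow> ('c \<Rightarrow> real ^ 'm) \<Rightarrow> ennreal" where
  "L2_norm \<gamma> F = ennreal_rpow (\<integral>\<^sup>+ z. ennreal ((norm (F z))\<^sup>2) \<partial>\<gamma>) (1 / 2)"

definition sign_diagonal :: "real ^ 'm ^ 'm \<Rightarrow> bool" where
  "sign_diagonal D \<longleftrightarrow> (\<forall>i j. i \<noteq> j \<longrightarrow> D $ i $ j = 0) \<and> (\<forall>i. D $ i $ i \<in> {-1, 1})"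

end

theory Submission
  imports Defs "HOL-Library.Diagonal_Subsequence"
begin

text \<open>All operators are lifted along the projections to the single Hilbert space \<open>L\<^sup>2(\<gamma>)\<close>,
  where convergence of the \<open>GW\<^sub>4\<close> cost bounds the Hilbert--Schmidt distance \<open>\<epsilon>\<^sub>n\<close> of the centered
  kernels. Let \<open>A\<^sub>n = (\<langle>u\<^sub>j, u\<^sup>n\<^sub>i\<rangle>)\<close> be the matrix of inner products of the first \<open>m\<close> lifted eigenfunctions.
  Applying Ky Fan's maximum principle once to \<open>T\<^sub>n\<close> with the functions \<open>u\<^sub>j\<close> and once to \<open>T\<close> with the
  functions \<open>u\<^sup>n\<^sub>i\<close> yields
  \<open>(\<lambda>\<^sub>m - \<lambda>\<^sub>m\<^sub>+\<^sub>1) (m - \<parallel>A\<^sub>n\<parallel>\<^sup>2) \<le> 2 m \<epsilon>\<^sub>n\<close> for the Frobenius norm, so \<open>A\<^sub>n A\<^sub>n\<^sup>T\<close> tends to the identity and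
  \<open>A\<^sub>n\<close> is close to an orthogonal matrix \<open>Q\<^sub>n\<close>. No convergence of eigenvalues is needed beforehand: the estimate
  \<open>\<bar>(\<lambda>\<^sub>j - \<lambda>\<^sup>n\<^sub>i) \<langle>u\<^sub>j, u\<^sup>n\<^sub>i\<rangle>\<bar> \<le> \<epsilon>\<^sub>n\<close> controls the weights \<open>\<surd>\<lambda>\<close>. For simple eigenvalues the gap
  estimate holds for every \<open>k \<le> m\<close>, which forces \<open>A\<^sub>n\<close> to become diagonal.

  The Rayleigh bound on the complement of the first eigenfunctions needs the existence of
  eigenfunctions. Here compactness is elementary: \<open>x \<mapsto> k(x, \<cdot>)\<close> is continuous into \<open>L\<^sup>2\<close> and \<open>X\<close> is
  separable, so the images of a bounded sequence converge pointwise along a diagonal subsequence.\<close>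

section \<open>Symmetric forms and spectral systems\<close>

text \<open>The obstacle is that every space carries its own L2 space and that only a list of
  positive eigenvalues is given, without any spectral decomposition. Operators therefore enter only
  through bilinear forms on functions, and completeness of the list is condensed into one property:
  on the complement of the first \<open>k\<close> eigenfunctions the form is at most
  \<open>lam (Suc k)\<close> times the squared norm. Lifting creates no new positive eigenvalue,
  because the lifted operator takes values in functions of \<open>\<pi> z\<close>. In the gap
  estimate one Ky Fan inequality bounds the sum of the first eigenvalues of one operator by that of
  the other, and the second bounds it back while keeping a deficit; the two sums cancel, hence no
  limit of \<open>lam'\<close> ever enters. The weights are compared through a - b = (sqrt a - sqrt
  b)(sqrt a + sqrt b), with sqrt \<open>lam j\<close> alone as lower bound of the last factor, so
  that \<open>lam'\<close> may come close to 0. The kernel error is measured before centering, since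
  centering is a contraction.\<close>

locale symmetric_form =
  fixes V :: "('z \<Rightarrow> real) set" and B :: "('z \<Rightarrow> real) \<Rightarrow> ('z \<Rightarrow> real) \<Rightarrow> real"
  assumes zero_mem: "(\<lambda>_. 0) \<in> V"
    and add_mem: "f \<in> V \<Longrightarrow> g \<in> V \<Longrightarrow> (\<lambda>z. f z + g z) \<in> V"
    and scale_mem: "f \<in> V \<Longrightarrow> (\<lambda>z. c * f z) \<in> V"
    and commute: "f \<in> V \<Longrightarrow> g \<in> V \<Longrightarrow> B f g = B g f"
    and add_left: "f \<in> V \<Longrightarrow> g \<in> V \<Longrightarrow> h \<in> V \<Longrightarrow> B (\<lambda>z. f z + g z) h = B f h + B g h"
    and scale_left: "f \<in> V \<Longrightarrow> g \<in> V \<Longrightarrow> B (\<lambda>z. c * f z) g = c * B f g"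
begin

lemma diff_mem: "f \<in> V \<Longrightarrow> g \<in> V \<Longrightarrow> (\<lambda>z. f z - g z) \<in> V"
  using add_mem[OF _ scale_mem, of f g "-1"] by simp

lemma diff_left: "f \<in> V \<Longrightarrow> g \<in> V \<Longrightarrow> h \<in> V \<Longrightarrow> B (\<lambda>z. f z - g z) h = B f h - B g h"
  using add_left[OF _ scale_mem, of f g h "-1"] scale_left[of g h "-1"] by simp

lemma zero_left: "f \<in> V \<Longrightarrow> B (\<lambda>_. 0) f = 0"
  using scale_left[OF zero_mem, of f 0] by simp

lemma add_right: "f \<in> V \<Longrightarrow> g \<in> V \<Longrightarrow> h \<in> V \<Longrightarrow> B h (\<lambda>z. f z + g z) = B h f + B h g"
  using add_left add_mem commute by simp

lemma scale_right: "f \<in> V \<Longrightarrow> g \<in> V \<Longrightarrow> B g (\<lambda>z. c * f z) = c * B g f"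
  using scale_left scale_mem commute by simp

lemma diff_right: "f \<in> V \<Longrightarrow> g \<in> V \<Longrightarrow> h \<in> V \<Longrightarrow> B h (\<lambda>z. f z - g z) = B h f - B h g"
  using diff_left diff_mem commute by simp

lemma lincomb_mem:
  assumes "\<And>i. i \<in> I \<Longrightarrow> u i \<in> V"
  shows "(\<lambda>z. \<Sum>i\<in>I. c i * u i z) \<in> V"
  using assms by (induction I rule: infinite_finite_induct) (simp_all add: zero_mem add_mem scale_mem)

lemma lincomb_left:
  assumes "\<And>i. i \<in> I \<Longrightarrow> u i \<in> V" "g \<in> V"
  shows "B (\<lambda>z. \<Sum>i\<in>I. c i * u i z) g = (\<Sum>i\<in>I. c i * B (u i) g)"
  using assms(1)
proof (induction I rule: infinite_finite_induct)
  case (insert x F)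
  then have "(\<lambda>z. \<Sum>i\<in>F. c i * u i z) \<in> V" by (intro lincomb_mem) auto
  with insert assms(2) show ?case
    by (simp add: add_left scale_left scale_mem)
qed (auto simp: zero_left assms(2))

lemma lincomb_right:
  assumes "\<And>i. i \<in> I \<Longrightarrow> u i \<in> V" "g \<in> V"
  shows "B g (\<lambda>z. \<Sum>i\<in>I. c i * u i z) = (\<Sum>i\<in>I. c i * B g (u i))"
proof -
  have "B g (\<lambda>z. \<Sum>i\<in>I. c i * u i z) = B (\<lambda>z. \<Sum>i\<in>I. c i * u i z) g"
    using assms lincomb_mem by (intro commute) auto
  also have "\<dots> = (\<Sum>i\<in>I. c i * B g (u i))"
    using assms by (simp add: lincomb_left commute)
  finally show ?thesis .
qed

text \<open>Coefficients are arbitrary and the \<open>u i\<close> general, so that the expansion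
  serves both projection residuals and the difference of two MDS coordinates.\<close>

lemma residual_square:
  assumes u: "\<And>i. i \<in> I \<Longrightarrow> u i \<in> V" and f: "f \<in> V"
  shows "B (\<lambda>z. f z - (\<Sum>i\<in>I. c i * u i z)) (\<lambda>z. f z - (\<Sum>i\<in>I. c i * u i z))
    = B f f - 2 * (\<Sum>i\<in>I. c i * B (u i) f) + (\<Sum>i\<in>I. c i * (\<Sum>j\<in>I. c j * B (u i) (u j)))"
proof -
  define s where "s = (\<lambda>z. \<Sum>i\<in>I. c i * u i z)"
  have s: "s \<in> V" unfolding s_def by (rule lincomb_mem) (rule u)
  have "B (\<lambda>z. f z - s z) (\<lambda>z. f z - s z) = B f f - 2 * B s f + B s s"
    using s f by (simp add: diff_left diff_right diff_mem commute)
  moreover have left: "B s g = (\<Sum>i\<in>I. c i * B (u i) g)" if "g \<in> V" for g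
    unfolding s_def using u that by (rule lincomb_left)
  moreover have "B s s = (\<Sum>i\<in>I. c i * (\<Sum>j\<in>I. c j * B (u i) (u j)))"
    unfolding left[OF s] unfolding s_def using u by (simp add: lincomb_right)
  ultimately show ?thesis using f by (simp add: s_def)
qed

text \<open>Positivity is a hypothesis here and not part of the locale: besides the inner product,
  the lemma has to cover \<open>s * l2_inner N f g - B f g\<close>, which is nonnegative only on an
  orthogonal complement and only because \<open>s\<close> is a supremum.\<close>

lemma Cauchy_Schwarz_on:
  assumes W: "symmetric_form W B" and "W \<subseteq> V"
    and pos: "\<And>f. f \<in> W \<Longrightarrow> 0 \<le> B f f" and f: "f \<in> W" and g: "g \<in> W"
  shows "(B f g)\<^sup>2 \<le> B f f * B g g"
proof -
  interpret W: symmetric_form W B by fact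
  have *: "0 \<le> B f f - 2 * t * B f g + t\<^sup>2 * B g g" for t
  proof -
    have "0 \<le> B (\<lambda>z. f z - t * g z) (\<lambda>z. f z - t * g z)"
      using f g by (intro pos W.diff_mem W.scale_mem)
    also have "\<dots> = B f f - 2 * t * B f g + t\<^sup>2 * B g g"
      using f g by (simp add: W.diff_left W.diff_right W.diff_mem W.scale_mem W.scale_left
          W.scale_right W.commute[of g f] algebra_simps power2_eq_square)
    finally show ?thesis .
  qed
  show ?thesis
  proof (cases "B g g = 0")
    case True
    have "B f g = 0"
    proof (rule ccontr)
      assume n: "B f g \<noteq> 0"
      \<comment> \<open>With \<open>B g g = 0\<close> the quadratic is affine in \<open>t\<close>;
        this \<open>t\<close> gives it the value -1.\<close>
      from *[of "(B f f + 1) / (2 * B f g)"] True n show False by simp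
    qed
    with True show ?thesis by simp
  next
    case False
    with pos[OF g] have p: "0 < B g g" by simp
    \<comment> \<open>The minimizer of the quadratic in \<open>t\<close>.\<close>
    from *[of "B f g / B g g"] p show ?thesis
      by (simp add: field_simps power2_eq_square)
  qed
qed

end

locale semi_inner = symmetric_form V ip
  for V :: "('z \<Rightarrow> real) set" and ip :: "('z \<Rightarrow> real) \<Rightarrow> ('z \<Rightarrow> real) \<Rightarrow> real" +
  assumes nonneg: "f \<in> V \<Longrightarrow> 0 \<le> ip f f"
begin

lemma Cauchy_Schwarz: "f \<in> V \<Longrightarrow> g \<in> V \<Longrightarrow> (ip f g)\<^sup>2 \<le> ip f f * ip g g"
  by (rule Cauchy_Schwarz_on[of V]) (auto intro: nonneg symmetric_form_axioms)

text \<open>Systems that are orthonormal up to null vectors: a null vector pads an eigenfunction list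
  beyond the last positive eigenvalue.\<close>

lemma null_right: "f \<in> V \<Longrightarrow> g \<in> V \<Longrightarrow> ip g g = 0 \<Longrightarrow> ip f g = 0"
  using Cauchy_Schwarz[of f g] by simp

text \<open>The \<open>u i\<close> diagonalize \<open>B\<close>, so the quadratic term of
  \<open>residual_square\<close> is half the mixed one. The predicate \<open>p\<close> marks the
  unit vectors among the \<open>u i\<close>; the others are null.\<close>

lemma eigen_residual:
  assumes B: "symmetric_form V B" and fin: "finite I"
    and u: "\<And>i. i \<in> I \<Longrightarrow> u i \<in> V" and f: "f \<in> V"
    and orth: "\<And>i j. i \<in> I \<Longrightarrow> j \<in> I \<Longrightarrow> ip (u i) (u j) = (if i = j \<and> p i then 1 else 0)"
    and eig: "\<And>i g. i \<in> I \<Longrightarrow> g \<in> V \<Longrightarrow> B (u i) g = l i * ip (u i) g"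
  defines "h \<equiv> \<lambda>z. f z - (\<Sum>i\<in>I. ip f (u i) * u i z)"
  shows "B h h = B f f - (\<Sum>i\<in>I. l i * (ip f (u i))\<^sup>2)"
proof -
  interpret B: symmetric_form V B by fact
  have "ip f (u i) * (\<Sum>j\<in>I. ip f (u j) * B (u i) (u j)) = l i * (ip f (u i))\<^sup>2" if i: "i \<in> I" for i
  proof -
    have "(\<Sum>j\<in>I. ip f (u j) * B (u i) (u j)) = (\<Sum>j\<in>I. if j = i then ip f (u i) * (if p i then l i else 0) else 0)"
      using i u by (intro sum.cong refl) (auto simp: eig orth)
    also have "\<dots> = ip f (u i) * (if p i then l i else 0)"
      using i fin by simp
    finally have 1: "(\<Sum>j\<in>I. ip f (u j) * B (u i) (u j)) = ip f (u i) * (if p i then l i else 0)" .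
    \<comment> \<open>The coefficient of \<open>f\<close> at a null vector vanishes, so the summand
      may carry \<open>l i\<close> without a case distinction on \<open>p i\<close>.\<close>
    have "ip f (u i) = 0" if "\<not> p i"
      using that null_right[OF f u[OF i]] orth[OF i i] by simp
    with 1 show ?thesis by (auto simp: power2_eq_square)
  qed
  moreover have "ip f (u i) * B (u i) f = l i * (ip f (u i))\<^sup>2" if i: "i \<in> I" for i
    using eig[OF i f] commute[OF u[OF i] f] by (simp add: power2_eq_square)
  ultimately show ?thesis
    unfolding h_def using B.residual_square[of I u f "\<lambda>i. ip f (u i)"] u f by simp
qed

lemma residual_orthogonal:
  assumes fin: "finite I" and u: "\<And>i. i \<in> I \<Longrightarrow> u i \<in> V" and f: "f \<in> V"
    and orth: "\<And>i j. i \<in> I \<Longrightarrow> j \<in> I \<Longrightarrow> ip (u i) (u j) = (if i = j \<and> p i then 1 else 0)"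
    and k: "k \<in> I"
  shows "ip (\<lambda>z. f z - (\<Sum>i\<in>I. ip f (u i) * u i z)) (u k) = 0"
proof -
  have "(\<Sum>j\<in>I. ip f (u j) * ip (u j) (u k)) = (\<Sum>j\<in>I. if j = k then ip f (u k) * (if p k then 1 else 0) else 0)"
    using k by (intro sum.cong refl) (auto simp: orth)
  also have "\<dots> = ip f (u k) * (if p k then 1 else 0)"
    using k fin by simp
  also have "\<dots> = ip f (u k)"
    using null_right[OF f u[OF k]] orth[OF k k] by simp
  finally show ?thesis
    using u f k lincomb_mem[of I u] by (simp add: diff_left lincomb_left)
qed

lemma residual_mem:
  assumes u: "\<And>i. i \<in> I \<Longrightarrow> u i \<in> V" and f: "f \<in> V"
  shows "(\<lambda>z. f z - (\<Sum>i\<in>I. c i * u i z)) \<in> V"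
  using u f by (intro diff_mem lincomb_mem)

text \<open>For the form \<open>ip\<close> itself every \<open>u i\<close> is an eigenvector for the
  value 1, and the residual has nonnegative square.\<close>

lemma Bessel:
  assumes fin: "finite I" and u: "\<And>i. i \<in> I \<Longrightarrow> u i \<in> V" and f: "f \<in> V"
    and orth: "\<And>i j. i \<in> I \<Longrightarrow> j \<in> I \<Longrightarrow> ip (u i) (u j) = (if i = j \<and> p i then 1 else 0)"
  shows "(\<Sum>i\<in>I. (ip f (u i))\<^sup>2) \<le> ip f f"
  using eigen_residual[where B = ip and I = I and u = u and f = f and p = p and l = "\<lambda>_. 1", OF symmetric_form_axioms] assms
    nonneg[OF residual_mem[where I = I and u = u and f = f and c = "\<lambda>i. ip f (u i)"]] by simp

end

text \<open>\<open>v j\<close> is a unit eigenvector if \<open>lam j\<close> is positive and a null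
  vector otherwise. The assumption \<open>rayleigh\<close> is what makes the list complete. For
  \<open>k = 0\<close> it bounds \<open>B\<close> globally by \<open>lam 1\<close>.\<close>

locale spectral_system = semi_inner V ip
  for V :: "('z \<Rightarrow> real) set" and ip +
  fixes B :: "('z \<Rightarrow> real) \<Rightarrow> ('z \<Rightarrow> real) \<Rightarrow> real"
    and lam :: "nat \<Rightarrow> real" and v :: "nat \<Rightarrow> 'z \<Rightarrow> real"
  assumes form: "symmetric_form V B"
    and v_mem: "1 \<le> j \<Longrightarrow> v j \<in> V"
    and v_orth: "1 \<le> i \<Longrightarrow> 1 \<le> j \<Longrightarrow> ip (v i) (v j) = (if i = j \<and> 0 < lam i then 1 else 0)"
    and eigen: "1 \<le> j \<Longrightarrow> g \<in> V \<Longrightarrow> B (v j) g = lam j * ip (v j) g"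
    and decreasing: "1 \<le> i \<Longrightarrow> i \<le> j \<Longrightarrow> lam j \<le> lam i"
    and lam_nonneg: "1 \<le> j \<Longrightarrow> 0 \<le> lam j"
    and rayleigh: "h \<in> V \<Longrightarrow> (\<And>i. i \<in> {1..k} \<Longrightarrow> ip h (v i) = 0) \<Longrightarrow> B h h \<le> lam (Suc k) * ip h h"
begin

lemma v_norm_le: "1 \<le> i \<Longrightarrow> ip (v i) (v i) \<le> 1"
  by (simp add: v_orth)

lemma v_orth': "i \<in> {1..k} \<Longrightarrow> j \<in> {1..k} \<Longrightarrow> ip (v i) (v j) = (if i = j \<and> 0 < lam i then 1 else 0)"
  by (simp add: v_orth)

lemma Bessel_v: "f \<in> V \<Longrightarrow> (\<Sum>i\<in>{1..k}. (ip f (v i))\<^sup>2) \<le> ip f f"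
  by (rule Bessel[where p = "\<lambda>i. 0 < lam i", OF _ _ _ v_orth'[where k = k]]) (simp_all add: v_mem)

text \<open>Both \<open>B\<close> and \<open>ip\<close> split along the projection of
  \<open>f\<close> onto \<open>v 1\<close>, ..., \<open>v k\<close> and the residual, and
  \<open>rayleigh\<close> applies to the residual.\<close>

lemma form_le:
  assumes f: "f \<in> V"
  shows "B f f \<le> (\<Sum>j=1..k. (lam j - lam (Suc k)) * (ip f (v j))\<^sup>2) + lam (Suc k) * ip f f"
proof -
  define h where "h = (\<lambda>z. f z - (\<Sum>i=1..k. ip f (v i) * v i z))"
  have h: "h \<in> V" unfolding h_def using f by (intro residual_mem) (auto intro: v_mem)
  have "B h h \<le> lam (Suc k) * ip h h"
    using h by (rule rayleigh)
      (unfold h_def, rule residual_orthogonal[where p = "\<lambda>i. 0 < lam i", OF _ _ f v_orth'[where k = k]],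
        auto intro: v_mem)
  moreover have "B h h = B f f - (\<Sum>i=1..k. lam i * (ip f (v i))\<^sup>2)"
    unfolding h_def
    by (rule eigen_residual[where B = B and p = "\<lambda>i. 0 < lam i", OF form _ _ f v_orth'[where k = k]])
      (simp_all add: v_mem eigen)
  moreover have "ip h h = ip f f - (\<Sum>i=1..k. 1 * (ip f (v i))\<^sup>2)"
    unfolding h_def
    by (rule eigen_residual[where B = ip and p = "\<lambda>i. 0 < lam i",
          OF symmetric_form_axioms _ _ f v_orth'[where k = k]])
      (simp_all add: v_mem)
  ultimately show ?thesis
    by (simp add: algebra_simps sum_subtractf sum_distrib_left)
qed

text \<open>Sum of \<open>form_le\<close> over the \<open>f i\<close>. The subtracted deficit
  measures how far the \<open>f i\<close> are from spanning the leading eigenspace. Only norms enter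
  here; orthogonality is used later, through Bessel, to see that the deficit is nonnegative.\<close>

lemma Ky_Fan:
  assumes f: "\<And>i. i \<in> {1..k} \<Longrightarrow> f i \<in> V"
    and f1: "\<And>i. i \<in> {1..k} \<Longrightarrow> ip (f i) (f i) \<le> 1"
  shows "(\<Sum>i=1..k. B (f i) (f i)) \<le>
    (\<Sum>j=1..k. lam j) - (\<Sum>j=1..k. (lam j - lam (Suc k)) * (1 - (\<Sum>i=1..k. (ip (f i) (v j))\<^sup>2)))"
proof -
  have "(\<Sum>i=1..k. B (f i) (f i)) \<le>
     (\<Sum>i=1..k. (\<Sum>j=1..k. (lam j - lam (Suc k)) * (ip (f i) (v j))\<^sup>2) + lam (Suc k) * 1)"
  proof (rule sum_mono)
    fix i assume i: "i \<in> {1..k}"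
    have "lam (Suc k) * ip (f i) (f i) \<le> lam (Suc k) * 1"
      by (intro mult_left_mono f1 i lam_nonneg) auto
    with form_le[OF f[OF i], of k]
    show "B (f i) (f i) \<le> (\<Sum>j=1..k. (lam j - lam (Suc k)) * (ip (f i) (v j))\<^sup>2) + lam (Suc k) * 1"
      by simp
  qed
  also have "\<dots> = (\<Sum>j=1..k. (lam j - lam (Suc k)) * (\<Sum>i=1..k. (ip (f i) (v j))\<^sup>2)) + k * lam (Suc k)"
    unfolding sum.distrib sum_distrib_left by (subst sum.swap) simp
  also have "\<dots> = (\<Sum>j=1..k. lam j) - (\<Sum>j=1..k. (lam j - lam (Suc k)) * (1 - (\<Sum>i=1..k. (ip (f i) (v j))\<^sup>2)))"
    by (simp add: right_diff_distrib sum_subtractf)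
  finally show ?thesis .
qed

end

text \<open>\<open>close\<close> says that the operators behind the two forms differ by at most
  \<open>\<epsilon>\<close> in operator norm.\<close>

locale two_spectral_systems =
  S1: spectral_system V ip B lam v + S2: spectral_system V ip B' lam' v'
  for V :: "('z \<Rightarrow> real) set" and ip B lam v B' lam' v' +
  fixes \<epsilon> :: real
  assumes close: "f \<in> V \<Longrightarrow> g \<in> V \<Longrightarrow> ip f f \<le> 1 \<Longrightarrow> ip g g \<le> 1 \<Longrightarrow> \<bar>B f g - B' f g\<bar> \<le> \<epsilon>"
begin

lemma row_le: "1 \<le> j \<Longrightarrow> (\<Sum>i=1..k. (ip (v j) (v' i))\<^sup>2) \<le> 1"
  using S2.Bessel_v[OF S1.v_mem] S1.v_norm_le by (meson order_trans)

lemma col_le: "1 \<le> i \<Longrightarrow> (\<Sum>j=1..k. (ip (v j) (v' i))\<^sup>2) \<le> 1"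
proof -
  assume i: "1 \<le> i"
  have "(\<Sum>j=1..k. (ip (v j) (v' i))\<^sup>2) = (\<Sum>j=1..k. (ip (v' i) (v j))\<^sup>2)"
    using i by (intro sum.cong) (auto simp: S1.commute S1.v_mem S2.v_mem)
  also have "\<dots> \<le> 1"
    using S1.Bessel_v[OF S2.v_mem] S2.v_norm_le i by (meson order_trans)
  finally show ?thesis .
qed

text \<open>At the pair \<open>v j\<close>, \<open>v' i\<close> the first form gives
  \<open>lam j\<close> and the second \<open>lam' i\<close> times the inner product, and the two
  values differ by at most \<open>\<epsilon>\<close>.\<close>

lemma entry_bound:
  assumes "1 \<le> j" "1 \<le> i"
  shows "\<bar>(lam j - lam' i) * ip (v j) (v' i)\<bar> \<le> \<epsilon>"
proof -
  interpret f: symmetric_form V B' by (rule S2.form)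
  have "B (v j) (v' i) = lam j * ip (v j) (v' i)"
    using assms by (simp add: S1.eigen S2.v_mem)
  moreover have "B' (v j) (v' i) = lam' i * ip (v j) (v' i)"
    using assms S2.eigen[of i "v j"] f.commute[of "v j" "v' i"] S1.commute[of "v j" "v' i"]
    by (simp add: S1.v_mem S2.v_mem)
  ultimately show ?thesis
    using close[OF S1.v_mem S2.v_mem S1.v_norm_le S2.v_norm_le, OF assms(1,2,1,2)]
    by (simp add: algebra_simps)
qed

text \<open>Testing \<open>B'\<close> on the \<open>v j\<close> and \<open>B\<close> on the
  \<open>v' i\<close> costs \<open>k * \<epsilon>\<close> each time. The first test bounds the sum
  of the \<open>lam j\<close> by that of the \<open>lam' j\<close>; the second gives the reverse
  bound improved by the deficit, so only the deficit and \<open>2 * k * \<epsilon>\<close>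
  survive.\<close>

lemma gap:
  "(lam k - lam (Suc k)) * (\<Sum>j=1..k. 1 - (\<Sum>i=1..k. (ip (v j) (v' i))\<^sup>2)) \<le> 2 * k * \<epsilon>"
proof -
  let ?a = "\<lambda>j. \<Sum>i=1..k. (ip (v j) (v' i))\<^sup>2"
  have "0 \<le> \<epsilon>"
    using close[OF S1.zero_mem S1.zero_mem] by (auto simp: S1.zero_left S1.zero_mem)
  have lam_pair: "B (v j) (v j) = lam j" if "1 \<le> j" for j
    using S1.lam_nonneg[OF that] that by (simp add: S1.eigen S1.v_mem S1.v_orth)
  have lam'_pair: "B' (v' j) (v' j) = lam' j" if "1 \<le> j" for j
    using S2.lam_nonneg[OF that] that by (simp add: S2.eigen S2.v_mem S2.v_orth)
  have "(\<Sum>j=1..k. lam j) - k * \<epsilon> = (\<Sum>j=1..k. B (v j) (v j) - \<epsilon>)"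
    by (simp add: sum_subtractf lam_pair)
  also have "\<dots> \<le> (\<Sum>j=1..k. B' (v j) (v j))"
  proof (rule sum_mono)
    fix j assume "j \<in> {1..k}"
    with close[of "v j" "v j"] S1.v_norm_le[of j] S1.v_mem[of j] show "B (v j) (v j) - \<epsilon> \<le> B' (v j) (v j)"
      by simp
  qed
  also have "\<dots> \<le> (\<Sum>j=1..k. lam' j) -
      (\<Sum>j=1..k. (lam' j - lam' (Suc k)) * (1 - (\<Sum>i=1..k. (ip (v i) (v' j))\<^sup>2)))"
    by (rule S2.Ky_Fan) (auto intro: S1.v_mem S1.v_norm_le)
  also have "\<dots> \<le> (\<Sum>j=1..k. lam' j)"
  proof -
    have "0 \<le> (\<Sum>j=1..k. (lam' j - lam' (Suc k)) * (1 - (\<Sum>i=1..k. (ip (v i) (v' j))\<^sup>2)))"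
    proof (intro sum_nonneg mult_nonneg_nonneg)
      fix j assume j: "j \<in> {1..k}"
      then show "0 \<le> lam' j - lam' (Suc k)" using S2.decreasing[of j "Suc k"] by simp
      show "0 \<le> 1 - (\<Sum>i=1..k. (ip (v i) (v' j))\<^sup>2)"
        using j col_le[of j] by simp
    qed
    then show ?thesis by simp
  qed
  finally have 1: "(\<Sum>j=1..k. lam j) - k * \<epsilon> \<le> (\<Sum>j=1..k. lam' j)" .
  have "(\<Sum>j=1..k. lam' j) - k * \<epsilon> = (\<Sum>j=1..k. B' (v' j) (v' j) - \<epsilon>)"
    by (simp add: sum_subtractf lam'_pair)
  also have "\<dots> \<le> (\<Sum>j=1..k. B (v' j) (v' j))"
  proof (rule sum_mono)
    fix j assume "j \<in> {1..k}"
    with close[of "v' j" "v' j"] S2.v_norm_le[of j] S2.v_mem[of j] show "B' (v' j) (v' j) - \<epsilon> \<le> B (v' j) (v' j)"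
      by simp
  qed
  also have "\<dots> \<le> (\<Sum>j=1..k. lam j) -
      (\<Sum>j=1..k. (lam j - lam (Suc k)) * (1 - (\<Sum>i=1..k. (ip (v' i) (v j))\<^sup>2)))"
    by (rule S1.Ky_Fan) (auto intro: S2.v_mem S2.v_norm_le)
  also have "(\<Sum>j=1..k. (lam j - lam (Suc k)) * (1 - (\<Sum>i=1..k. (ip (v' i) (v j))\<^sup>2)))
     = (\<Sum>j=1..k. (lam j - lam (Suc k)) * (1 - ?a j))"
    by (simp add: S1.commute[OF S2.v_mem S1.v_mem])
  finally have "(\<Sum>j=1..k. (lam j - lam (Suc k)) * (1 - ?a j)) \<le> 2 * k * \<epsilon>"
    using 1 by simp
  \<comment> \<open>All row deficits are nonnegative, so each weight may be lowered to the smallest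
    one, the gap at \<open>k\<close>.\<close>
  moreover have "(lam k - lam (Suc k)) * (\<Sum>j=1..k. 1 - ?a j) \<le> (\<Sum>j=1..k. (lam j - lam (Suc k)) * (1 - ?a j))"
    unfolding sum_distrib_left
  proof (rule sum_mono)
    fix j assume j: "j \<in> {1..k}"
    show "(lam k - lam (Suc k)) * (1 - ?a j) \<le> (lam j - lam (Suc k)) * (1 - ?a j)"
      using j row_le[of j k] S1.decreasing[of j k] by (intro mult_right_mono) auto
  qed
  ultimately show ?thesis by simp
qed

text \<open>Polarization: Bessel for \<open>v j + v k\<close> and \<open>v j - v k\<close>, both of
  squared norm at most 2.\<close>

lemma row_products:
  assumes "1 \<le> j" "1 \<le> k" "j \<noteq> k"
  shows "2 * \<bar>\<Sum>i=1..m. ip (v j) (v' i) * ip (v k) (v' i)\<bar>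
    \<le> 2 - (\<Sum>i=1..m. (ip (v j) (v' i))\<^sup>2) - (\<Sum>i=1..m. (ip (v k) (v' i))\<^sup>2)"
proof -
  have *: "(\<Sum>i=1..m. (ip (v j) (v' i))\<^sup>2) + (\<Sum>i=1..m. (ip (v k) (v' i))\<^sup>2)
      + 2 * t * (\<Sum>i=1..m. ip (v j) (v' i) * ip (v k) (v' i)) \<le> 2" if t: "t\<^sup>2 = 1" for t
  proof -
    let ?f = "\<lambda>z. v j z + t * v k z"
    have f: "?f \<in> V" using assms by (intro S1.add_mem S1.scale_mem S1.v_mem)
    have "(\<Sum>i=1..m. (ip ?f (v' i))\<^sup>2) \<le> ip ?f ?f" by (rule S2.Bessel_v[OF f])
    also have "ip ?f ?f = ip (v j) (v j) + t\<^sup>2 * ip (v k) (v k)"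
      using assms by (simp add: S1.add_left S1.add_right S1.scale_left S1.scale_right S1.v_mem
          S1.scale_mem S1.add_mem S1.v_orth power2_eq_square)
    also have "\<dots> \<le> 2" using S1.v_norm_le[of j] S1.v_norm_le[of k] assms t by simp
    also have "(\<Sum>i=1..m. (ip ?f (v' i))\<^sup>2) =
       (\<Sum>i=1..m. (ip (v j) (v' i))\<^sup>2 + t\<^sup>2 * (ip (v k) (v' i))\<^sup>2 + 2 * t * (ip (v j) (v' i) * ip (v k) (v' i)))"
      using assms by (intro sum.cong refl)
        (simp add: S1.add_left S1.scale_left S1.v_mem S2.v_mem S1.scale_mem power2_eq_square algebra_simps)
    also have "\<dots> = (\<Sum>i=1..m. (ip (v j) (v' i))\<^sup>2) + (\<Sum>i=1..m. (ip (v k) (v' i))\<^sup>2)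
      + 2 * t * (\<Sum>i=1..m. ip (v j) (v' i) * ip (v k) (v' i))"
      by (simp add: sum.distrib sum_distrib_left t)
    finally show ?thesis .
  qed
  from *[of 1] *[of "-1"] show ?thesis by simp
qed

text \<open>With \<open>R\<close> the \<open>j\<close>-th row of a matrix, \<open>F\<close> is the
  \<open>j\<close>-th coordinate of the difference of the MDS maps. Completing the square separates
  the part of \<open>v j\<close> outside the span of the \<open>v' i\<close> from the mismatch of
  coefficients.\<close>

lemma map_distance:
  fixes R :: "nat \<Rightarrow> real" and m :: nat
  assumes j: "1 \<le> j" "0 < lam j"
  defines "F \<equiv> \<lambda>z. sqrt (lam j) * v j z - (\<Sum>i=1..m. (R i * sqrt (lam' i)) * v' i z)"
  shows "ip F F = lam j * (1 - (\<Sum>i=1..m. (ip (v j) (v' i))\<^sup>2))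
    + (\<Sum>i=1..m. (sqrt (lam j) * ip (v j) (v' i) - R i * sqrt (lam' i))\<^sup>2)"
proof -
  let ?c = "\<lambda>i. R i * sqrt (lam' i)"
  let ?A = "\<lambda>i. ip (v j) (v' i)"
  have vj: "v j \<in> V" using j(1) by (rule S1.v_mem)
  have "(\<Sum>l=1..m. ?c l * ip (v' i) (v' l)) = ?c i" if i: "i \<in> {1..m}" for i
  proof -
    have "(\<Sum>l=1..m. ?c l * ip (v' i) (v' l)) = (\<Sum>l=1..m. if l = i then ?c i else 0)"
    proof (intro sum.cong refl)
      fix l assume l: "l \<in> {1..m}"
      \<comment> \<open>Where \<open>v' i\<close> is null, \<open>?c i\<close> contains sqrt 0 and
        vanishes too, so the diagonal term is still \<open>?c i\<close>.\<close>
      have "lam' i = 0" if "\<not> 0 < lam' i" using that S2.lam_nonneg[of i] i by simp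
      then show "?c l * ip (v' i) (v' l) = (if l = i then ?c i else 0)"
        using i l S2.v_orth'[OF i l] by auto
    qed
    with i show ?thesis by simp
  qed
  moreover have "ip (v' i) (\<lambda>z. sqrt (lam j) * v j z) = sqrt (lam j) * ?A i" if "i \<in> {1..m}" for i
    using that vj S2.v_mem[of i] by (simp add: S1.scale_right S1.commute)
  moreover have "ip (\<lambda>z. sqrt (lam j) * v j z) (\<lambda>z. sqrt (lam j) * v j z) = lam j"
    using vj j by (simp add: S1.scale_right S1.scale_left S1.scale_mem S1.v_orth)
  ultimately have "ip F F = lam j - 2 * (\<Sum>i=1..m. ?c i * (sqrt (lam j) * ?A i)) + (\<Sum>i=1..m. ?c i * ?c i)"
    unfolding F_def using S1.residual_square[of "{1..m}" v' "\<lambda>z. sqrt (lam j) * v j z" ?c]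
      S1.scale_mem[OF vj] S2.v_mem by simp
  also have "\<dots> = lam j - (\<Sum>i=1..m. lam j * (?A i)\<^sup>2) + (\<Sum>i=1..m. (sqrt (lam j) * ?A i - ?c i)\<^sup>2)"
  proof -
    have "(sqrt (lam j) * ?A i - ?c i)\<^sup>2 = lam j * (?A i)\<^sup>2 - 2 * (?c i * (sqrt (lam j) * ?A i)) + ?c i * ?c i" for i
      using j by (simp add: power2_diff power_mult_distrib) (simp add: power2_eq_square algebra_simps)
    then show ?thesis
      by (simp add: sum.distrib sum_subtractf sum_distrib_left)
  qed
  finally show ?thesis by (simp add: right_diff_distrib sum_distrib_left)
qed

end

section \<open>Square-integrable functions and kernel forms\<close>

lemma tendsto_zero_bound:
  fixes f g :: "nat \<Rightarrow> real"
  assumes "g \<longlonglongrightarrow> 0" and "\<And>n. \<bar>f n\<bar> \<le> g n"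
  shows "f \<longlonglongrightarrow> 0"
  by (rule Lim_null_comparison[OF _ assms(1)]) (use assms(2) in simp)

definition l2_inner :: "'z measure \<Rightarrow> ('z \<Rightarrow> real) \<Rightarrow> ('z \<Rightarrow> real) \<Rightarrow> real" where
  "l2_inner N f g = (\<integral>z. f z * g z \<partial>N)"

lemma L2_spaceI [intro?]: "f \<in> borel_measurable N \<Longrightarrow> integrable N (\<lambda>z. (f z)\<^sup>2) \<Longrightarrow> f \<in> L2_space N"
  by (simp add: L2_space_def)

lemma L2_measurable: "f \<in> L2_space N \<Longrightarrow> f \<in> borel_measurable N"
  by (simp add: L2_space_def)

lemma L2_integrable_square: "f \<in> L2_space N \<Longrightarrow> integrable N (\<lambda>z. (f z)\<^sup>2)"
  by (simp add: L2_space_def)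

lemma L2_bound:
  assumes "f \<in> borel_measurable N" "g \<in> L2_space N" "\<And>z. z \<in> space N \<Longrightarrow> \<bar>f z\<bar> \<le> \<bar>g z\<bar>"
  shows "f \<in> L2_space N"
proof
  show "integrable N (\<lambda>z. (f z)\<^sup>2)"
  proof (rule Bochner_Integration.integrable_bound[OF L2_integrable_square[OF assms(2)]])
    show "(\<lambda>z. (f z)\<^sup>2) \<in> borel_measurable N" using assms(1) by measurable
    show "AE z in N. norm ((f z)\<^sup>2) \<le> norm ((g z)\<^sup>2)"
    proof (rule AE_I2)
      fix z assume "z \<in> space N"
      then have "\<bar>f z\<bar>\<^sup>2 \<le> \<bar>g z\<bar>\<^sup>2" using assms(3) by (intro power_mono) auto
      then show "norm ((f z)\<^sup>2) \<le> norm ((g z)\<^sup>2)" by simp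
    qed
  qed
qed fact

lemma L2_cong: "f \<in> L2_space N \<Longrightarrow> (\<And>z. z \<in> space N \<Longrightarrow> f z = g z) \<Longrightarrow> g \<in> L2_space N"
  unfolding L2_space_def using measurable_cong[of N f g borel]
    Bochner_Integration.integrable_cong[of N N "\<lambda>z. (f z)\<^sup>2" "\<lambda>z. (g z)\<^sup>2"] by auto

lemma L2_integrable_mult:
  assumes "f \<in> L2_space N" "g \<in> L2_space N"
  shows "integrable N (\<lambda>z. f z * g z)"
proof (rule Bochner_Integration.integrable_bound)
  show "integrable N (\<lambda>z. (f z)\<^sup>2 + (g z)\<^sup>2)"
    using assms by (intro Bochner_Integration.integrable_add L2_integrable_square)
  show "(\<lambda>z. f z * g z) \<in> borel_measurable N"
    using assms by (intro borel_measurable_times L2_measurable)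
  have "\<bar>a * b\<bar> \<le> a\<^sup>2 + b\<^sup>2" for a b :: real
  proof -
    have "2 * (\<bar>a\<bar> * \<bar>b\<bar>) \<le> a\<^sup>2 + b\<^sup>2"
      using sum_squares_bound[of "\<bar>a\<bar>" "\<bar>b\<bar>"] by (simp add: mult.assoc)
    moreover have "0 \<le> \<bar>a\<bar> * \<bar>b\<bar>" by (rule mult_nonneg_nonneg) auto
    ultimately show ?thesis unfolding abs_mult by linarith
  qed
  then show "AE z in N. norm (f z * g z) \<le> norm ((f z)\<^sup>2 + (g z)\<^sup>2)"
    by simp
qed

lemma L2_scale: "f \<in> L2_space N \<Longrightarrow> (\<lambda>z. c * f z) \<in> L2_space N"
  by (auto simp: L2_space_def power_mult_distrib)

lemma L2_add:
  assumes "f \<in> L2_space N" "g \<in> L2_space N"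
  shows "(\<lambda>z. f z + g z) \<in> L2_space N"
proof
  show "(\<lambda>z. f z + g z) \<in> borel_measurable N"
    using assms by (intro borel_measurable_add L2_measurable)
  have "integrable N (\<lambda>z. (f z)\<^sup>2 + (g z)\<^sup>2 + 2 * (f z * g z))"
    using assms by (intro Bochner_Integration.integrable_add L2_integrable_square integrable_mult_right L2_integrable_mult)
  then show "integrable N (\<lambda>z. (f z + g z)\<^sup>2)"
    by (simp add: power2_sum algebra_simps)
qed

lemma l2_inner_semi: "semi_inner (L2_space N) (l2_inner N)"
proof
  fix f g h :: "'a \<Rightarrow> real" and c :: real
  assume f: "f \<in> L2_space N"
  show "0 \<le> l2_inner N f f" by (simp add: l2_inner_def)
  show "(\<lambda>z. c * f z) \<in> L2_space N" using f by (rule L2_scale)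
  assume g: "g \<in> L2_space N"
  show "(\<lambda>z. f z + g z) \<in> L2_space N" using f g by (rule L2_add)
  show "l2_inner N f g = l2_inner N g f" unfolding l2_inner_def by (simp only: mult.commute)
  show "l2_inner N (\<lambda>z. c * f z) g = c * l2_inner N f g"
    unfolding l2_inner_def by (simp only: mult.assoc integral_mult_right_zero)
  assume h: "h \<in> L2_space N"
  show "l2_inner N (\<lambda>z. f z + g z) h = l2_inner N f h + l2_inner N g h"
    unfolding l2_inner_def distrib_right using f g h
    by (intro Bochner_Integration.integral_add L2_integrable_mult)
qed (simp add: L2_space_def)

interpretation l2: semi_inner "L2_space N" "l2_inner N" for N
  by (rule l2_inner_semi)

lemma L2_abs: "f \<in> L2_space N \<Longrightarrow> (\<lambda>z. \<bar>f z\<bar>) \<in> L2_space N"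
  by (auto simp: L2_space_def)

lemma l2_inner_abs: "l2_inner N (\<lambda>z. \<bar>f z\<bar>) (\<lambda>z. \<bar>f z\<bar>) = l2_inner N f f"
  by (simp add: l2_inner_def)

lemma l2_abs_le:
  assumes "f \<in> L2_space N" "g \<in> L2_space N"
  shows "\<bar>l2_inner N f g\<bar> \<le> sqrt (l2_inner N f f) * sqrt (l2_inner N g g)"
  using real_sqrt_le_mono[OF l2.Cauchy_Schwarz[OF assms]] by (simp add: real_sqrt_mult)

lemma l2_inner_cong:
  "(\<And>z. z \<in> space N \<Longrightarrow> f z = f' z) \<Longrightarrow> (\<And>z. z \<in> space N \<Longrightarrow> g z = g' z) \<Longrightarrow> l2_inner N f g = l2_inner N f' g'"
  unfolding l2_inner_def by (intro Bochner_Integration.integral_cong) auto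

lemma l2_norm_add_le:
  assumes "f \<in> L2_space N" "g \<in> L2_space N"
  shows "l2_inner N (\<lambda>z. f z + g z) (\<lambda>z. f z + g z) \<le> 2 * l2_inner N f f + 2 * l2_inner N g g"
proof -
  have "0 \<le> l2_inner N (\<lambda>z. f z - g z) (\<lambda>z. f z - g z)"
    using assms by (intro l2.nonneg l2.diff_mem)
  then show ?thesis
    using assms by (simp add: l2.diff_left l2.diff_right l2.diff_mem l2.add_left l2.add_right l2.add_mem
        l2.commute[of g _ f])
qed

lemma l2_tendsto_inner:
  assumes F: "\<And>n. F n \<in> L2_space N" and f: "f \<in> L2_space N" and g: "g \<in> L2_space N"
    and lim: "(\<lambda>n. l2_inner N (\<lambda>z. F n z - f z) (\<lambda>z. F n z - f z)) \<longlonglongrightarrow> 0"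
  shows "(\<lambda>n. l2_inner N (F n) g) \<longlonglongrightarrow> l2_inner N f g"
proof -
  have "(\<lambda>n. sqrt (l2_inner N (\<lambda>z. F n z - f z) (\<lambda>z. F n z - f z)) * sqrt (l2_inner N g g)) \<longlonglongrightarrow> 0"
    using tendsto_mult_left_zero[OF tendsto_real_sqrt[OF lim, simplified]] by simp
  moreover have "\<bar>l2_inner N (F n) g - l2_inner N f g\<bar>
      \<le> sqrt (l2_inner N (\<lambda>z. F n z - f z) (\<lambda>z. F n z - f z)) * sqrt (l2_inner N g g)" for n
    using l2_abs_le[OF l2.diff_mem[OF F[of n] f] g] F f g by (simp add: l2.diff_left)
  ultimately have "(\<lambda>n. l2_inner N (F n) g - l2_inner N f g) \<longlonglongrightarrow> 0"
    by (rule tendsto_zero_bound)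
  then show ?thesis by (rule LIM_zero_cancel)
qed

text \<open>The squared norm is recovered from |F - f|^2 + 2 <F, f> - |f|^2, whose terms all
  converge.\<close>

lemma l2_tendsto_norm:
  assumes F: "\<And>n. F n \<in> L2_space N" and f: "f \<in> L2_space N"
    and lim: "(\<lambda>n. l2_inner N (\<lambda>z. F n z - f z) (\<lambda>z. F n z - f z)) \<longlonglongrightarrow> 0"
  shows "(\<lambda>n. l2_inner N (F n) (F n)) \<longlonglongrightarrow> l2_inner N f f"
proof -
  have "(\<lambda>n. l2_inner N (\<lambda>z. F n z - f z) (\<lambda>z. F n z - f z) + (2 * l2_inner N (F n) f - l2_inner N f f))
     \<longlonglongrightarrow> 0 + (2 * l2_inner N f f - l2_inner N f f)"
    by (intro tendsto_intros lim l2_tendsto_inner F f)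
  moreover have "l2_inner N (\<lambda>z. F n z - f z) (\<lambda>z. F n z - f z) + (2 * l2_inner N (F n) f - l2_inner N f f)
      = l2_inner N (F n) (F n)" for n
    using F[of n] f by (simp add: l2.diff_left l2.diff_right l2.diff_mem l2.commute[of f _ "F n"])
  ultimately show ?thesis by simp
qed

text \<open>With \<open>P\<close> the centering this passes from the form of K to the form of
  PKP.\<close>

lemma symmetric_form_compose:
  assumes "symmetric_form V B" and "\<And>f. f \<in> V \<Longrightarrow> P f \<in> V"
    and "\<And>f g. f \<in> V \<Longrightarrow> g \<in> V \<Longrightarrow> P (\<lambda>z. f z + g z) = (\<lambda>z. P f z + P g z)"
    and "\<And>f c. f \<in> V \<Longrightarrow> P (\<lambda>z. c * f z) = (\<lambda>z. c * P f z)"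
  shows "symmetric_form V (\<lambda>f g. B (P f) (P g))"
proof -
  interpret symmetric_form V B by fact
  show ?thesis
    by standard (auto simp: zero_mem add_mem scale_mem assms add_left scale_left commute)
qed

section \<open>Centering and kernel forms over a probability space\<close>

context prob_space
begin

lemma L2_const: "(\<lambda>_. c) \<in> L2_space M"
  by (simp add: L2_space_def)

lemma L2_integrable: "f \<in> L2_space M \<Longrightarrow> integrable M f"
  using L2_integrable_mult[OF _ L2_const[of 1]] by simp

lemma centering_L2: "f \<in> L2_space M \<Longrightarrow> centering M f \<in> L2_space M"
  unfolding centering_def by (intro l2.diff_mem L2_const)

lemma centering_add:
  "f \<in> L2_space M \<Longrightarrow> g \<in> L2_space M \<Longrightarrow> centering M (\<lambda>z. f z + g z) = (\<lambda>z. centering M f z + centering M g z)"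
  by (simp add: centering_def L2_integrable algebra_simps)

lemma centering_diff:
  "f \<in> L2_space M \<Longrightarrow> g \<in> L2_space M \<Longrightarrow> centering M (\<lambda>z. f z - g z) = (\<lambda>z. centering M f z - centering M g z)"
  by (simp add: centering_def L2_integrable algebra_simps)

lemma centering_scale: "centering M (\<lambda>z. c * f z) = (\<lambda>z. c * centering M f z)"
  by (simp add: centering_def right_diff_distrib)

lemma inner_centering:
  assumes "f \<in> L2_space M" "g \<in> L2_space M"
  shows "l2_inner M (centering M f) g = l2_inner M f g - expectation f * expectation g"
  unfolding l2_inner_def centering_def
  using assms L2_integrable_mult[of f M g] L2_integrable[of g]
  by (simp add: left_diff_distrib)

lemma centering_selfadjoint:
  assumes "f \<in> L2_space M" "g \<in> L2_space M"
  shows "l2_inner M (centering M f) g = l2_inner M f (centering M g)"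
  using assms l2.commute[of f M "centering M g"] l2.commute[of f M g]
  by (simp add: inner_centering centering_L2)

text \<open>The two sides differ by the square of the mean.\<close>

lemma centering_norm_le:
  assumes "f \<in> L2_space M"
  shows "l2_inner M (centering M f) (centering M f) \<le> l2_inner M f f"
proof -
  have "expectation (centering M f) = 0"
    unfolding centering_def using L2_integrable[OF assms] by (simp add: prob_space)
  then have "l2_inner M (centering M f) (centering M f) = l2_inner M f f - expectation f * expectation f"
    using assms l2.commute[of f M "centering M f"] by (simp add: inner_centering centering_L2)
  then show ?thesis by simp
qed

lemma tensor_L2:
  assumes f: "f \<in> L2_space M" and g: "g \<in> L2_space M"
  shows "(\<lambda>p. f (fst p) * g (snd p)) \<in> L2_space (M \<Otimes>\<^sub>M M)"
    and "l2_inner (M \<Otimes>\<^sub>M M) (\<lambda>p. f (fst p) * g (snd p)) (\<lambda>p. f (fst p) * g (snd p))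
      = l2_inner M f f * l2_inner M g g"
proof -
  interpret pair: pair_prob_space M M ..
  note [measurable] = L2_measurable[OF f] L2_measurable[OF g]
  have int: "integrable (M \<Otimes>\<^sub>M M) (\<lambda>(x, y). (f x * g y)\<^sup>2)"
  proof (rule pair.Fubini_integrable)
    show "integrable M (\<lambda>x. LINT y|M. norm (case (x, y) of (x, y) \<Rightarrow> (f x * g y)\<^sup>2))"
      using L2_integrable_square[OF f] by (simp add: power_mult_distrib)
    show "AE x in M. integrable M (\<lambda>y. case (x, y) of (x, y) \<Rightarrow> (f x * g y)\<^sup>2)"
      using L2_integrable_square[OF g] by (simp add: power_mult_distrib)
  qed measurable
  then show "(\<lambda>p. f (fst p) * g (snd p)) \<in> L2_space (M \<Otimes>\<^sub>M M)"
    by (intro L2_spaceI) (simp_all add: case_prod_unfold)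
  have "l2_inner (M \<Otimes>\<^sub>M M) (\<lambda>p. f (fst p) * g (snd p)) (\<lambda>p. f (fst p) * g (snd p))
     = (\<integral>p. (case p of (x, y) \<Rightarrow> (f x * g y)\<^sup>2) \<partial>(M \<Otimes>\<^sub>M M))"
    unfolding l2_inner_def by (intro Bochner_Integration.integral_cong) (auto simp: power2_eq_square)
  also have "\<dots> = (\<integral>x. (\<integral>y. (f x * g y)\<^sup>2 \<partial>M) \<partial>M)"
    using int by (subst pair.integral_fst'[symmetric]) auto
  also have "\<dots> = l2_inner M f f * l2_inner M g g"
    by (simp add: l2_inner_def power_mult_distrib flip: power2_eq_square)
  finally show "l2_inner (M \<Otimes>\<^sub>M M) (\<lambda>p. f (fst p) * g (snd p)) (\<lambda>p. f (fst p) * g (snd p))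
      = l2_inner M f f * l2_inner M g g" .
qed

text \<open>The double integral of \<open>k (x, y) * f x * g y\<close>, written as an inner product
  on the product space: linearity in the kernel is then immediate, and Cauchy-Schwarz gives the
  Hilbert-Schmidt bound.\<close>

definition kernel_form :: "('a \<times> 'a \<Rightarrow> real) \<Rightarrow> ('a \<Rightarrow> real) \<Rightarrow> ('a \<Rightarrow> real) \<Rightarrow> real" where
  "kernel_form k f g = l2_inner (M \<Otimes>\<^sub>M M) k (\<lambda>p. f (fst p) * g (snd p))"

definition centered_form :: "('a \<times> 'a \<Rightarrow> real) \<Rightarrow> ('a \<Rightarrow> real) \<Rightarrow> ('a \<Rightarrow> real) \<Rightarrow> real" where
  "centered_form k f g = kernel_form k (centering M f) (centering M g)"

lemma kernel_form_abs_le: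
  assumes k: "k \<in> L2_space (M \<Otimes>\<^sub>M M)" and f: "f \<in> L2_space M" and g: "g \<in> L2_space M"
  shows "\<bar>kernel_form k f g\<bar> \<le> sqrt (l2_inner (M \<Otimes>\<^sub>M M) k k) * (sqrt (l2_inner M f f) * sqrt (l2_inner M g g))"
  unfolding kernel_form_def
  using l2_abs_le[OF k tensor_L2(1)[OF f g]] by (simp add: tensor_L2(2)[OF f g] real_sqrt_mult)

lemma centered_form_abs_le:
  assumes k: "k \<in> L2_space (M \<Otimes>\<^sub>M M)" and f: "f \<in> L2_space M" and g: "g \<in> L2_space M"
  shows "\<bar>centered_form k f g\<bar> \<le> sqrt (l2_inner (M \<Otimes>\<^sub>M M) k k) * (sqrt (l2_inner M f f) * sqrt (l2_inner M g g))"
proof -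
  have "\<bar>centered_form k f g\<bar> \<le> sqrt (l2_inner (M \<Otimes>\<^sub>M M) k k) *
     (sqrt (l2_inner M (centering M f) (centering M f)) * sqrt (l2_inner M (centering M g) (centering M g)))"
    unfolding centered_form_def using assms by (intro kernel_form_abs_le centering_L2)
  also have "\<dots> \<le> sqrt (l2_inner (M \<Otimes>\<^sub>M M) k k) * (sqrt (l2_inner M f f) * sqrt (l2_inner M g g))"
    using assms by (intro mult_left_mono mult_mono real_sqrt_le_mono centering_norm_le)
      (auto intro!: l2.nonneg centering_L2)
  finally show ?thesis .
qed

lemma centered_form_diff_kernel:
  assumes "k \<in> L2_space (M \<Otimes>\<^sub>M M)" "k' \<in> L2_space (M \<Otimes>\<^sub>M M)" "f \<in> L2_space M" "g \<in> L2_space M"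
  shows "centered_form (\<lambda>p. k p - k' p) f g = centered_form k f g - centered_form k' f g"
  unfolding centered_form_def kernel_form_def
  using assms by (intro l2.diff_left tensor_L2 centering_L2)

end

section \<open>Existence of eigenfunctions for compact kernels\<close>

text \<open>Sections are square-integrable at every point, not just almost everywhere, so that
  \<open>K g z\<close> is controlled for every \<open>z\<close> and eigenvalue equations can be
  obtained pointwise; the descent of eigenfunctions to \<open>X\<close> relies on that.\<close>

locale compact_kernel = prob_space N for N :: "'z measure" +
  fixes k :: "'z \<times> 'z \<Rightarrow> real"
  assumes kernel_L2: "k \<in> L2_space (N \<Otimes>\<^sub>M N)"
    and kernel_sym: "\<And>z w. z \<in> space N \<Longrightarrow> w \<in> space N \<Longrightarrow> k (z, w) = k (w, z)"
    and section_L2: "\<And>z. z \<in> space N \<Longrightarrow> (\<lambda>w. k (z, w)) \<in> L2_space N"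
    and compactness: "\<And>F. (\<And>n. F n \<in> L2_space N) \<Longrightarrow> (\<And>n. l2_inner N (F n) (F n) \<le> 1) \<Longrightarrow>
      \<exists>r. strict_mono (r :: nat \<Rightarrow> nat) \<and>
        (\<forall>z\<in>space N. convergent (\<lambda>n. \<integral>w. k (z, w) * F (r n) w \<partial>N))"
begin

definition K :: "('z \<Rightarrow> real) \<Rightarrow> 'z \<Rightarrow> real" where
  "K g z = (\<integral>w. k (z, w) * g w \<partial>N)"

definition T :: "('z \<Rightarrow> real) \<Rightarrow> 'z \<Rightarrow> real" where
  "T g = centering N (K (centering N g))"

definition row :: "'z \<Rightarrow> real" where
  "row z = sqrt (\<integral>w. (k (z, w))\<^sup>2 \<partial>N)"

abbreviation "kernel_norm \<equiv> sqrt (l2_inner (N \<Otimes>\<^sub>M N) k k)"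
abbreviation "B \<equiv> centered_form k"

lemma kernel_measurable [measurable]: "k \<in> borel_measurable (N \<Otimes>\<^sub>M N)"
  using kernel_L2 by (rule L2_measurable)

lemma row_nonneg: "0 \<le> row z"
  by (simp add: row_def)

lemma row_L2: "row \<in> L2_space N"
proof
  interpret pair: pair_prob_space N N ..
  show "row \<in> borel_measurable N" unfolding row_def by measurable
  have "integrable N (\<lambda>z. \<integral>w. (k (z, w))\<^sup>2 \<partial>N)"
    using pair.integrable_fst'[OF L2_integrable_square[OF kernel_L2]] by simp
  then show "integrable N (\<lambda>z. (row z)\<^sup>2)" by (simp add: row_def)
qed

lemma K_abs_le:
  assumes "g \<in> L2_space N" "z \<in> space N"
  shows "\<bar>K g z\<bar> \<le> row z * sqrt (l2_inner N g g)"
  using l2_abs_le[OF section_L2[OF assms(2)] assms(1)]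
  by (simp add: K_def row_def l2_inner_def power2_eq_square)

lemma K_measurable: "g \<in> L2_space N \<Longrightarrow> K g \<in> borel_measurable N"
proof -
  assume "g \<in> L2_space N"
  note [measurable] = L2_measurable[OF this]
  show ?thesis unfolding K_def by measurable
qed

lemma K_L2: "g \<in> L2_space N \<Longrightarrow> K g \<in> L2_space N"
proof (rule L2_bound)
  assume g: "g \<in> L2_space N"
  then show "K g \<in> borel_measurable N" by (rule K_measurable)
  show "(\<lambda>z. sqrt (l2_inner N g g) * row z) \<in> L2_space N" by (intro L2_scale row_L2)
  fix z assume "z \<in> space N"
  from K_abs_le[OF g this] show "\<bar>K g z\<bar> \<le> \<bar>sqrt (l2_inner N g g) * row z\<bar>"
    by (simp add: mult.commute)
qed

lemma T_L2: "g \<in> L2_space N \<Longrightarrow> T g \<in> L2_space N"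
  unfolding T_def by (intro centering_L2 K_L2)

lemma kernel_form_K:
  assumes f: "f \<in> L2_space N" and g: "g \<in> L2_space N"
  shows "kernel_form k f g = l2_inner N f (K g)"
proof -
  interpret pair: pair_prob_space N N ..
  have "integrable (N \<Otimes>\<^sub>M N) (\<lambda>p. k p * (f (fst p) * g (snd p)))"
    by (intro L2_integrable_mult kernel_L2 tensor_L2 f g)
  from pair.integral_fst'[OF this]
  have "kernel_form k f g = (\<integral>z. (\<integral>w. f z * (k (z, w) * g w) \<partial>N) \<partial>N)"
    by (simp add: kernel_form_def l2_inner_def ac_simps)
  also have "\<dots> = l2_inner N f (K g)"
    by (simp add: l2_inner_def K_def)
  finally show ?thesis .
qed

lemma kernel_form_commute:
  assumes f: "f \<in> L2_space N" and g: "g \<in> L2_space N"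
  shows "kernel_form k f g = kernel_form k g f"
proof -
  interpret pair: pair_prob_space N N ..
  note [measurable] = L2_measurable[OF f] L2_measurable[OF g]
  have "kernel_form k f g = (\<integral>p. k p * (f (fst p) * g (snd p)) \<partial>(N \<Otimes>\<^sub>M N))"
    by (simp add: kernel_form_def l2_inner_def)
  also have "\<dots> = (\<integral>(x, y). k (y, x) * (f y * g x) \<partial>(N \<Otimes>\<^sub>M N))"
    by (subst pair.integral_product_swap[symmetric]) (auto simp: case_prod_beta)
  also have "\<dots> = (\<integral>p. k p * (g (fst p) * f (snd p)) \<partial>(N \<Otimes>\<^sub>M N))"
    by (intro Bochner_Integration.integral_cong) (auto simp: space_pair_measure kernel_sym mult.commute)
  finally show ?thesis by (simp add: kernel_form_def l2_inner_def)
qed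

lemma form_T:
  assumes f: "f \<in> L2_space N" and g: "g \<in> L2_space N"
  shows "B f g = l2_inner N f (T g)"
  using assms by (simp add: centered_form_def kernel_form_K T_def centering_L2 K_L2 centering_selfadjoint)

lemma kernel_form_symmetric: "symmetric_form (L2_space N) (kernel_form k)"
proof
  fix f g h :: "'z \<Rightarrow> real" and c :: real
  assume f: "f \<in> L2_space N" and g: "g \<in> L2_space N"
  show "kernel_form k f g = kernel_form k g f" using f g by (rule kernel_form_commute)
  show "kernel_form k (\<lambda>z. c * f z) g = c * kernel_form k f g"
    using f g by (simp add: kernel_form_K L2_scale K_L2 l2.scale_left)
  assume "h \<in> L2_space N"
  then show "kernel_form k (\<lambda>z. f z + g z) h = kernel_form k f h + kernel_form k g h"
    using f g by (simp add: kernel_form_K L2_add K_L2 l2.add_left)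
qed (auto intro: l2.zero_mem L2_add L2_scale)

lemma form_symmetric: "symmetric_form (L2_space N) B"
  using symmetric_form_compose[OF kernel_form_symmetric, of "centering N"]
  by (simp add: centering_L2 centering_add centering_scale centered_form_def[abs_def])

interpretation B: symmetric_form "L2_space N" B by (rule form_symmetric)

lemma form_le:
  assumes f: "f \<in> L2_space N"
  shows "\<bar>B f f\<bar> \<le> kernel_norm * l2_inner N f f"
  using centered_form_abs_le[OF kernel_L2 f f] l2.nonneg[OF f] by simp

text \<open>Pointwise convergence of the images suffices: the kernel section bound \<open>row\<close> dominates them.\<close>

lemma T_compact:
  assumes F: "\<And>n. F n \<in> L2_space N" and F1: "\<And>n. l2_inner N (F n) (F n) \<le> 1"
  obtains r G where "strict_mono (r :: nat \<Rightarrow> nat)" "G \<in> L2_space N"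
    "\<And>z. z \<in> space N \<Longrightarrow> (\<lambda>n. T (F (r n)) z) \<longlonglongrightarrow> G z"
    "(\<lambda>n. l2_inner N (\<lambda>z. T (F (r n)) z - G z) (\<lambda>z. T (F (r n)) z - G z)) \<longlonglongrightarrow> 0"
proof -
  define F' where "F' n = centering N (F n)" for n
  have F': "F' n \<in> L2_space N" for n unfolding F'_def by (intro centering_L2 F)
  have F'1: "l2_inner N (F' n) (F' n) \<le> 1" for n
    unfolding F'_def using centering_norm_le[OF F] F1 by (rule order_trans)
  obtain r where r: "strict_mono (r :: nat \<Rightarrow> nat)"
    and conv: "\<And>z. z \<in> space N \<Longrightarrow> convergent (\<lambda>n. K (F' (r n)) z)"
    using compactness[of F', OF F' F'1] unfolding K_def by blast
  define q where "q z = lim (\<lambda>n. K (F' (r n)) z)" for z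
  have q: "(\<lambda>n. K (F' (r n)) z) \<longlonglongrightarrow> q z" if "z \<in> space N" for z
    unfolding q_def using conv[OF that] by (simp add: convergent_LIMSEQ_iff)
  have bound: "\<bar>K (F' (r n)) z\<bar> \<le> row z" if z: "z \<in> space N" for n z
  proof -
    have "\<bar>K (F' (r n)) z\<bar> \<le> row z * sqrt (l2_inner N (F' (r n)) (F' (r n)))" by (rule K_abs_le[OF F' z])
    also have "\<dots> \<le> row z * 1" using F'1[of "r n"] by (intro mult_left_mono) (auto simp: row_def)
    finally show ?thesis by simp
  qed
  have qm: "q \<in> borel_measurable N"
    by (rule borel_measurable_LIMSEQ_real[OF q K_measurable[OF F']])
  have qb: "\<bar>q z\<bar> \<le> row z" if z: "z \<in> space N" for z
    by (rule LIMSEQ_le_const2[OF tendsto_rabs[OF q[OF z]]]) (use bound[OF z] in auto)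
  have qL2: "q \<in> L2_space N"
    by (rule L2_bound[OF qm row_L2]) (use qb in \<open>force intro: order_trans[OF _ abs_ge_self]\<close>)
  have mean: "(\<lambda>n. expectation (K (F' (r n)))) \<longlonglongrightarrow> expectation q"
    by (rule integral_dominated_convergence[where w = row])
      (use q bound qm in \<open>auto intro: L2_integrable row_L2 K_measurable F'\<close>)
  define G where "G = centering N q"
  have G: "G \<in> L2_space N" unfolding G_def by (intro centering_L2 qL2)
  have lim: "(\<lambda>n. T (F (r n)) z) \<longlonglongrightarrow> G z" if z: "z \<in> space N" for z
    unfolding G_def T_def F'_def[symmetric] centering_def[of N "K _"] centering_def[of N q]
    by (intro tendsto_diff q mean z)
  have "(\<lambda>n. l2_inner N (\<lambda>z. K (F' (r n)) z - q z) (\<lambda>z. K (F' (r n)) z - q z)) \<longlonglongrightarrow> (\<integral>z. 0 \<partial>N)"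
    unfolding l2_inner_def
  \<comment> \<open>Images and limit are both bounded by \<open>row\<close>, hence their difference
    by \<open>2 * row\<close>.\<close>
  proof (rule integral_dominated_convergence[where w = "\<lambda>z. 4 * (row z)\<^sup>2"])
    show "integrable N (\<lambda>z. 4 * (row z)\<^sup>2)"
      by (intro integrable_mult_right L2_integrable_square row_L2)
    show "AE z in N. (\<lambda>n. (K (F' (r n)) z - q z) * (K (F' (r n)) z - q z)) \<longlonglongrightarrow> 0"
    proof (rule AE_I2)
      fix z assume z: "z \<in> space N"
      from tendsto_diff[OF q[OF z] tendsto_const[of "q z"]]
      have "(\<lambda>n. K (F' (r n)) z - q z) \<longlonglongrightarrow> 0" by simp
      from tendsto_mult[OF this this] show "(\<lambda>n. (K (F' (r n)) z - q z) * (K (F' (r n)) z - q z)) \<longlonglongrightarrow> 0"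
        by simp
    qed
    fix n
    show "AE z in N. norm ((K (F' (r n)) z - q z) * (K (F' (r n)) z - q z)) \<le> 4 * (row z)\<^sup>2"
    proof (rule AE_I2)
      fix z assume z: "z \<in> space N"
      have "\<bar>K (F' (r n)) z - q z\<bar> \<le> 2 * row z" using bound[OF z, of n] qb[OF z] by linarith
      then have "\<bar>K (F' (r n)) z - q z\<bar>\<^sup>2 \<le> (2 * row z)\<^sup>2" by (intro power_mono) auto
      then show "norm ((K (F' (r n)) z - q z) * (K (F' (r n)) z - q z)) \<le> 4 * (row z)\<^sup>2"
        by (simp add: power2_eq_square)
    qed
  qed (use qm K_measurable[OF F'] in measurable)
  then have lim0: "(\<lambda>n. l2_inner N (\<lambda>z. K (F' (r n)) z - q z) (\<lambda>z. K (F' (r n)) z - q z)) \<longlonglongrightarrow> 0"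
    by simp
  have "(\<lambda>n. l2_inner N (\<lambda>z. T (F (r n)) z - G z) (\<lambda>z. T (F (r n)) z - G z)) \<longlonglongrightarrow> 0"
  proof (rule tendsto_sandwich[OF _ _ tendsto_const lim0])
    show "\<forall>\<^sub>F n in sequentially. 0 \<le> l2_inner N (\<lambda>z. T (F (r n)) z - G z) (\<lambda>z. T (F (r n)) z - G z)"
      using T_L2[OF F] G by (intro always_eventually allI l2.nonneg l2.diff_mem)
    show "\<forall>\<^sub>F n in sequentially. l2_inner N (\<lambda>z. T (F (r n)) z - G z) (\<lambda>z. T (F (r n)) z - G z)
        \<le> l2_inner N (\<lambda>z. K (F' (r n)) z - q z) (\<lambda>z. K (F' (r n)) z - q z)"
    proof (intro always_eventually allI)
      fix n
      \<comment> \<open>The error of \<open>T\<close> is the centering of the error of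
        \<open>K\<close>, and centering contracts.\<close>
      have "(\<lambda>z. T (F (r n)) z - G z) = centering N (\<lambda>z. K (F' (r n)) z - q z)"
        using K_L2[OF F'] qL2 by (simp add: centering_diff T_def G_def F'_def)
      then show "l2_inner N (\<lambda>z. T (F (r n)) z - G z) (\<lambda>z. T (F (r n)) z - G z)
        \<le> l2_inner N (\<lambda>z. K (F' (r n)) z - q z) (\<lambda>z. K (F' (r n)) z - q z)"
        using K_L2[OF F'] qL2 by (simp add: centering_norm_le l2.diff_mem)
    qed
  qed
  with r G lim that show thesis by blast
qed

lemma T_abs_le:
  assumes g: "g \<in> L2_space N" and z: "z \<in> space N"
  shows "\<bar>T g z\<bar> \<le> (row z + expectation row) * sqrt (l2_inner N g g)"
proof -
  let ?g = "centering N g" and ?s = "sqrt (l2_inner N g g)"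
  have g': "?g \<in> L2_space N" using g by (rule centering_L2)
  have K: "\<bar>K ?g x\<bar> \<le> row x * ?s" if "x \<in> space N" for x
  proof -
    have "row x * sqrt (l2_inner N ?g ?g) \<le> row x * ?s"
      by (intro mult_left_mono real_sqrt_le_mono centering_norm_le g row_nonneg)
    with K_abs_le[OF g' that] show ?thesis by (rule order_trans)
  qed
  have "\<bar>expectation (K ?g)\<bar> \<le> expectation (\<lambda>x. row x * ?s)"
    by (rule integral_abs_bound[THEN order_trans], rule integral_mono)
      (use K g' in \<open>auto intro: L2_integrable K_L2 row_L2 integrable_abs\<close>)
  also have "\<dots> = expectation row * ?s" by simp
  finally show ?thesis
    using K[OF z] unfolding T_def centering_def[of N "K _"] distrib_right by linarith
qed

lemma K_diff:
  assumes "f \<in> L2_space N" "g \<in> L2_space N" "z \<in> space N"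
  shows "K (\<lambda>z. f z - g z) z = K f z - K g z"
  unfolding K_def right_diff_distrib
  using assms by (intro Bochner_Integration.integral_diff L2_integrable_mult section_L2)

lemma T_diff:
  assumes f: "f \<in> L2_space N" and g: "g \<in> L2_space N" and z: "z \<in> space N"
  shows "T (\<lambda>z. f z - g z) z = T f z - T g z"
proof -
  have "expectation (K (centering N (\<lambda>z. f z - g z))) = expectation (\<lambda>z. K (centering N f) z - K (centering N g) z)"
    using f g by (intro Bochner_Integration.integral_cong) (simp_all add: centering_diff K_diff centering_L2)
  also have "\<dots> = expectation (K (centering N f)) - expectation (K (centering N g))"
    using f g by (intro Bochner_Integration.integral_diff L2_integrable K_L2 centering_L2)
  finally show ?thesis
    using f g z by (simp add: T_def centering_def[of N "K _"])
      (simp add: centering_diff K_diff centering_L2)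
qed

text \<open>By \<open>T_abs_le\<close>, the value of \<open>T f\<close> at a fixed point depends
  continuously on \<open>f\<close> in the L2 norm.\<close>

lemma T_pointwise:
  assumes F: "\<And>n. F n \<in> L2_space N" and f: "f \<in> L2_space N" and z: "z \<in> space N"
    and lim: "(\<lambda>n. l2_inner N (\<lambda>z. F n z - f z) (\<lambda>z. F n z - f z)) \<longlonglongrightarrow> 0"
  shows "(\<lambda>n. T (F n) z) \<longlonglongrightarrow> T f z"
proof -
  have "(\<lambda>n. (row z + expectation row) * sqrt (l2_inner N (\<lambda>z. F n z - f z) (\<lambda>z. F n z - f z)))
      \<longlonglongrightarrow> (row z + expectation row) * sqrt 0"
    by (intro tendsto_intros lim)
  then have "(\<lambda>n. (row z + expectation row) * sqrt (l2_inner N (\<lambda>z. F n z - f z) (\<lambda>z. F n z - f z)))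
      \<longlonglongrightarrow> 0"
    by simp
  moreover have "\<bar>T (F n) z - T f z\<bar>
      \<le> (row z + expectation row) * sqrt (l2_inner N (\<lambda>z. F n z - f z) (\<lambda>z. F n z - f z))" for n
    using T_abs_le[OF l2.diff_mem[OF F f] z] T_diff[OF F f z] by simp
  ultimately have "(\<lambda>n. T (F n) z - T f z) \<longlonglongrightarrow> 0"
    by (rule tendsto_zero_bound)
  then show ?thesis by (rule LIM_zero_cancel)
qed

text \<open>For a maximising sequence \<open>F\<close> of the Rayleigh quotient, Cauchy--Schwarz for the
  semidefinite form \<open>s \<cdot> \<langle>f, g\<rangle> - B f g\<close> gives \<open>s F - T F \<longlonglongrightarrow> 0\<close>, so that compactness of \<open>T\<close>
  makes \<open>F\<close> itself converge along a subsequence.\<close>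

lemma eigenfunction_exists:
  assumes v: "\<And>i. i \<in> I \<Longrightarrow> v i \<in> L2_space N"
    and eig: "\<And>i g. i \<in> I \<Longrightarrow> g \<in> L2_space N \<Longrightarrow> B (v i) g = l i * l2_inner N (v i) g"
    and h: "h \<in> L2_space N" "\<And>i. i \<in> I \<Longrightarrow> l2_inner N h (v i) = 0"
    and c: "0 \<le> c" "c * l2_inner N h h < B h h"
  obtains s f where "c < s" "f \<in> L2_space N" "l2_inner N f f = 1"
    "\<And>i. i \<in> I \<Longrightarrow> l2_inner N f (v i) = 0" "\<And>z. z \<in> space N \<Longrightarrow> T f z = s * f z"
proof -
  define W where "W = {f \<in> L2_space N. \<forall>i\<in>I. l2_inner N f (v i) = 0}"
  have WL: "f \<in> L2_space N" if "f \<in> W" for f using that by (simp add: W_def)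
  have W_add: "(\<lambda>z. f z + g z) \<in> W" if "f \<in> W" "g \<in> W" for f g
    using that v by (auto simp: W_def L2_add l2.add_left)
  have W_scale: "(\<lambda>z. a * f z) \<in> W" if "f \<in> W" for f a
    using that v by (auto simp: W_def L2_scale l2.scale_left)
  have W_diff: "(\<lambda>z. f z - g z) \<in> W" if "f \<in> W" "g \<in> W" for f g
    using W_add[OF that(1) W_scale[OF that(2), of "-1"]] by simp
  \<comment> \<open>The complement of eigenvectors is invariant because \<open>T\<close> is
    symmetric.\<close>
  have W_T: "T f \<in> W" if f: "f \<in> W" for f
    unfolding W_def
  proof (intro CollectI conjI ballI T_L2 WL f)
    fix i assume i: "i \<in> I"
    have "l2_inner N (T f) (v i) = B (v i) f"
      using WL[OF f] v[OF i] by (simp add: form_T l2.commute T_L2)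
    also have "\<dots> = l i * l2_inner N f (v i)"
      using WL[OF f] v[OF i] i by (simp add: eig l2.commute)
    finally show "l2_inner N (T f) (v i) = 0" using f i by (simp add: W_def)
  qed
  have hW: "h \<in> W" using h by (simp add: W_def)
  \<comment> \<open>The values of the Rayleigh quotient on \<open>W\<close>; the function
    \<open>h\<close> shows that their supremum exceeds \<open>c\<close>.\<close>
  define S where "S = {B f f | f. f \<in> W \<and> l2_inner N f f = 1}"
  define s where "s = Sup S"
  have h_pos: "0 < l2_inner N h h"
  proof (rule ccontr)
    assume "\<not> 0 < l2_inner N h h"
    then have "l2_inner N h h = 0" using l2.nonneg[OF h(1)] by simp
    with form_le[OF h(1)] c show False by simp
  qed
  have normalise: "B f f / l2_inner N f f \<in> S" if f: "f \<in> W" and pos: "0 < l2_inner N f f" for f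
  proof -
    let ?a = "1 / sqrt (l2_inner N f f)"
    have "l2_inner N (\<lambda>z. ?a * f z) (\<lambda>z. ?a * f z) = ?a * ?a * l2_inner N f f"
      using WL[OF f] by (simp add: l2.scale_left l2.scale_right L2_scale del: times_divide_eq_left)
    also have "\<dots> = 1" using pos by simp
    finally have 1: "l2_inner N (\<lambda>z. ?a * f z) (\<lambda>z. ?a * f z) = 1" .
    have "B (\<lambda>z. ?a * f z) (\<lambda>z. ?a * f z) = ?a * ?a * B f f"
      using WL[OF f] by (simp add: B.scale_left B.scale_right L2_scale del: times_divide_eq_left)
    also have "\<dots> = B f f / l2_inner N f f" using pos by simp
    finally show ?thesis unfolding S_def using 1 W_scale[OF f, of ?a]
      by (intro CollectI exI[of _ "\<lambda>z. ?a * f z"]) auto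
  qed
  have S_bound: "x \<le> kernel_norm" if "x \<in> S" for x
    using that form_le WL by (fastforce simp: S_def)
  have S_ne: "S \<noteq> {}" using normalise[OF hW h_pos] by blast
  have S_bdd: "bdd_above S" using S_bound by (rule bdd_aboveI)
  have "c < B h h / l2_inner N h h" using c h_pos by (simp add: pos_less_divide_eq)
  also have "\<dots> \<le> s" unfolding s_def by (intro cSup_upper normalise hW h_pos S_bdd)
  finally have cs: "c < s" .
  \<comment> \<open>Here \<open>0 \<le> c\<close> enters; the limit is divided by \<open>s\<close>
    below.\<close>
  with c have s_pos: "0 < s" by simp
  have le_s: "B f f \<le> s * l2_inner N f f" if f: "f \<in> W" for f
  proof (cases "0 < l2_inner N f f")
    case True
    have "B f f / l2_inner N f f \<le> s" unfolding s_def by (intro cSup_upper normalise f True S_bdd)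
    with True show ?thesis by (simp add: pos_divide_le_eq)
  next
    case False
    then have "l2_inner N f f = 0" using l2.nonneg[OF WL[OF f]] by simp
    with form_le[OF WL[OF f]] show ?thesis by simp
  qed
  have "\<exists>f. f \<in> W \<and> l2_inner N f f = 1 \<and> s - 1 / real (Suc n) < B f f" for n
  proof -
    have "s - 1 / real (Suc n) < Sup S" by (simp add: s_def)
    then obtain x where "x \<in> S" "s - 1 / real (Suc n) < x" using less_cSupD[OF S_ne] by blast
    then show ?thesis by (auto simp: S_def)
  qed
  then obtain F where FW: "\<And>n. F n \<in> W" and F1: "\<And>n. l2_inner N (F n) (F n) = 1"
    and FB: "\<And>n. s - 1 / real (Suc n) < B (F n) (F n)" by metis
  have FL: "F n \<in> L2_space N" for n by (rule WL[OF FW])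
  define w where "w f g = s * l2_inner N f g - B f g" for f g
  have w_form: "symmetric_form W w"
  proof
    fix f g h :: "'z \<Rightarrow> real" and a :: real
    assume f: "f \<in> W" and g: "g \<in> W"
    show "(\<lambda>z. f z + g z) \<in> W" "(\<lambda>z. a * f z) \<in> W" using f g by (rule W_add, intro W_scale f)
    show "w f g = w g f"
      using WL[OF f] WL[OF g] by (simp add: w_def l2.commute[of f N g] B.commute[of f g])
    show "w (\<lambda>z. a * f z) g = a * w f g"
      using WL[OF f] WL[OF g] by (simp add: w_def l2.scale_left B.scale_left right_diff_distrib)
    assume h: "h \<in> W"
    show "w (\<lambda>z. f z + g z) h = w f h + w g h"
      using WL[OF f] WL[OF g] WL[OF h] by (simp add: w_def l2.add_left B.add_left distrib_left)
  next
    show "(\<lambda>_. 0) \<in> W" using W_scale[OF hW, of 0] by simp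
  qed
  interpret w: symmetric_form W w by (rule w_form)
  define R where "R n z = s * F n z - T (F n) z" for n z
  have RW: "R n \<in> W" for n unfolding R_def by (intro W_diff W_scale W_T FW)
  have RL: "R n \<in> L2_space N" for n by (rule WL[OF RW])
  have R_le: "l2_inner N (R n) (R n) \<le> (s + kernel_norm) * (1 / real (Suc n))" for n
  proof (cases "l2_inner N (R n) (R n) = 0")
    case False
    with l2.nonneg[OF RL[of n]] have pos: "0 < l2_inner N (R n) (R n)" by simp
    have "l2_inner N (R n) (R n) = s * l2_inner N (F n) (R n) - l2_inner N (T (F n)) (R n)"
      using RL FL by (simp add: R_def[abs_def] l2.diff_left L2_scale T_L2 l2.scale_left)
    also have "\<dots> = w (F n) (R n)"
      using RL FL B.commute[of "F n" "R n"] by (simp add: w_def form_T l2.commute T_L2)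
    finally have "(l2_inner N (R n) (R n))\<^sup>2 = (w (F n) (R n))\<^sup>2" by simp
    \<comment> \<open>The first factor is the shortfall of \<open>F n\<close> from the supremum,
      below \<open>1 / real (Suc n)\<close>; the second is at most a multiple of the squared norm of
      \<open>R n\<close>, which cancels against the left side.\<close>
    also have "\<dots> \<le> w (F n) (F n) * w (R n) (R n)"
      by (rule w.Cauchy_Schwarz_on[of W]) (use le_s FW RW w_form in \<open>auto simp: w_def\<close>)
    also have "\<dots> \<le> (1 / real (Suc n)) * ((s + kernel_norm) * l2_inner N (R n) (R n))"
    proof (rule mult_mono)
      show "w (F n) (F n) \<le> 1 / real (Suc n)" using FB[of n] F1[of n] by (simp add: w_def)
      show "w (R n) (R n) \<le> (s + kernel_norm) * l2_inner N (R n) (R n)"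
        using form_le[OF RL[of n]] by (simp add: w_def algebra_simps)
      show "0 \<le> w (R n) (R n)" using le_s[OF RW] by (simp add: w_def)
    qed simp
    also have "\<dots> = ((s + kernel_norm) * (1 / real (Suc n))) * l2_inner N (R n) (R n)" by simp
    finally show ?thesis using pos unfolding power2_eq_square by (rule mult_right_le_imp_le)
  qed (use s_pos l2.nonneg[OF kernel_L2] in simp)
  obtain r G where r: "strict_mono (r :: nat \<Rightarrow> nat)" and G: "G \<in> L2_space N"
    and TG: "\<And>z. z \<in> space N \<Longrightarrow> (\<lambda>n. T (F (r n)) z) \<longlonglongrightarrow> G z"
    and TG2: "(\<lambda>n. l2_inner N (\<lambda>z. T (F (r n)) z - G z) (\<lambda>z. T (F (r n)) z - G z)) \<longlonglongrightarrow> 0"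
    using T_compact[of F] FL F1 by auto
  have R0: "(\<lambda>n. l2_inner N (R n) (R n)) \<longlonglongrightarrow> 0"
  proof (rule tendsto_sandwich[OF _ _ tendsto_const])
    show "(\<lambda>n. (s + kernel_norm) * (1 / real (Suc n))) \<longlonglongrightarrow> 0"
      using tendsto_mult_right_zero[OF LIMSEQ_inverse_real_of_nat] by (simp add: inverse_eq_divide)
  qed (use R_le l2.nonneg[OF RL] in auto)
  \<comment> \<open>Since \<open>s * F\<close> is \<open>R + T F\<close> with \<open>R\<close>
    tending to 0, the limit of \<open>F\<close> can only be \<open>G / s\<close>. Defining it by the
    pointwise limit \<open>G\<close> makes the eigenvalue equation hold at every point.\<close>
  define f where "f z = (1 / s) * G z" for z
  have f: "f \<in> L2_space N" unfolding f_def by (intro L2_scale G)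
  have Ff: "(\<lambda>n. l2_inner N (\<lambda>z. F (r n) z - f z) (\<lambda>z. F (r n) z - f z)) \<longlonglongrightarrow> 0"
  proof (rule tendsto_sandwich[OF _ _ tendsto_const])
    let ?D = "\<lambda>n z. T (F (r n)) z - G z"
    have D: "?D n \<in> L2_space N" for n by (intro l2.diff_mem T_L2 FL G)
    show "(\<lambda>n. (1 / s * (1 / s)) * (2 * l2_inner N (R (r n)) (R (r n)) + 2 * l2_inner N (?D n) (?D n))) \<longlonglongrightarrow> 0"
    proof (rule tendsto_eq_rhs)
      have "(\<lambda>n. l2_inner N (R (r n)) (R (r n))) \<longlonglongrightarrow> 0"
        using LIMSEQ_subseq_LIMSEQ[OF R0 r] by (simp add: o_def)
      then show "(\<lambda>n. (1 / s * (1 / s)) * (2 * l2_inner N (R (r n)) (R (r n)) + 2 * l2_inner N (?D n) (?D n)))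
          \<longlonglongrightarrow> (1 / s * (1 / s)) * (2 * 0 + 2 * 0)"
        by (intro tendsto_mult tendsto_add tendsto_const TG2)
    qed simp
    show "\<forall>\<^sub>F n in sequentially. l2_inner N (\<lambda>z. F (r n) z - f z) (\<lambda>z. F (r n) z - f z)
      \<le> (1 / s * (1 / s)) * (2 * l2_inner N (R (r n)) (R (r n)) + 2 * l2_inner N (?D n) (?D n))"
    proof (intro always_eventually allI)
      fix n
      have "(\<lambda>z. F (r n) z - f z) = (\<lambda>z. 1 / s * (R (r n) z + ?D n z))"
        using s_pos by (simp add: R_def f_def fun_eq_iff field_simps)
      then have "l2_inner N (\<lambda>z. F (r n) z - f z) (\<lambda>z. F (r n) z - f z)
         = (1 / s * (1 / s)) * l2_inner N (\<lambda>z. R (r n) z + ?D n z) (\<lambda>z. R (r n) z + ?D n z)"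
        using L2_add[OF RL[of "r n"] D[of n]]
        by (simp only: l2.scale_left l2.scale_right L2_scale mult.assoc)
      also have "\<dots> \<le> (1 / s * (1 / s)) * (2 * l2_inner N (R (r n)) (R (r n)) + 2 * l2_inner N (?D n) (?D n))"
        using s_pos by (intro mult_left_mono l2_norm_add_le RL D) simp
      finally show "l2_inner N (\<lambda>z. F (r n) z - f z) (\<lambda>z. F (r n) z - f z)
        \<le> (1 / s * (1 / s)) * (2 * l2_inner N (R (r n)) (R (r n)) + 2 * l2_inner N (?D n) (?D n))" .
    qed
    show "\<forall>\<^sub>F n in sequentially. 0 \<le> l2_inner N (\<lambda>z. F (r n) z - f z) (\<lambda>z. F (r n) z - f z)"
      by (intro always_eventually allI l2.nonneg l2.diff_mem FL f)
  qed
  show thesis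
  proof (rule that[OF cs f])
    have "(\<lambda>n. l2_inner N (F (r n)) (F (r n))) \<longlonglongrightarrow> l2_inner N f f"
      by (rule l2_tendsto_norm[OF FL f Ff])
    then show "l2_inner N f f = 1" by (simp add: F1 LIMSEQ_const_iff)
    show "l2_inner N f (v i) = 0" if i: "i \<in> I" for i
    proof -
      have "(\<lambda>n. l2_inner N (F (r n)) (v i)) \<longlonglongrightarrow> l2_inner N f (v i)"
        by (rule l2_tendsto_inner[OF FL f v[OF i] Ff])
      moreover have "l2_inner N (F (r n)) (v i) = 0" for n using FW[of "r n"] i by (simp add: W_def)
      ultimately show ?thesis by (simp add: LIMSEQ_const_iff)
    qed
    show "T f z = s * f z" if z: "z \<in> space N" for z
    proof -
      have "T f z = G z" by (rule LIMSEQ_unique[OF T_pointwise[OF FL f z Ff] TG[OF z]])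
      then show ?thesis using s_pos by (simp add: f_def)
    qed
  qed
qed

end

section \<open>The lifted distance kernel\<close>

lemma power4_add_le: "0 \<le> a \<Longrightarrow> 0 \<le> b \<Longrightarrow> (a + b) ^ 4 \<le> 8 * (a ^ 4 + b ^ 4)" for a b :: real
proof -
  have sq: "(x + y)\<^sup>2 \<le> 2 * (x\<^sup>2 + y\<^sup>2)" for x y :: real
    using sum_squares_bound[of x y] by (simp add: power2_sum)
  have "(a + b) ^ 4 = ((a + b)\<^sup>2)\<^sup>2" by simp
  also have "\<dots> \<le> (2 * (a\<^sup>2 + b\<^sup>2))\<^sup>2" by (intro power_mono sq) auto
  also have "\<dots> = 4 * (a\<^sup>2 + b\<^sup>2)\<^sup>2" by (simp only: power_mult_distrib) simp
  also have "\<dots> \<le> 4 * (2 * ((a\<^sup>2)\<^sup>2 + (b\<^sup>2)\<^sup>2))" by (intro mult_left_mono sq) simp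
  finally show ?thesis by simp
qed

lemma space_borel_sigma [simp]: "space (borel_sigma T) = topspace T"
  and sets_borel_sigma: "sets (borel_sigma T) = sigma_sets (topspace T) {U. openin T U}"
proof -
  have "{U. openin T U} \<subseteq> Pow (topspace T)" using openin_subset by blast
  then show "space (borel_sigma T) = topspace T"
    and "sets (borel_sigma T) = sigma_sets (topspace T) {U. openin T U}"
    by (simp_all add: borel_sigma_def space_measure_of sets_measure_of)
qed

lemma openin_borel_sigma: "openin T U \<Longrightarrow> U \<in> sets (borel_sigma T)"
  by (simp add: sets_borel_sigma sigma_sets.Basic)

lemma continuous_map_measurable:
  assumes "continuous_map S T f"
  shows "f \<in> measurable (borel_sigma S) (borel_sigma T)"
  unfolding borel_sigma_def[of T]
proof (rule measurable_measure_of)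
  show "{U. openin T U} \<subseteq> Pow (topspace T)" using openin_subset by blast
  show "f \<in> space (borel_sigma S) \<rightarrow> topspace T"
    using assms by (auto simp: continuous_map_def)
  fix U assume "U \<in> {U. openin T U}"
  then have "openin S {x \<in> topspace S. f x \<in> U}"
    using assms by (simp add: openin_continuous_map_preimage)
  moreover have "f -` U \<inter> space (borel_sigma S) = {x \<in> topspace S. f x \<in> U}" by auto
  ultimately show "f -` U \<inter> space (borel_sigma S) \<in> sets (borel_sigma S)"
    by (simp add: openin_borel_sigma)
qed

text \<open>\<open>N\<close> is any probability space with a measure-preserving map to
  \<open>X\<close>. It is used with \<open>N = \<gamma>\<close> and a coordinate projection, and
  with \<open>N = \<mu>\<close> and the identity, so that facts about \<open>X\<close> itself are
  instances.\<close>

locale mds_lift = prob_space N for N :: "'z measure" +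
  fixes X :: "'a set" and d :: "'a \<Rightarrow> 'a \<Rightarrow> real" and \<mu> :: "'a measure" and \<pi> :: "'z \<Rightarrow> 'a"
  assumes mm: "mm_space X d \<mu>" and moment: "finite_fourth_moment X d \<mu>"
    and proj [measurable]: "\<pi> \<in> measurable N \<mu>" and distr_proj: "distr N \<mu> \<pi> = \<mu>"
begin

sublocale Metric_space X d
  using mm by (simp add: mm_space_def)

lemma space_mu: "space \<mu> = X"
proof -
  have "sets \<mu> = sets (borel_sigma mtopology)" using mm by (simp add: mm_space_def)
  then show ?thesis by (metis sets_eq_imp_space_eq space_borel_sigma topspace_mtopology)
qed

lemma proj_space: "z \<in> space N \<Longrightarrow> \<pi> z \<in> X"
  using measurable_space[OF proj] space_mu by simp

lemma dense:
  obtains D where "countable D" "D \<subseteq> X" "D \<noteq> {}" "\<And>x e. x \<in> X \<Longrightarrow> 0 < e \<Longrightarrow> \<exists>q\<in>D. d x q < e"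
proof -
  obtain D where D: "countable D" "D \<subseteq> X" "mtopology closure_of D = X"
    using mm by (auto simp: mm_space_def separable_space_def)
  have 1: "\<exists>q\<in>D. d x q < e" if "x \<in> X" "0 < e" for x e
  proof -
    have "x \<in> mtopology closure_of D" using that D(3) by simp
    with that(2) obtain q where "q \<in> D" "q \<in> mball x e" unfolding metric_closure_of by blast
    then show ?thesis by (auto simp: in_mball)
  qed
  obtain z where "z \<in> space N" using not_empty by blast
  then have "D \<noteq> {}" using 1[OF proj_space, of z 1] by auto
  with 1 D show thesis by (intro that[of D])
qed

lemma dist_measurable_mu: "x \<in> X \<Longrightarrow> d x \<in> borel_measurable \<mu>"
proof (rule borel_measurableI_less)
  fix r assume x: "x \<in> X"
  have "{y \<in> space \<mu>. d x y < r} = mball x r" using x by (auto simp: space_mu in_mball)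
  moreover have "mball x r \<in> sets \<mu>"
    using mm by (simp add: mm_space_def openin_borel_sigma)
  ultimately show "{y \<in> space \<mu>. d x y < r} \<in> sets \<mu>" by simp
qed

lemma dist_measurable: "x \<in> X \<Longrightarrow> (\<lambda>z. d x (\<pi> z)) \<in> borel_measurable N"
  using measurable_compose[OF proj dist_measurable_mu] .

text \<open>The product sigma-algebra is generated by rectangles, so continuity of \<open>d\<close>
  alone does not help. By separability \<open>d x y < r\<close> holds iff some dense
  \<open>q\<close> and rational \<open>t\<close> satisfy \<open>d q x < t\<close> and
  \<open>d q y < r - t\<close>.\<close>

lemma dist2_measurable: "(\<lambda>p. d (\<pi> (fst p)) (\<pi> (snd p))) \<in> borel_measurable (N \<Otimes>\<^sub>M N)"
proof (rule borel_measurableI_less)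
  fix r
  obtain D where D: "countable D" "D \<subseteq> X" "\<And>x e. x \<in> X \<Longrightarrow> 0 < e \<Longrightarrow> \<exists>q\<in>D. d x q < e"
    using dense by metis
  let ?A = "\<lambda>q t. {p \<in> space (N \<Otimes>\<^sub>M N). d q (\<pi> (fst p)) < t \<and> d q (\<pi> (snd p)) < r - t}"
  have "{p \<in> space (N \<Otimes>\<^sub>M N). d (\<pi> (fst p)) (\<pi> (snd p)) < r} = (\<Union>q\<in>D. \<Union>t\<in>\<rat>. ?A q t)"
  proof (intro set_eqI iffI)
    fix p assume p: "p \<in> {p \<in> space (N \<Otimes>\<^sub>M N). d (\<pi> (fst p)) (\<pi> (snd p)) < r}"
    define x y where "x = \<pi> (fst p)" and "y = \<pi> (snd p)"
    have xy: "x \<in> X" "y \<in> X" "d x y < r"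
      using p by (auto simp: x_def y_def space_pair_measure intro: proj_space)
    \<comment> \<open>A quarter of the slack leaves room for \<open>t\<close> on both sides:
      \<open>d q y < t + d x y < r - t\<close>.\<close>
    define e where "e = (r - d x y) / 4"
    have "0 < e" using xy by (simp add: e_def)
    with D(3) xy obtain q where q: "q \<in> D" "d x q < e" by blast
    then have qX: "q \<in> X" using D by blast
    obtain t where t: "t \<in> \<rat>" "d q x < t" "t < e"
      using Rats_dense_in_real[of "d q x" e] q commute[of q x] by auto
    have "d q y \<le> d q x + d x y" using qX xy by (intro triangle)
    also have "\<dots> < r - t"
    proof -
      have "4 * t < r - d x y" using t(3) by (simp add: e_def)
      moreover have "0 \<le> d q x" by simp
      ultimately show ?thesis using t(2) by argo
    qed
    finally show "p \<in> (\<Union>q\<in>D. \<Union>t\<in>\<rat>. ?A q t)" using q t p by (auto simp: x_def y_def)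
  next
    fix p assume "p \<in> (\<Union>q\<in>D. \<Union>t\<in>\<rat>. ?A q t)"
    then obtain q t where p: "q \<in> D" "p \<in> ?A q t" by blast
    then have "d (\<pi> (fst p)) (\<pi> (snd p)) \<le> d (\<pi> (fst p)) q + d q (\<pi> (snd p))"
      using D by (intro triangle) (auto simp: space_pair_measure intro: proj_space)
    with p show "p \<in> {p \<in> space (N \<Otimes>\<^sub>M N). d (\<pi> (fst p)) (\<pi> (snd p)) < r}"
      using commute[of q "\<pi> (fst p)"] by auto
  qed
  moreover have "?A q t \<in> sets (N \<Otimes>\<^sub>M N)" if "q \<in> D" for q t
  proof -
    have [measurable]: "(\<lambda>z. d q (\<pi> z)) \<in> borel_measurable N" using that D by (intro dist_measurable) auto
    show ?thesis by measurable
  qed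
  ultimately show "{p \<in> space (N \<Otimes>\<^sub>M N). d (\<pi> (fst p)) (\<pi> (snd p)) < r} \<in> sets (N \<Otimes>\<^sub>M N)"
    using D(1) by (auto intro!: sets.countable_UN' simp: countable_rat)
qed

text \<open>The moment is given at one base point; the triangle inequality moves it to any
  \<open>x\<close>.\<close>

lemma dist_sq_L2:
  assumes x: "x \<in> X"
  shows "(\<lambda>z. (d x (\<pi> z))\<^sup>2) \<in> L2_space N"
proof -
  obtain x0 where x0: "x0 \<in> X" "(\<integral>\<^sup>+ y. ennreal (d x0 y ^ 4) \<partial>\<mu>) < \<infinity>"
    using moment by (auto simp: finite_fourth_moment_def)
  note [measurable] = dist_measurable[OF x0(1)] dist_measurable[OF x] dist_measurable_mu[OF x0(1)]
  have "(\<integral>\<^sup>+ y. ennreal (d x0 y ^ 4) \<partial>\<mu>) = (\<integral>\<^sup>+ y. ennreal (d x0 y ^ 4) \<partial>(distr N \<mu> \<pi>))"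
    by (simp add: distr_proj)
  also have "\<dots> = (\<integral>\<^sup>+ z. ennreal (d x0 (\<pi> z) ^ 4) \<partial>N)"
    by (subst nn_integral_distr) auto
  finally have int: "integrable N (\<lambda>z. d x0 (\<pi> z) ^ 4)"
    using x0(2) by (intro integrableI_bounded) auto
  have "integrable N (\<lambda>z. d x (\<pi> z) ^ 4)"
  proof (rule Bochner_Integration.integrable_bound)
    show "integrable N (\<lambda>z. 8 * (d x x0 ^ 4 + d x0 (\<pi> z) ^ 4))" using int by simp
    show "AE z in N. norm (d x (\<pi> z) ^ 4) \<le> norm (8 * (d x x0 ^ 4 + d x0 (\<pi> z) ^ 4))"
    proof (rule AE_I2)
      fix z assume "z \<in> space N"
      then have "d x (\<pi> z) \<le> d x x0 + d x0 (\<pi> z)" using x x0 by (intro triangle proj_space)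
      then have "d x (\<pi> z) ^ 4 \<le> (d x x0 + d x0 (\<pi> z)) ^ 4" by (intro power_mono) auto
      also have "\<dots> \<le> 8 * (d x x0 ^ 4 + d x0 (\<pi> z) ^ 4)" by (intro power4_add_le) auto
      finally show "norm (d x (\<pi> z) ^ 4) \<le> norm (8 * (d x x0 ^ 4 + d x0 (\<pi> z) ^ 4))" by simp
    qed
  qed measurable
  then show ?thesis by (intro L2_spaceI) simp_all
qed

lemma dist_L2:
  assumes x: "x \<in> X"
  shows "(\<lambda>z. d x (\<pi> z)) \<in> L2_space N"
  using L2_integrable[OF dist_sq_L2[OF x]] dist_measurable[OF x] by (intro L2_spaceI)

definition dist_sq :: "'z \<times> 'z \<Rightarrow> real" where
  "dist_sq p = (d (\<pi> (fst p)) (\<pi> (snd p)))\<^sup>2"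

lemma dist_sq_pair_L2: "dist_sq \<in> L2_space (N \<Otimes>\<^sub>M N)"
proof -
  note [measurable] = dist2_measurable
  obtain z where "z \<in> space N" using not_empty by blast
  then obtain x where x: "x \<in> X" using proj_space by blast
  \<comment> \<open>The factors 1 bring both summands into the shape of
    \<open>tensor_L2\<close>.\<close>
  have "(\<lambda>p. 2 * ((d x (\<pi> (fst p)))\<^sup>2 * 1 + 1 * (d x (\<pi> (snd p)))\<^sup>2)) \<in> L2_space (N \<Otimes>\<^sub>M N)"
    by (intro L2_scale L2_add tensor_L2(1)[of _ "\<lambda>_. 1"] tensor_L2(1)[of "\<lambda>_. 1"] dist_sq_L2 x L2_const)
  then show ?thesis
  proof (rule L2_bound[rotated])
    show "dist_sq \<in> borel_measurable (N \<Otimes>\<^sub>M N)" unfolding dist_sq_def[abs_def] by measurable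
    fix p assume "p \<in> space (N \<Otimes>\<^sub>M N)"
    then have X: "\<pi> (fst p) \<in> X" "\<pi> (snd p) \<in> X"
      by (auto simp: space_pair_measure intro: proj_space)
    have "d (\<pi> (fst p)) (\<pi> (snd p)) \<le> d x (\<pi> (fst p)) + d x (\<pi> (snd p))"
      using triangle[OF X(1) x X(2)] commute[of x "\<pi> (fst p)"] by simp
    then have "dist_sq p \<le> (d x (\<pi> (fst p)) + d x (\<pi> (snd p)))\<^sup>2"
      unfolding dist_sq_def by (intro power_mono) auto
    also have "\<dots> \<le> 2 * ((d x (\<pi> (fst p)))\<^sup>2 * 1 + 1 * (d x (\<pi> (snd p)))\<^sup>2)"
      using sum_squares_bound[of "d x (\<pi> (fst p))" "d x (\<pi> (snd p))"] by (simp add: power2_sum)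
    finally show "\<bar>dist_sq p\<bar> \<le> \<bar>2 * ((d x (\<pi> (fst p)))\<^sup>2 * 1 + 1 * (d x (\<pi> (snd p)))\<^sup>2)\<bar>"
      by (simp add: dist_sq_def)
  qed
qed

definition kern :: "'z \<times> 'z \<Rightarrow> real" where
  "kern p = mds_kernel d (\<pi> (fst p)) (\<pi> (snd p))"

lemma kern_eq: "kern = (\<lambda>p. - (1 / 2) * dist_sq p)"
  by (simp add: kern_def mds_kernel_def dist_sq_def fun_eq_iff)

lemma kernel_section_L2: "x \<in> X \<Longrightarrow> (\<lambda>w. mds_kernel d x (\<pi> w)) \<in> L2_space N"
  unfolding mds_kernel_def by (intro L2_scale dist_sq_L2)

text \<open>Integration runs over \<open>N\<close> but the evaluation point lies in
  \<open>X\<close>. The lifted operator thus has a version living on \<open>X\<close>, open to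
  metric estimates and to descending eigenfunctions.\<close>

definition lifted_K :: "('z \<Rightarrow> real) \<Rightarrow> 'a \<Rightarrow> real" where
  "lifted_K g x = (\<integral>w. mds_kernel d x (\<pi> w) * g w \<partial>N)"

lemma lifted_K_bound:
  assumes x: "x \<in> X" and g: "g \<in> L2_space N" "l2_inner N g g \<le> 1"
  shows "\<bar>lifted_K g x\<bar> \<le> sqrt (l2_inner N (\<lambda>w. mds_kernel d x (\<pi> w)) (\<lambda>w. mds_kernel d x (\<pi> w)))"
proof -
  let ?k = "\<lambda>w. mds_kernel d x (\<pi> w)"
  have "\<bar>lifted_K g x\<bar> \<le> sqrt (l2_inner N ?k ?k) * sqrt (l2_inner N g g)"
    using l2_abs_le[OF kernel_section_L2[OF x] g(1)] by (simp add: lifted_K_def l2_inner_def)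
  also have "\<dots> \<le> sqrt (l2_inner N ?k ?k) * 1"
    using g(2) l2.nonneg[OF kernel_section_L2[OF x]] by (intro mult_left_mono) auto
  finally show ?thesis by simp
qed

text \<open>Half the difference of the squared distances a, b factors as (a - b)(a + b)/2, and (a +
  b)/2 is at most a + 1 when \<open>d x y \<le> 1\<close>. The constant does not depend on
  \<open>g\<close>: this is equicontinuity over the unit ball.\<close>

lemma lifted_K_lipschitz:
  assumes x: "x \<in> X" and y: "y \<in> X" and xy: "d x y \<le> 1"
    and g: "g \<in> L2_space N" "l2_inner N g g \<le> 1"
  shows "\<bar>lifted_K g x - lifted_K g y\<bar>
    \<le> d x y * sqrt (l2_inner N (\<lambda>w. d x (\<pi> w) + 1) (\<lambda>w. d x (\<pi> w) + 1))"
proof -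
  let ?h = "\<lambda>w. d x (\<pi> w) + 1"
  have h: "?h \<in> L2_space N" by (intro L2_add dist_L2 x L2_const)
  have "\<bar>lifted_K g x - lifted_K g y\<bar>
      = \<bar>\<integral>w. mds_kernel d x (\<pi> w) * g w - mds_kernel d y (\<pi> w) * g w \<partial>N\<bar>"
    unfolding lifted_K_def using x y g
    by (subst Bochner_Integration.integral_diff) (auto intro: L2_integrable_mult kernel_section_L2)
  also have "\<dots> \<le> (\<integral>w. d x y * (?h w * \<bar>g w\<bar>) \<partial>N)"
  proof (rule integral_abs_bound[THEN order_trans], rule integral_mono)
    show "integrable N (\<lambda>w. \<bar>mds_kernel d x (\<pi> w) * g w - mds_kernel d y (\<pi> w) * g w\<bar>)"
      using x y g by (intro integrable_abs Bochner_Integration.integrable_diff L2_integrable_mult kernel_section_L2)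
    show "integrable N (\<lambda>w. d x y * (?h w * \<bar>g w\<bar>))"
      using g by (intro integrable_mult_right L2_integrable_mult h L2_abs)
    fix w assume "w \<in> space N"
    then have w: "\<pi> w \<in> X" by (rule proj_space)
    let ?a = "d x (\<pi> w)" and ?b = "d y (\<pi> w)"
    have 1: "\<bar>?a - ?b\<bar> \<le> d x y" "?b \<le> ?a + d x y"
      using triangle[OF x y w] triangle[OF y x w] commute[of x y] by auto
    have "\<bar>mds_kernel d x (\<pi> w) - mds_kernel d y (\<pi> w)\<bar> = \<bar>?a - ?b\<bar> * ((?a + ?b) / 2)"
    proof -
      have "mds_kernel d x (\<pi> w) - mds_kernel d y (\<pi> w) = - ((?a - ?b) * ((?a + ?b) / 2))"
        by (simp add: mds_kernel_def power2_eq_square field_simps)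
      then show ?thesis by (simp add: abs_mult)
    qed
    also have "\<dots> \<le> d x y * ?h w"
      using 1 xy by (intro mult_mono) auto
    finally have "\<bar>mds_kernel d x (\<pi> w) - mds_kernel d y (\<pi> w)\<bar> * \<bar>g w\<bar> \<le> d x y * ?h w * \<bar>g w\<bar>"
      by (intro mult_right_mono) auto
    then show "\<bar>mds_kernel d x (\<pi> w) * g w - mds_kernel d y (\<pi> w) * g w\<bar> \<le> d x y * (?h w * \<bar>g w\<bar>)"
      by (simp add: left_diff_distrib[symmetric] abs_mult mult.assoc)
  qed
  also have "\<dots> = d x y * l2_inner N ?h (\<lambda>w. \<bar>g w\<bar>)"
    by (simp add: l2_inner_def)
  also have "\<dots> \<le> d x y * (sqrt (l2_inner N ?h ?h) * sqrt (l2_inner N g g))"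
    using l2_abs_le[OF h L2_abs[OF g(1)]] by (intro mult_left_mono) (auto simp: l2_inner_abs)
  also have "\<dots> \<le> d x y * (sqrt (l2_inner N ?h ?h) * 1)"
    using g(2) l2.nonneg[OF h] by (intro mult_left_mono) auto
  finally show ?thesis by simp
qed

text \<open>Convergence on a countable dense set extends to all of \<open>X\<close> by equicontinuity.\<close>

lemma lifted_K_compact:
  assumes F: "\<And>n. F n \<in> L2_space N" "\<And>n. l2_inner N (F n) (F n) \<le> 1"
  shows "\<exists>r. strict_mono (r :: nat \<Rightarrow> nat) \<and> (\<forall>x\<in>X. convergent (\<lambda>n. lifted_K (F (r n)) x))"
proof -
  obtain D where D: "countable D" "D \<subseteq> X" "D \<noteq> {}" "\<And>x e. x \<in> X \<Longrightarrow> 0 < e \<Longrightarrow> \<exists>q\<in>D. d x q < e"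
    using dense by metis
  define q where "q = from_nat_into D"
  have q: "q i \<in> X" for i unfolding q_def using from_nat_into[OF D(3)] D(2) by blast
  interpret subseqs "\<lambda>i s. convergent (\<lambda>n. lifted_K (F (s n)) (q i))"
  proof
    fix i and s :: "nat \<Rightarrow> nat"
    have "bounded (range (\<lambda>n. lifted_K (F (s n)) (q i)))"
      by (rule boundedI[where B = "sqrt (l2_inner N (\<lambda>w. mds_kernel d (q i) (\<pi> w)) (\<lambda>w. mds_kernel d (q i) (\<pi> w)))"])
        (use lifted_K_bound[OF q] F in auto)
    from bounded_imp_convergent_subsequence[OF this]
    show "\<exists>r'. strict_mono r' \<and> convergent (\<lambda>n. lifted_K (F ((s \<circ> r') n)) (q i))"
      by (auto simp: o_def convergent_def)
  qed
  have diag: "convergent (\<lambda>n. lifted_K (F (diagseq n)) (q i))" for i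
  proof -
    \<comment> \<open>Only after its first \<open>Suc i\<close> terms is the diagonal sequence a
      subsequence of the one selected for \<open>q i\<close>; an initial segment does not affect
      convergence.\<close>
    have "convergent (\<lambda>n. lifted_K (F ((diagseq \<circ> (+) (Suc i)) n)) (q i))"
    proof (rule diagseq_holds)
      fix j and s r :: "nat \<Rightarrow> nat"
      assume "strict_mono r" "convergent (\<lambda>n. lifted_K (F (s n)) (q j))"
      then show "convergent (\<lambda>n. lifted_K (F ((s \<circ> r) n)) (q j))"
        using convergent_subseq_convergent[of "\<lambda>n. lifted_K (F (s n)) (q j)" r] by (simp add: o_def)
    qed
    then show ?thesis
      using convergent_ignore_initial_segment[of "\<lambda>n. lifted_K (F (diagseq n)) (q i)" "Suc i"]
      by (simp add: o_def add.commute)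
  qed
  have "convergent (\<lambda>n. lifted_K (F (diagseq n)) x)" if x: "x \<in> X" for x
  proof (rule real_Cauchy_convergent, rule metric_CauchyI)
    fix e :: real assume e: "0 < e"
    define C where "C = sqrt (l2_inner N (\<lambda>w. d x (\<pi> w) + 1) (\<lambda>w. d x (\<pi> w) + 1))"
    have C: "0 \<le> C" unfolding C_def
      by (intro real_sqrt_ge_zero l2.nonneg L2_add dist_L2 x L2_const)
    \<comment> \<open>The bound 1 is required by \<open>lifted_K_lipschitz\<close>;
      \<open>C + 1\<close> avoids a division by zero.\<close>
    obtain y where y: "y \<in> D" "d x y < min 1 (e / (3 * (C + 1)))"
      using D(4)[OF x, of "min 1 (e / (3 * (C + 1)))"] e C by auto
    then obtain i where i: "q i = y" unfolding q_def using from_nat_into_surj[OF D(1)] by blast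
    have close: "\<bar>lifted_K (F n) x - lifted_K (F n) y\<bar> \<le> e / 3" for n
    proof -
      have "\<bar>lifted_K (F n) x - lifted_K (F n) y\<bar> \<le> d x y * C"
        unfolding C_def using y D(2) by (intro lifted_K_lipschitz x F) auto
      also have "\<dots> \<le> e / (3 * (C + 1)) * (C + 1)" using y C e by (intro mult_mono) auto
      also have "\<dots> = e / 3" using C by (simp add: field_simps)
      finally show ?thesis .
    qed
    have "Cauchy (\<lambda>n. lifted_K (F (diagseq n)) y)"
      using diag[of i] i by (simp add: Cauchy_convergent_iff)
    from metric_CauchyD[OF this, of "e / 3"] e obtain n0 where
      n0: "\<And>m n. n0 \<le> m \<Longrightarrow> n0 \<le> n \<Longrightarrow> dist (lifted_K (F (diagseq m)) y) (lifted_K (F (diagseq n)) y) < e / 3"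
      by auto
    have "dist (lifted_K (F (diagseq m)) x) (lifted_K (F (diagseq n)) x) < e" if "n0 \<le> m" "n0 \<le> n" for m n
      using n0[OF that] close[of "diagseq m"] close[of "diagseq n"] unfolding dist_real_def by linarith
    then show "\<exists>n0. \<forall>m\<ge>n0. \<forall>n\<ge>n0. dist (lifted_K (F (diagseq m)) x) (lifted_K (F (diagseq n)) x) < e"
      by blast
  qed
  then show ?thesis using subseq_diagseq by blast
qed

sublocale compact_kernel N kern
proof
  show "kern \<in> L2_space (N \<Otimes>\<^sub>M N)" unfolding kern_eq by (intro L2_scale dist_sq_pair_L2)
  show "kern (z, w) = kern (w, z)" for z w
    by (simp add: kern_def mds_kernel_def commute)
  show "(\<lambda>w. kern (z, w)) \<in> L2_space N" if "z \<in> space N" for z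
    unfolding kern_def using kernel_section_L2[OF proj_space[OF that]] by simp
  show "\<exists>r. strict_mono (r :: nat \<Rightarrow> nat) \<and> (\<forall>z\<in>space N. convergent (\<lambda>n. \<integral>w. kern (z, w) * F (r n) w \<partial>N))"
    if "\<And>n. F n \<in> L2_space N" "\<And>n. l2_inner N (F n) (F n) \<le> 1" for F
    using lifted_K_compact[of F, OF that] proj_space by (fastforce simp: lifted_K_def kern_def)
qed

end

section \<open>Spectral systems of metric measure spaces\<close>

lemma orthonormal_independent:
  assumes f: "\<And>i. i < k \<Longrightarrow> f i \<in> L2_space \<mu>"
    and orth: "\<And>i j. i < k \<Longrightarrow> j < k \<Longrightarrow> l2_inner \<mu> (f i) (f j) = (if i = j then 1 else 0)"
  shows "L2_independent \<mu> k f"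
  unfolding L2_independent_def
proof (intro allI impI)
  fix c :: "nat \<Rightarrow> real" and j
  assume 0: "AE x in \<mu>. (\<Sum>i<k. c i * f i x) = 0" and j: "j < k"
  have "c j = (\<Sum>i<k. c i * l2_inner \<mu> (f i) (f j))"
    using j by (simp add: orth if_distrib[of "\<lambda>x. _ * x"] cong: if_cong)
  also have "\<dots> = l2_inner \<mu> (\<lambda>x. \<Sum>i<k. c i * f i x) (f j)"
    using f j by (subst l2.lincomb_left) auto
  also have "\<dots> = (\<integral>x. 0 \<partial>\<mu>)"
    unfolding l2_inner_def
  proof (rule integral_cong_AE)
    have "(\<lambda>x. \<Sum>i<k. c i * f i x) \<in> L2_space \<mu>" using f by (intro l2.lincomb_mem) auto
    then show "(\<lambda>x. (\<Sum>i<k. c i * f i x) * f j x) \<in> borel_measurable \<mu>"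
      using f[OF j] by (intro borel_measurable_times L2_measurable)
  qed (use 0 in auto)
  finally show "c j = 0" by simp
qed

context mds_lift
begin

lemma integral_lift: "g \<in> borel_measurable \<mu> \<Longrightarrow> (\<integral>x. g x \<partial>\<mu>) = (\<integral>z. g (\<pi> z) \<partial>N)" for g :: "'a \<Rightarrow> real"
  using integral_distr[OF proj, of g] by (simp add: distr_proj)

lemma integrable_lift: "g \<in> borel_measurable \<mu> \<Longrightarrow> integrable \<mu> g \<longleftrightarrow> integrable N (\<lambda>z. g (\<pi> z))" for g :: "'a \<Rightarrow> real"
  using integrable_distr_eq[OF proj, of g] by (simp add: distr_proj)

lemma L2_lift: "g \<in> L2_space \<mu> \<Longrightarrow> (\<lambda>z. g (\<pi> z)) \<in> L2_space N"
proof -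
  assume g: "g \<in> L2_space \<mu>"
  note [measurable] = L2_measurable[OF g]
  show ?thesis
    using L2_integrable_square[OF g] integrable_lift[of "\<lambda>x. (g x)\<^sup>2"] by (intro L2_spaceI) auto
qed

lemma inner_lift:
  assumes "f \<in> L2_space \<mu>" "g \<in> L2_space \<mu>"
  shows "l2_inner \<mu> f g = l2_inner N (\<lambda>z. f (\<pi> z)) (\<lambda>z. g (\<pi> z))"
  unfolding l2_inner_def using assms by (intro integral_lift borel_measurable_times L2_measurable)

lemma AE_lift: "AE x in \<mu>. P x \<Longrightarrow> AE z in N. P (\<pi> z)"
  by (rule AE_distrD[OF proj, of P, unfolded distr_proj])

lemma base: "mds_lift \<mu> X d \<mu> (\<lambda>x. x)"
proof (intro mds_lift.intro mds_lift_axioms.intro mm moment)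
  show "prob_space \<mu>" using mm by (simp add: mm_space_def)
  show "(\<lambda>x. x) \<in> measurable \<mu> \<mu>" by simp
  show "distr \<mu> \<mu> (\<lambda>x. x) = \<mu>" using distr_id[of \<mu>] by (simp add: id_def)
qed

lemma centering_lift: "g \<in> borel_measurable \<mu> \<Longrightarrow> centering \<mu> g (\<pi> z) = centering N (\<lambda>z. g (\<pi> z)) z"
  by (simp add: centering_def integral_lift)

lemma kernel_op_lift:
  assumes x: "x \<in> X" and g [measurable]: "g \<in> borel_measurable \<mu>"
  shows "kernel_op d \<mu> g x = lifted_K (\<lambda>z. g (\<pi> z)) x"
proof -
  have [measurable]: "d x \<in> borel_measurable \<mu>" using x by (rule dist_measurable_mu)
  show ?thesis unfolding kernel_op_def lifted_K_def mds_kernel_def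
    by (rule integral_lift) measurable
qed

text \<open>Change of variables along \<open>\<pi>\<close>. The identity holds at every
  \<open>x\<close> in \<open>X\<close>, also outside the image of \<open>\<pi>\<close>, as the
  eigenvalue equation of a descended function is verified on all of \<open>X\<close>.\<close>

lemma mds_op_lift:
  assumes g: "g \<in> L2_space \<mu>" and x: "x \<in> X"
  defines "f \<equiv> \<lambda>z. g (\<pi> z)"
  shows "mds_op d \<mu> g x = lifted_K (centering N f) x - expectation (K (centering N f))"
proof -
  interpret base: mds_lift \<mu> X d \<mu> "\<lambda>x. x" by (rule base)
  have c: "centering \<mu> g \<in> L2_space \<mu>" using g by (rule base.centering_L2)
  note [measurable] = L2_measurable[OF g] L2_measurable[OF c]
  have eq: "kernel_op d \<mu> (centering \<mu> g) x = lifted_K (centering N f) x" if "x \<in> X" for x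
    using kernel_op_lift[OF that, of "centering \<mu> g"] by (simp add: centering_lift f_def)
  have "base.K (centering \<mu> g) = kernel_op d \<mu> (centering \<mu> g)"
    by (simp add: base.K_def base.kern_def kernel_op_def fun_eq_iff)
  then have "kernel_op d \<mu> (centering \<mu> g) \<in> borel_measurable \<mu>"
    using base.K_measurable[OF c] by simp
  then have "(\<integral>x. kernel_op d \<mu> (centering \<mu> g) x \<partial>\<mu>) = (\<integral>z. kernel_op d \<mu> (centering \<mu> g) (\<pi> z) \<partial>N)"
    by (rule integral_lift)
  also have "\<dots> = expectation (K (centering N f))"
    by (intro Bochner_Integration.integral_cong) (auto simp: eq proj_space K_def lifted_K_def kern_def)
  finally show ?thesis
    unfolding mds_op_def centering_def[of \<mu> "kernel_op _ _ _"] using x eq by simp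
qed

lemma T_lifted_K: "T f z = lifted_K (centering N f) (\<pi> z) - expectation (K (centering N f))"
proof -
  have "T f z = K (centering N f) z - expectation (K (centering N f))"
    by (simp add: T_def centering_def[of N "K _"])
  also have "K (centering N f) z = lifted_K (centering N f) (\<pi> z)"
    by (simp add: K_def lifted_K_def kern_def)
  finally show ?thesis .
qed

lemma T_lift:
  assumes "g \<in> L2_space \<mu>" "z \<in> space N"
  shows "T (\<lambda>z. g (\<pi> z)) z = mds_op d \<mu> g (\<pi> z)"
  using assms by (simp add: mds_op_lift proj_space T_lifted_K)

text \<open>Joint measurability of the distance on \<open>\<mu> \<Otimes>\<^sub>M N\<close> comes
  from the identity lift, composed with \<open>\<pi>\<close> in the second argument.\<close>

lemma lifted_K_measurable:
  assumes f: "f \<in> L2_space N"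
  shows "lifted_K f \<in> borel_measurable \<mu>"
proof -
  interpret base: mds_lift \<mu> X d \<mu> "\<lambda>x. x" by (rule base)
  note [measurable] = L2_measurable[OF f]
  have "(\<lambda>p. d (fst p) (\<pi> (snd p))) \<in> borel_measurable (\<mu> \<Otimes>\<^sub>M N)"
    using measurable_compose[OF _ base.dist2_measurable, of "\<lambda>p. (fst p, \<pi> (snd p))" "\<mu> \<Otimes>\<^sub>M N"] by simp
  then have [measurable]: "(\<lambda>(x, w). d x (\<pi> w)) \<in> borel_measurable (\<mu> \<Otimes>\<^sub>M N)"
    by (simp add: case_prod_unfold)
  show ?thesis unfolding lifted_K_def mds_kernel_def by measurable
qed

text \<open>An eigenfunction of the lifted operator for a nonzero eigenvalue lies in its range, hence
  depends on \<open>\<pi> z\<close> only.\<close>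

lemma eigenfunction_descends:
  assumes f: "f \<in> L2_space N" and s: "s \<noteq> 0" and eig: "\<And>z. z \<in> space N \<Longrightarrow> T f z = s * f z"
  obtains g where "g \<in> eigenspace \<mu> (mds_op d \<mu>) s" "\<And>z. z \<in> space N \<Longrightarrow> g (\<pi> z) = f z"
proof -
  \<comment> \<open>The formula for \<open>T f z / s\<close> with \<open>\<pi> z\<close> replaced by
    a free point of \<open>X\<close>.\<close>
  define g where "g x = (1 / s) * (lifted_K (centering N f) x - expectation (K (centering N f)))" for x
  have [measurable]: "lifted_K (centering N f) \<in> borel_measurable \<mu>"
    by (intro lifted_K_measurable centering_L2 f)
  have gm: "g \<in> borel_measurable \<mu>" unfolding g_def by measurable
  have gf: "g (\<pi> z) = f z" if "z \<in> space N" for z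
  proof -
    have "g (\<pi> z) = (1 / s) * T f z"
      by (simp add: g_def T_lifted_K)
    then show ?thesis using eig[OF that] s by simp
  qed
  have g: "g \<in> L2_space \<mu>"
  proof (rule L2_spaceI[OF gm])
    have "(\<lambda>z. g (\<pi> z)) \<in> L2_space N" using L2_cong[OF f, of "\<lambda>z. g (\<pi> z)"] gf by simp
    then show "integrable \<mu> (\<lambda>x. (g x)\<^sup>2)"
      using gm integrable_lift[of "\<lambda>x. (g x)\<^sup>2"] L2_integrable_square by auto
  qed
  have "mds_op d \<mu> g x = s * g x" if x: "x \<in> X" for x
  proof -
    have "expectation (\<lambda>z. g (\<pi> z)) = expectation f"
      using gf by (intro Bochner_Integration.integral_cong) auto
    then have c: "centering N (\<lambda>z. g (\<pi> z)) z = centering N f z" if "z \<in> space N" for z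
      using gf[OF that] by (simp add: centering_def)
    then have "lifted_K (centering N (\<lambda>z. g (\<pi> z))) y = lifted_K (centering N f) y" for y
      unfolding lifted_K_def by (intro Bochner_Integration.integral_cong) auto
    moreover have "K (centering N (\<lambda>z. g (\<pi> z))) = K (centering N f)"
      unfolding K_def using c by (intro ext Bochner_Integration.integral_cong) auto
    ultimately show ?thesis using mds_op_lift[OF g x] s by (simp add: g_def)
  qed
  then have "g \<in> eigenspace \<mu> (mds_op d \<mu>) s"
    using g by (auto simp: eigenspace_def space_mu)
  with gf show thesis by (rule that[rotated])
qed

text \<open>Where \<open>lam j = 0\<close> the given \<open>u j\<close> is unconstrained and may
  fail to be measurable; the zero function takes its place as null vector.\<close>

definition lifted_eigenfunction :: "(nat \<Rightarrow> real) \<Rightarrow> (nat \<Rightarrow> 'a \<Rightarrow> real) \<Rightarrow> nat \<Rightarrow> 'z \<Rightarrow> real" where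
  "lifted_eigenfunction lam u j z = (if 0 < lam j then u j (\<pi> z) else 0)"

text \<open>The Rayleigh bound is the substance. If it failed, there would be an eigenfunction with
  eigenvalue \<open>s\<close> above \<open>lam (Suc k)\<close>, orthogonal to the first
  \<open>k\<close>. It descends to \<open>X\<close> and, together with the listed eigenfunctions for
  \<open>s\<close>, gives one independent function more than the multiplicity allows.\<close>

lemma spectral_system_lift:
  assumes pos: "positive_eigenvalues \<mu> (mds_op d \<mu>) lam"
    and onb: "orthonormal_eigenfunctions \<mu> (mds_op d \<mu>) lam u"
  shows "spectral_system (L2_space N) (l2_inner N) (centered_form kern) lam (lifted_eigenfunction lam u)"
proof -
  let ?v = "lifted_eigenfunction lam u"
  interpret base: mds_lift \<mu> X d \<mu> "\<lambda>x. x" by (rule base)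
  interpret B: symmetric_form "L2_space N" B by (rule form_symmetric)
  have decr: "lam j \<le> lam i" if "1 \<le> i" "i \<le> j" for i j
    using pos that by (simp add: positive_eigenvalues_def)
  have nn: "0 \<le> lam j" if "1 \<le> j" for j
    using pos that by (simp add: positive_eigenvalues_def)
  have u: "u j \<in> L2_space \<mu>" "AE x in \<mu>. mds_op d \<mu> (u j) x = lam j * u j x"
    "u j \<in> eigenspace \<mu> (mds_op d \<mu>) (lam j)"
    if "1 \<le> j" "0 < lam j" for j
    using onb that by (auto simp: orthonormal_eigenfunctions_def eigenspace_def)
  have u_orth: "l2_inner \<mu> (u i) (u j) = (if i = j then 1 else 0)"
    if "1 \<le> i" "1 \<le> j" "0 < lam i" "0 < lam j" for i j
    using onb that by (simp add: orthonormal_eigenfunctions_def l2_inner_def)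
  have v: "?v j \<in> L2_space N" if "1 \<le> j" for j
    using that u L2_const[of 0] by (cases "0 < lam j") (auto simp: lifted_eigenfunction_def[abs_def] intro: L2_lift)
  have v_orth: "l2_inner N (?v i) (?v j) = (if i = j \<and> 0 < lam i then 1 else 0)" if "1 \<le> i" "1 \<le> j" for i j
  proof (cases "0 < lam i \<and> 0 < lam j")
    case True
    then show ?thesis using u u_orth that
      by (simp add: lifted_eigenfunction_def[abs_def] inner_lift)
  qed (auto simp: lifted_eigenfunction_def l2_inner_def)
  have eigen: "B (?v j) g = lam j * l2_inner N (?v j) g" if j: "1 \<le> j" and g: "g \<in> L2_space N" for j g
  proof (cases "0 < lam j")
    case True
    have vj: "?v j = (\<lambda>z. u j (\<pi> z))" using True by (simp add: lifted_eigenfunction_def fun_eq_iff)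
    have uL: "u j \<in> L2_space \<mu>" using u j True by simp
    have "AE z in N. mds_op d \<mu> (u j) (\<pi> z) = lam j * u j (\<pi> z)"
      using u(2)[OF j True] by (rule AE_lift)
    then have AE: "AE z in N. T (?v j) z = lam j * ?v j z"
      using AE_space by eventually_elim (simp add: vj T_lift[OF uL])
    have "B (?v j) g = l2_inner N (T (?v j)) g"
      using B.commute[OF v[OF j] g] form_T[OF g v[OF j]] l2.commute[OF g T_L2[OF v[OF j]]] by simp
    also have "\<dots> = (\<integral>z. (lam j * ?v j z) * g z \<partial>N)"
      unfolding l2_inner_def
    proof (rule integral_cong_AE)
      show "(\<lambda>z. T (?v j) z * g z) \<in> borel_measurable N"
        by (intro borel_measurable_times L2_measurable T_L2 v j g)
      show "(\<lambda>z. lam j * ?v j z * g z) \<in> borel_measurable N"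
        by (rule borel_measurable_times[OF L2_measurable[OF L2_scale[OF v[OF j]]] L2_measurable[OF g]])
    qed (use AE in auto)
    finally show ?thesis by (simp add: l2_inner_def mult.assoc)
  next
    case False
    then have "?v j = (\<lambda>_. 0)" by (simp add: lifted_eigenfunction_def fun_eq_iff)
    then show ?thesis using g by (simp add: B.zero_left l2.zero_left)
  qed
  have rayleigh: "B h h \<le> lam (Suc k) * l2_inner N h h"
    if h: "h \<in> L2_space N" "\<And>i. i \<in> {1..k} \<Longrightarrow> l2_inner N h (?v i) = 0" for h k
  proof (rule ccontr)
    assume "\<not> B h h \<le> lam (Suc k) * l2_inner N h h"
    then have "lam (Suc k) * l2_inner N h h < B h h" by simp
    from eigenfunction_exists[where I = "{1..k}" and v = ?v and l = lam, OF _ _ h(1) h(2) nn this] v eigen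
    obtain s f where s: "lam (Suc k) < s" and f: "f \<in> L2_space N" "l2_inner N f f = 1"
      "\<And>i. i \<in> {1..k} \<Longrightarrow> l2_inner N f (?v i) = 0" "\<And>z. z \<in> space N \<Longrightarrow> T f z = s * f z"
      by auto
    have s0: "0 < s" using s nn[of "Suc k"] by simp
    obtain g where g: "g \<in> eigenspace \<mu> (mds_op d \<mu>) s" "\<And>z. z \<in> space N \<Longrightarrow> g (\<pi> z) = f z"
      using eigenfunction_descends[OF f(1) _ f(4)] s0 by auto
    have gL: "g \<in> L2_space \<mu>" using g(1) by (simp add: eigenspace_def)
    define J where "J = {j. 1 \<le> j \<and> lam j = s}"
    have J: "finite J" "enat (card J) = eigen_multiplicity \<mu> (mds_op d \<mu>) s"
      using pos s0 by (auto simp: positive_eigenvalues_def J_def)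
    \<comment> \<open>All indices listed with eigenvalue \<open>s\<close> are at most
      \<open>k\<close>, since \<open>s\<close> exceeds \<open>lam (Suc k)\<close>; so the new
      function is orthogonal to each of their eigenfunctions.\<close>
    have Jk: "j \<in> {1..k} \<and> 0 < lam j \<and> lam j = s" if "j \<in> J" for j
      using that s s0 decr[of "Suc k" j] by (auto simp: J_def not_less_eq_eq[symmetric])
    define p where "p = card J"
    obtain e where e: "bij_betw e {..<p} J"
      using ex_bij_betw_nat_finite[OF J(1)] by (auto simp: p_def atLeast0LessThan)
    have eJ: "e i \<in> J" if "i < p" for i using e that by (auto simp: bij_betw_def)
    define F where "F i = (if i < p then u (e i) else g)" for i
    have F: "F i \<in> eigenspace \<mu> (mds_op d \<mu>) s" for i
      using g(1) u(3) Jk[OF eJ, of i] by (auto simp: F_def)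
    then have FL: "F i \<in> L2_space \<mu>" for i by (simp add: eigenspace_def)
    have gg: "l2_inner \<mu> g g = 1"
    proof -
      have "l2_inner \<mu> g g = l2_inner N f f" unfolding inner_lift[OF gL gL] by (rule l2_inner_cong) (auto simp: g)
      then show ?thesis using f by simp
    qed
    have gu: "l2_inner \<mu> g (u (e i)) = 0" if "i < p" for i
    proof -
      have *: "e i \<in> {1..k}" "0 < lam (e i)" using Jk[OF eJ[OF that]] by auto
      then have "l2_inner \<mu> g (u (e i)) = l2_inner N f (?v (e i))"
        using inner_lift[OF gL u(1)[of "e i"]] by (simp add: lifted_eigenfunction_def g cong: l2_inner_cong)
      then show ?thesis using f(3) * by simp
    qed
    have "l2_inner \<mu> (F i) (F j) = (if i = j then 1 else 0)" if ij: "i < Suc p" "j < Suc p" for i j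
    proof -
      consider "i < p" "j < p" | "i < p" "j = p" | "i = p" "j < p" | "i = p" "j = p" using ij by linarith
      then show ?thesis
      proof cases
        case 1
        then have "e i = e j \<longleftrightarrow> i = j" using e by (auto simp: bij_betw_def inj_on_def)
        with 1 show ?thesis using Jk[OF eJ, of i] Jk[OF eJ, of j] by (simp add: F_def u_orth)
      next
        case 2
        then show ?thesis using gu[of i] l2.commute[OF FL[of i] gL] by (simp add: F_def)
      qed (simp_all add: F_def gu gg)
    qed
    then have "L2_independent \<mu> (Suc p) F"
      using FL by (intro orthonormal_independent) auto
    then have "enat (Suc p) \<le> eigen_multiplicity \<mu> (mds_op d \<mu>) s"
      unfolding eigen_multiplicity_def using F by (intro Sup_upper) blast
    with J(2) show False by (simp flip: J(2) p_def)
  qed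
  show ?thesis
    by unfold_locales (use v v_orth eigen decr nn rayleigh form_symmetric in \<open>auto\<close>)
qed

end

section \<open>Convergence of spectral systems\<close>

definition entry_box :: "(real ^ 'm ^ 'm) set" where
  "entry_box = {M. \<forall>i j. \<bar>M $ i $ j\<bar> \<le> 1}"

lemma compact_entry_box: "compact (entry_box :: (real ^ 'm::finite ^ 'm) set)"
  unfolding compact_eq_bounded_closed
proof
  show "bounded (entry_box :: (real ^ 'm ^ 'm) set)"
  proof (rule boundedI)
    fix M :: "real ^ 'm ^ 'm" assume M: "M \<in> entry_box"
    have row: "norm (M $ i) \<le> real CARD('m)" for i
    proof -
      have "norm (M $ i) \<le> (\<Sum>j\<in>UNIV. \<bar>M $ i $ j\<bar>)" by (rule norm_le_l1_cart)
      also have "\<dots> \<le> (\<Sum>j\<in>(UNIV :: 'm set). 1)" using M by (intro sum_mono) (auto simp: entry_box_def)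
      finally show ?thesis by simp
    qed
    have "norm M \<le> (\<Sum>i\<in>UNIV. norm (M $ i))" by (simp add: norm_vec_def L2_set_le_sum)
    also have "\<dots> \<le> (\<Sum>i\<in>(UNIV :: 'm set). real CARD('m))" using row by (intro sum_mono) auto
    finally show "norm M \<le> real CARD('m) * real CARD('m)" by simp
  qed
  show "closed (entry_box :: (real ^ 'm ^ 'm) set)"
    unfolding entry_box_def by (intro closed_Collect_all closed_Collect_le continuous_intros)
qed

lemma continuous_on_gram: "continuous_on S (\<lambda>M :: real ^ 'm::finite ^ 'm. M ** transpose M)"
  unfolding matrix_matrix_mult_def transpose_def by (simp, intro continuous_intros)

lemma orthogonal_matrix_gram: "orthogonal_matrix Q \<longleftrightarrow> Q ** transpose Q = mat 1" for Q :: "real ^ 'm::finite ^ 'm"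
  by (metis matrix_left_right_inverse orthogonal_matrix_def)

lemma gram_nth: "(M ** transpose M) $ a $ b = (\<Sum>c\<in>UNIV. M $ a $ c * M $ b $ c)" for M :: "real ^ 'm::finite ^ 'm"
  by (simp add: matrix_matrix_mult_def transpose_def)

lemma orthogonal_in_entry_box:
  fixes Q :: "real ^ 'm::finite ^ 'm"
  assumes "orthogonal_matrix Q"
  shows "Q \<in> entry_box"
  unfolding entry_box_def
proof (intro CollectI allI)
  fix i j
  have "(Q $ i $ j)\<^sup>2 \<le> (\<Sum>c\<in>UNIV. (Q $ i $ c)\<^sup>2)" by (intro member_le_sum) auto
  also have "\<dots> = (Q ** transpose Q) $ i $ i" by (simp add: gram_nth power2_eq_square)
  also have "\<dots> = 1" using assms by (simp add: orthogonal_matrix_gram mat_def)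
  finally show "\<bar>Q $ i $ j\<bar> \<le> 1" by (simp add: abs_square_le_1)
qed

lemma closed_orthogonal: "closed {Q :: real ^ 'm::finite ^ 'm. orthogonal_matrix Q}"
  unfolding orthogonal_matrix_gram by (intro closed_Collect_eq continuous_on_gram continuous_on_const)

lemma compact_orthogonal: "compact {Q :: real ^ 'm::finite ^ 'm. orthogonal_matrix Q}"
proof -
  have "{Q :: real ^ 'm ^ 'm. orthogonal_matrix Q} = entry_box \<inter> {Q. orthogonal_matrix Q}"
    using orthogonal_in_entry_box by auto
  then show ?thesis using compact_Int_closed[OF compact_entry_box closed_orthogonal] by metis
qed

text \<open>On the compact set of matrices at distance at least \<open>e\<close> from the orthogonal group the Gram
  matrix stays away from the identity.\<close>

lemma approx_orthogonal:
  fixes A :: "nat \<Rightarrow> real ^ 'm::finite ^ 'm"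
  assumes box: "\<And>n. A n \<in> entry_box" and lim: "(\<lambda>n. A n ** transpose (A n)) \<longlonglongrightarrow> mat 1"
  obtains Q where "\<And>n. orthogonal_matrix (Q n)" "(\<lambda>n. Q n - A n) \<longlonglongrightarrow> 0"
proof -
  let ?O = "{Q :: real ^ 'm ^ 'm. orthogonal_matrix Q}"
  have ne: "?O \<noteq> {}" using orthogonal_matrix_id by blast
  \<comment> \<open>\<open>Q n\<close> is a nearest orthogonal matrix, so it remains to see that the
    distance to the group tends to 0.\<close>
  have "\<exists>Q. orthogonal_matrix Q \<and> infdist (A n) ?O = dist (A n) Q" for n
    using infdist_attains_inf[OF closed_orthogonal ne, of "A n"] by blast
  then obtain Q where Q: "\<And>n. orthogonal_matrix (Q n)" "\<And>n. infdist (A n) ?O = dist (A n) (Q n)"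
    by metis
  have "(\<lambda>n. infdist (A n) ?O) \<longlonglongrightarrow> 0"
  proof (rule LIMSEQ_I)
    fix e :: real assume e: "0 < e"
    define C where "C = entry_box \<inter> {M. e \<le> infdist M ?O}"
    have C: "compact C" unfolding C_def
      by (intro compact_Int_closed compact_entry_box closed_Collect_le continuous_intros)
    obtain \<delta> where \<delta>: "0 < \<delta>" "\<And>M. M \<in> C \<Longrightarrow> \<delta> \<le> dist (M ** transpose M) (mat 1)"
    proof (cases "C = {}")
      case False
      obtain M where M: "M \<in> C" "\<And>M'. M' \<in> C \<Longrightarrow> dist (M ** transpose M) (mat 1) \<le> dist (M' ** transpose M') (mat 1)"
        using continuous_attains_inf[OF C False, of "\<lambda>M. dist (M ** transpose M) (mat 1)"]
          continuous_on_dist[OF continuous_on_gram continuous_on_const] by blast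
      have "M ** transpose M \<noteq> mat 1"
      proof
        assume "M ** transpose M = mat 1"
        then have "infdist M ?O = 0" by (intro infdist_zero) (simp add: orthogonal_matrix_gram)
        with M(1) e show False by (simp add: C_def)
      qed
      with M that[of "dist (M ** transpose M) (mat 1)"] show thesis by simp
    qed (use that[of 1] in auto)
    from metric_LIMSEQ_D[OF lim \<delta>(1)] obtain n0
      where n0: "\<And>n. n0 \<le> n \<Longrightarrow> dist (A n ** transpose (A n)) (mat 1) < \<delta>" by blast
    have "infdist (A n) ?O < e" if "n0 \<le> n" for n
      using n0[OF that] \<delta>(2)[of "A n"] box[of n] by (force simp: C_def)
    then show "\<exists>n0. \<forall>n\<ge>n0. norm (infdist (A n) ?O - 0) < e"
      by (auto simp: infdist_nonneg)
  qed
  then have "(\<lambda>n. Q n - A n) \<longlonglongrightarrow> 0"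
    unfolding Q(2) by (subst tendsto_norm_zero_iff[symmetric]) (simp add: dist_norm norm_minus_commute)
  with Q(1) show thesis by (rule that)
qed

text \<open>If \<open>lam j\<close> were larger, call it \<open>s\<close>: by monotonicity
  \<open>lam'\<close> takes the value \<open>s\<close> only before \<open>j\<close>, where both
  lists agree, while \<open>lam\<close> takes it at \<open>j\<close> as well. The two counts would
  differ, yet both are the multiplicity of \<open>s\<close>.\<close>

lemma positive_eigenvalues_le:
  assumes l: "positive_eigenvalues \<mu> T lam" and l': "positive_eigenvalues \<mu> T lam'"
    and j: "1 \<le> j" and eq: "\<And>i. 1 \<le> i \<Longrightarrow> i < j \<Longrightarrow> lam i = lam' i"
  shows "lam j \<le> lam' j"
proof (rule ccontr)
  assume less: "\<not> lam j \<le> lam' j"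
  define s where "s = lam j"
  have s: "0 < s" using less l' j by (force simp: positive_eigenvalues_def s_def)
  let ?J = "{i. 1 \<le> i \<and> lam i = s}" and ?J' = "{i. 1 \<le> i \<and> lam' i = s}"
  have "finite ?J" "enat (card ?J) = eigen_multiplicity \<mu> T s"
    using l s unfolding positive_eigenvalues_def by blast+
  moreover have "enat (card ?J') = eigen_multiplicity \<mu> T s"
    using l' s unfolding positive_eigenvalues_def by blast
  ultimately have fin: "finite ?J" and "card ?J = card ?J'" by (simp_all flip: enat.inject)
  moreover have "?J' \<subset> ?J"
  proof
    show "?J' \<subseteq> ?J"
    proof
      fix i assume i: "i \<in> ?J'"
      have "i < j"
      proof (rule ccontr)
        assume "\<not> i < j"
        then have "lam' i \<le> lam' j" using l' j by (auto simp: positive_eigenvalues_def)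
        with i less show False by (simp add: s_def)
      qed
      with i eq show "i \<in> ?J" by simp
    qed
    have "j \<in> ?J" "j \<notin> ?J'" using j less by (auto simp: s_def)
    then show "?J' \<noteq> ?J" by blast
  qed
  ultimately show False using psubset_card_mono[OF fin, of ?J'] by simp
qed

text \<open>An MDS map brings its own eigenvalue list, while the gap is assumed for a given one;
  uniqueness identifies them.\<close>

lemma positive_eigenvalues_unique:
  assumes "positive_eigenvalues \<mu> T lam" and "positive_eigenvalues \<mu> T lam'" and "1 \<le> j"
  shows "lam j = lam' j"
  using assms(3)
proof (induction j rule: less_induct)
  case (less j)
  then have "lam j \<le> lam' j" by (intro positive_eigenvalues_le[OF assms(1,2)]) auto
  moreover from less have "lam' j \<le> lam j" by (intro positive_eigenvalues_le[OF assms(2,1)]) auto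
  ultimately show ?case by simp
qed

text \<open>Equality would place both \<open>j\<close> and \<open>Suc j\<close> among the indices of
  an eigenvalue of multiplicity 1.\<close>

lemma simple_eigenvalues_gap:
  assumes pos: "positive_eigenvalues \<mu> T lam" and j: "1 \<le> j" "0 < lam j"
    and simple: "eigen_multiplicity \<mu> T (lam j) = 1"
  shows "lam (Suc j) < lam j"
proof (rule ccontr)
  assume "\<not> lam (Suc j) < lam j"
  moreover have "lam (Suc j) \<le> lam j" using pos j by (simp add: positive_eigenvalues_def)
  ultimately have eq: "lam (Suc j) = lam j" by simp
  let ?J = "{i. 1 \<le> i \<and> lam i = lam j}"
  have "finite ?J" "enat (card ?J) = 1"
    using pos j simple unfolding positive_eigenvalues_def by auto
  moreover have "{j, Suc j} \<subseteq> ?J" using eq j by auto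
  ultimately show False using card_mono[of ?J "{j, Suc j}"] by (simp add: one_enat_def)
qed

section \<open>Limits of the matrices of inner products\<close>

locale spectral_convergence = spectral_system V ip B lam v
  for V :: "('z \<Rightarrow> real) set" and ip B lam v +
  fixes B' lam' v' and \<epsilon> :: "nat \<Rightarrow> real"
  assumes two: "\<And>n. two_spectral_systems V ip B lam v (B' n) (lam' n) (v' n) (\<epsilon> n)"
    and eps: "\<epsilon> \<longlonglongrightarrow> 0"
begin

definition A :: "nat \<Rightarrow> nat \<Rightarrow> nat \<Rightarrow> real" where
  "A n j i = ip (v j) (v' n i)"

lemma row_le: "1 \<le> j \<Longrightarrow> (\<Sum>i=1..k. (A n j i)\<^sup>2) \<le> 1"
  unfolding A_def by (rule two_spectral_systems.row_le[OF two])

lemma col_le: "1 \<le> i \<Longrightarrow> (\<Sum>j=1..k. (A n j i)\<^sup>2) \<le> 1"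
  unfolding A_def by (rule two_spectral_systems.col_le[OF two])

lemma A_le: assumes "1 \<le> j" "1 \<le> i" shows "\<bar>A n j i\<bar> \<le> 1"
proof -
  have "(A n j i)\<^sup>2 \<le> (\<Sum>l=1..i. (A n j l)\<^sup>2)" using assms by (intro member_le_sum) auto
  with row_le[OF assms(1), of n i] show ?thesis by (simp add: abs_square_le_1[symmetric])
qed

text \<open>The row deficits are nonnegative and their sum is at most
  \<open>2 * k * \<epsilon> n\<close> over the gap, so each one tends to 0.\<close>

lemma row_limit:
  assumes gap: "lam (Suc k) < lam k" and j: "j \<in> {1..k}"
  shows "(\<lambda>n. \<Sum>i=1..k. (A n j i)\<^sup>2) \<longlonglongrightarrow> 1"
proof -
  let ?a = "\<lambda>n j. \<Sum>i=1..k. (A n j i)\<^sup>2"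
  let ?g = "lam k - lam (Suc k)"
  have up: "(\<lambda>n. 2 * k * \<epsilon> n / ?g) \<longlonglongrightarrow> 0"
    using tendsto_mult_right_zero[OF eps, of "2 * k / ?g"] by simp
  have "1 - ?a n j \<le> 2 * k * \<epsilon> n / ?g" for n
  proof -
    have "1 - ?a n j \<le> (\<Sum>j=1..k. 1 - ?a n j)"
      using j row_le by (intro member_le_sum[where f = "\<lambda>j. 1 - ?a n j"]) auto
    also have "\<dots> \<le> 2 * k * \<epsilon> n / ?g"
      using gap two_spectral_systems.gap[OF two, of k n] by (simp add: pos_le_divide_eq mult.commute A_def)
    finally show ?thesis .
  qed
  moreover have "0 \<le> 1 - ?a n j" for n using j row_le[of j] by simp
  ultimately have "(\<lambda>n. 1 - ?a n j) \<longlonglongrightarrow> 0"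
    using tendsto_zero_bound[OF up, of "\<lambda>n. 1 - ?a n j"] by simp
  from tendsto_diff[OF tendsto_const[of 1] this] show ?thesis by simp
qed

lemma gram_limit:
  assumes gap: "lam (Suc k) < lam k" and jl: "j \<in> {1..k}" "l \<in> {1..k}"
  shows "(\<lambda>n. \<Sum>i=1..k. A n j i * A n l i) \<longlonglongrightarrow> (if j = l then 1 else 0)"
proof (cases "j = l")
  case True
  then show ?thesis using row_limit[OF gap jl(1)] by (simp add: power2_eq_square)
next
  case False
  let ?a = "\<lambda>n j. \<Sum>i=1..k. (A n j i)\<^sup>2"
  have "(\<lambda>n. (2 - ?a n j - ?a n l) / 2) \<longlonglongrightarrow> (2 - 1 - 1) / 2"
    using jl by (intro tendsto_intros row_limit gap) auto
  then have "(\<lambda>n. (2 - ?a n j - ?a n l) / 2) \<longlonglongrightarrow> 0"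
    by simp
  moreover have "\<bar>\<Sum>i=1..k. A n j i * A n l i\<bar> \<le> (2 - ?a n j - ?a n l) / 2" for n
    using two_spectral_systems.row_products[OF two, of j l n k] jl False by (simp add: A_def)
  ultimately have "(\<lambda>n. \<Sum>i=1..k. A n j i * A n l i) \<longlonglongrightarrow> 0"
    by (rule tendsto_zero_bound)
  with False show ?thesis by simp
qed

text \<open>Comparing forms at \<open>v' n i\<close> bounds \<open>lam' n i\<close> by
  \<open>lam 1 + \<epsilon> n\<close>. Boundedness suffices, because it is only used where
  \<open>sqrt (lam' n i)\<close> multiplies a quantity tending to 0.\<close>

lemma lam'_bounded:
  obtains C where "\<And>n i. 1 \<le> i \<Longrightarrow> 0 \<le> lam' n i \<and> lam' n i \<le> C"
proof -
  obtain E where E: "\<And>n. \<bar>\<epsilon> n\<bar> \<le> E"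
    using convergent_imp_Bseq[OF convergentI[OF eps]] by (auto simp: Bseq_def)
  show thesis
  proof (rule that)
    fix n i :: nat assume i: "1 \<le> i"
    interpret two_spectral_systems V ip B lam v "B' n" "lam' n" "v' n" "\<epsilon> n" by (rule two)
    have "lam' n i = B' n (v' n i) (v' n i)"
      using i S2.lam_nonneg[of i] by (simp add: S2.eigen S2.v_mem S2.v_orth)
    also have "\<dots> \<le> B (v' n i) (v' n i) + \<epsilon> n"
      using close[of "v' n i" "v' n i"] i S2.v_mem[of i] S2.v_norm_le[of i] by simp
    \<comment> \<open>With \<open>k = 0\<close> the orthogonality condition of
      \<open>rayleigh\<close> is empty.\<close>
    also have "B (v' n i) (v' n i) \<le> lam (Suc 0) * ip (v' n i) (v' n i)"
      using i S2.v_mem by (intro rayleigh[where k = 0]) auto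
    also have "\<dots> \<le> lam (Suc 0) * 1"
      using i S2.v_norm_le lam_nonneg by (intro mult_left_mono) auto
    finally show "0 \<le> lam' n i \<and> lam' n i \<le> lam (Suc 0) + E"
      using E[of n] S2.lam_nonneg[OF i] by simp
  qed
qed

text \<open>Multiplied by \<open>sqrt (lam j) + sqrt (lam' n i)\<close>, the difference becomes the
  quantity of \<open>entry_bound\<close>, and this factor is at least
  \<open>sqrt (lam j) > 0\<close>.\<close>

lemma sqrt_limit:
  assumes j: "1 \<le> j" "0 < lam j" and i: "1 \<le> i"
  shows "(\<lambda>n. sqrt (lam j) * A n j i - A n j i * sqrt (lam' n i)) \<longlonglongrightarrow> 0"
proof (rule Lim_null_comparison)
  have "(\<lambda>n. \<epsilon> n / sqrt (lam j)) \<longlonglongrightarrow> 0 / sqrt (lam j)"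
    using j by (intro tendsto_intros eps) auto
  then show "(\<lambda>n. \<epsilon> n / sqrt (lam j)) \<longlonglongrightarrow> 0" by simp
  show "\<forall>\<^sub>F n in sequentially. norm (sqrt (lam j) * A n j i - A n j i * sqrt (lam' n i)) \<le> \<epsilon> n / sqrt (lam j)"
  proof (intro always_eventually allI)
    fix n
    interpret two_spectral_systems V ip B lam v "B' n" "lam' n" "v' n" "\<epsilon> n" by (rule two)
    let ?s = "sqrt (lam j)" and ?t = "sqrt (lam' n i)"
    have pos: "0 < ?s" "0 \<le> ?t" using j S2.lam_nonneg[OF i] by auto
    have "(lam j - lam' n i) * A n j i = (?s * A n j i - A n j i * ?t) * (?s + ?t)"
    proof -
      have "lam j = ?s * ?s" "lam' n i = ?t * ?t" using j S2.lam_nonneg[OF i] by simp_all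
      then have "(lam j - lam' n i) * A n j i = (?s * ?s - ?t * ?t) * A n j i" by (simp only:)
      also have "(x * x - y * y) * a = (x * a - a * y) * (x + y)" for x y a :: real by (simp add: algebra_simps)
      finally show ?thesis .
    qed
    then have "\<bar>?s * A n j i - A n j i * ?t\<bar> * (?s + ?t) = \<bar>(lam j - lam' n i) * A n j i\<bar>"
      using pos by (simp add: abs_mult)
    also have "\<dots> \<le> \<epsilon> n" using entry_bound[OF j(1) i] by (simp add: A_def)
    finally have "\<bar>?s * A n j i - A n j i * ?t\<bar> * (?s + ?t) \<le> \<epsilon> n" .
    moreover have "\<bar>?s * A n j i - A n j i * ?t\<bar> * ?s \<le> \<bar>?s * A n j i - A n j i * ?t\<bar> * (?s + ?t)"
      using pos by (intro mult_left_mono) auto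
    ultimately show "norm (?s * A n j i - A n j i * ?t) \<le> \<epsilon> n / ?s"
      using pos by (simp add: pos_le_divide_eq)
  qed
qed

definition F :: "nat \<Rightarrow> nat \<Rightarrow> (nat \<Rightarrow> real) \<Rightarrow> nat \<Rightarrow> 'z \<Rightarrow> real" where
  "F m j R n = (\<lambda>z. sqrt (lam j) * v j z - (\<Sum>i=1..m. (R i * sqrt (lam' n i)) * v' n i z))"

lemma F_norm:
  assumes "1 \<le> j" "0 < lam j"
  shows "ip (F m j R n) (F m j R n) = lam j * (1 - (\<Sum>i=1..m. (A n j i)\<^sup>2))
    + (\<Sum>i=1..m. (sqrt (lam j) * A n j i - R i * sqrt (lam' n i))\<^sup>2)"
  unfolding F_def A_def by (rule two_spectral_systems.map_distance[OF two assms])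

lemma F_limit:
  assumes gap: "lam (Suc m) < lam m" and j: "j \<in> {1..m}"
    and R: "\<And>i. i \<in> {1..m} \<Longrightarrow> (\<lambda>n. R n i - A n j i) \<longlonglongrightarrow> 0"
  shows "(\<lambda>n. ip (F m j (R n) n) (F m j (R n) n)) \<longlonglongrightarrow> 0"
proof -
  have lam: "0 < lam j"
    using gap lam_nonneg[of "Suc m"] decreasing[of j m] j by auto
  obtain C where C: "\<And>n i. 1 \<le> i \<Longrightarrow> 0 \<le> lam' n i \<and> lam' n i \<le> C" using lam'_bounded by metis
  have "(\<lambda>n. sqrt (lam j) * A n j i - R n i * sqrt (lam' n i)) \<longlonglongrightarrow> 0" if i: "i \<in> {1..m}" for i
  proof -
    have "(\<lambda>n. (R n i - A n j i) * sqrt (lam' n i)) \<longlonglongrightarrow> 0"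
    proof (rule Lim_null_comparison)
      show "\<forall>\<^sub>F n in sequentially. norm ((R n i - A n j i) * sqrt (lam' n i)) \<le> \<bar>R n i - A n j i\<bar> * sqrt C"
        using C[of i] i by (intro always_eventually allI) (auto simp: abs_mult intro!: mult_left_mono)
      show "(\<lambda>n. \<bar>R n i - A n j i\<bar> * sqrt C) \<longlonglongrightarrow> 0"
        using tendsto_mult_left_zero[OF tendsto_rabs_zero[OF R[OF i]]] .
    qed
    \<comment> \<open>Insertion of \<open>A n j i * sqrt (lam' n i)\<close>: the weight is exchanged
      first, then the coefficient.\<close>
    from tendsto_diff[OF sqrt_limit[of j i] this] show ?thesis
      using i j lam by (simp add: algebra_simps)
  qed
  then have "(\<lambda>n. lam j * (1 - (\<Sum>i=1..m. (A n j i)\<^sup>2))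
    + (\<Sum>i=1..m. (sqrt (lam j) * A n j i - R n i * sqrt (lam' n i))\<^sup>2)) \<longlonglongrightarrow> lam j * (1 - 1) + (\<Sum>i=1..m. 0\<^sup>2)"
    using j by (intro tendsto_add tendsto_mult tendsto_diff tendsto_const row_limit gap tendsto_sum tendsto_power) auto
  then show ?thesis using j lam by (simp add: F_norm)
qed

text \<open>Columns restrict the entries left of the diagonal: \<open>(A n k i)\<^sup>2\<close> is
  at most the deficit of column \<open>i\<close> in the leading block of size \<open>k - 1\<close>.
  Summed over \<open>i\<close>, the column deficits of that block equal its row deficits, which
  vanish in the limit by the gap at \<open>k - 1\<close>; all the mass of row \<open>k\<close> is
  left to the diagonal.\<close>

lemma diagonal_limit:
  assumes gap: "\<And>l. l \<in> {1..k} \<Longrightarrow> lam (Suc l) < lam l" and k: "1 \<le> k"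
  shows "(\<lambda>n. (A n k k)\<^sup>2) \<longlonglongrightarrow> 1"
proof -
  obtain p where p: "k = Suc p" using k by (cases k) auto
  let ?off = "\<lambda>n. \<Sum>i=1..p. (A n k i)\<^sup>2"
  have off: "?off \<longlonglongrightarrow> 0"
  proof (rule tendsto_sandwich[OF _ _ tendsto_const])
    have "(\<lambda>n. \<Sum>j=1..p. 1 - (\<Sum>i=1..p. (A n j i)\<^sup>2)) \<longlonglongrightarrow> (\<Sum>j=1..p. 1 - 1)"
      by (intro tendsto_sum tendsto_diff tendsto_const row_limit gap) (auto simp: p)
    then show "(\<lambda>n. \<Sum>j=1..p. 1 - (\<Sum>i=1..p. (A n j i)\<^sup>2)) \<longlonglongrightarrow> 0" by simp
    show "\<forall>\<^sub>F n in sequentially. ?off n \<le> (\<Sum>j=1..p. 1 - (\<Sum>i=1..p. (A n j i)\<^sup>2))"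
    proof (intro always_eventually allI)
      fix n
      have "?off n \<le> (\<Sum>i=1..p. 1 - (\<Sum>j=1..p. (A n j i)\<^sup>2))"
        using col_le[of _ n k] by (intro sum_mono) (simp add: p algebra_simps)
      also have "\<dots> = (\<Sum>j=1..p. 1 - (\<Sum>i=1..p. (A n j i)\<^sup>2))"
        unfolding sum_subtractf by (subst sum.swap) simp
      finally show "?off n \<le> (\<Sum>j=1..p. 1 - (\<Sum>i=1..p. (A n j i)\<^sup>2))" .
    qed
  qed (auto intro!: always_eventually sum_nonneg)
  have "(\<lambda>n. (\<Sum>i=1..k. (A n k i)\<^sup>2) - ?off n) \<longlonglongrightarrow> 1 - 0"
    using k by (intro tendsto_diff off row_limit gap) auto
  then show ?thesis by (simp add: p)
qed

text \<open>For |x| at most 1 the distance from x to its sign is 1 - |x|, at most 1 - x^2. Off the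
  diagonal, an entry is bounded by what the diagonal leaves of the row sum.\<close>

lemma sign_limit:
  assumes gap: "\<And>l. l \<in> {1..m} \<Longrightarrow> lam (Suc l) < lam l" and ji: "j \<in> {1..m}" "i \<in> {1..m}"
  shows "(\<lambda>n. (if j = i then (if 0 \<le> A n j j then 1 else -1) else 0) - A n j i) \<longlonglongrightarrow> 0"
proof -
  have d: "(\<lambda>n. (A n j j)\<^sup>2) \<longlonglongrightarrow> 1"
    using ji gap by (intro diagonal_limit) auto
  show ?thesis
  proof (cases "j = i")
    case True
    have "(\<lambda>n. 1 - (A n j j)\<^sup>2) \<longlonglongrightarrow> 0" using tendsto_diff[OF tendsto_const[of 1] d] by simp
    moreover have "\<bar>(if 0 \<le> A n j j then 1 else -1) - A n j j\<bar> \<le> 1 - (A n j j)\<^sup>2" for n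
    proof -
      have a: "\<bar>A n j j\<bar> \<le> 1" using ji by (intro A_le) auto
      have "\<bar>A n j j\<bar> * \<bar>A n j j\<bar> \<le> \<bar>A n j j\<bar> * 1" using a by (intro mult_left_mono) auto
      then have "(A n j j)\<^sup>2 \<le> \<bar>A n j j\<bar>" by (simp add: power2_eq_square)
      with a show ?thesis by auto
    qed
    ultimately have "(\<lambda>n. (if 0 \<le> A n j j then 1 else -1) - A n j j) \<longlonglongrightarrow> 0"
      by (rule tendsto_zero_bound)
    with True show ?thesis by simp
  next
    case False
    have "(\<lambda>n. (\<Sum>i=1..m. (A n j i)\<^sup>2) - (A n j j)\<^sup>2) \<longlonglongrightarrow> 1 - 1"
      using ji by (intro tendsto_diff d row_limit gap) auto
    moreover have "(A n j i)\<^sup>2 \<le> (\<Sum>i=1..m. (A n j i)\<^sup>2) - (A n j j)\<^sup>2" for n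
    proof -
      have "(\<Sum>i\<in>{j, i}. (A n j i)\<^sup>2) \<le> (\<Sum>i=1..m. (A n j i)\<^sup>2)"
        using ji by (intro sum_mono2) auto
      with False show ?thesis by simp
    qed
    ultimately have "(\<lambda>n. (A n j i)\<^sup>2) \<longlonglongrightarrow> 0"
      using tendsto_zero_bound[of "\<lambda>n. (\<Sum>i=1..m. (A n j i)\<^sup>2) - (A n j j)\<^sup>2" "\<lambda>n. (A n j i)\<^sup>2"] by simp
    then have "(\<lambda>n. \<bar>A n j i\<bar>) \<longlonglongrightarrow> 0" using tendsto_real_sqrt by fastforce
    then have "(\<lambda>n. A n j i) \<longlonglongrightarrow> 0" by (rule tendsto_rabs_zero_cancel)
    from tendsto_minus[OF this] False show ?thesis by simp
  qed
qed

lemma orthogonal_limit: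
  fixes idx :: "'m::finite \<Rightarrow> nat"
  assumes idx: "bij_betw idx UNIV {1..m}" and gap: "lam (Suc m) < lam m"
  obtains Q :: "nat \<Rightarrow> real ^ 'm ^ 'm" where "\<And>n. orthogonal_matrix (Q n)"
    "\<And>a b. (\<lambda>n. Q n $ a $ b - A n (idx a) (idx b)) \<longlonglongrightarrow> 0"
proof -
  define M :: "nat \<Rightarrow> real ^ 'm ^ 'm" where "M n = (\<chi> a b. A n (idx a) (idx b))" for n
  have im: "idx a \<in> {1..m}" for a using idx by (auto simp: bij_betw_def)
  have "M n \<in> entry_box" for n using im by (auto simp: entry_box_def M_def intro!: A_le)
  moreover have "(\<lambda>n. M n ** transpose (M n)) \<longlonglongrightarrow> mat 1"
  proof (intro vec_tendstoI)
    fix a b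
    have "(\<Sum>c\<in>UNIV. A n (idx a) (idx c) * A n (idx b) (idx c)) = (\<Sum>i=1..m. A n (idx a) i * A n (idx b) i)" for n
      by (rule sum.reindex_bij_betw[OF idx])
    moreover have "idx a = idx b \<longleftrightarrow> a = b" using idx by (auto simp: bij_betw_def inj_on_def)
    ultimately show "(\<lambda>n. (M n ** transpose (M n)) $ a $ b) \<longlonglongrightarrow> mat 1 $ a $ b"
      using gram_limit[OF gap im im, of a b] by (simp add: gram_nth M_def mat_def)
  qed
  ultimately obtain Q where Q: "\<And>n. orthogonal_matrix (Q n)" "(\<lambda>n. Q n - M n) \<longlonglongrightarrow> 0"
    using approx_orthogonal[of M] by blast
  have "(\<lambda>n. Q n $ a $ b - A n (idx a) (idx b)) \<longlonglongrightarrow> 0" for a b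
    using tendsto_vec_nth[OF tendsto_vec_nth[OF Q(2), of a], of b] by (simp add: M_def)
  with Q(1) show thesis by (rule that)
qed

end

section \<open>Gromov--Kantorovich cost and kernel error\<close>

locale mds_lift_pair =
  L1: mds_lift N X d \<mu> \<pi> + L2: mds_lift N Y e \<nu> \<rho>
  for N :: "'z measure" and X :: "'a set" and d \<mu> \<pi> and Y :: "'b set" and e \<nu> \<rho>
begin

text \<open>Squared, so that the cost of order 4 is the squared L2 norm of this function.\<close>

definition distortion :: "'z \<times> 'z \<Rightarrow> real" where
  "distortion p = (d (\<pi> (fst p)) (\<pi> (snd p)) - e (\<rho> (fst p)) (\<rho> (snd p)))\<^sup>2"

text \<open>The Hilbert-Schmidt norm for the uncentered kernels; centering being a contraction, it
  also dominates the difference of the centered forms.\<close>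

definition kernel_error :: real where
  "kernel_error = sqrt (l2_inner (N \<Otimes>\<^sub>M N) (\<lambda>p. L1.kern p - L2.kern p) (\<lambda>p. L1.kern p - L2.kern p))"

abbreviation "quartic_cost \<equiv> l2_inner (N \<Otimes>\<^sub>M N) distortion distortion"

lemma distortion_L2: "distortion \<in> L2_space (N \<Otimes>\<^sub>M N)"
proof (rule L2_bound)
  note [measurable] = L1.dist2_measurable L2.dist2_measurable
  show "distortion \<in> borel_measurable (N \<Otimes>\<^sub>M N)" unfolding distortion_def by measurable
  show "(\<lambda>p. L1.dist_sq p + L2.dist_sq p) \<in> L2_space (N \<Otimes>\<^sub>M N)"
    by (intro L2_add L1.dist_sq_pair_L2 L2.dist_sq_pair_L2)
  have "(a - b)\<^sup>2 \<le> a\<^sup>2 + b\<^sup>2" if "0 \<le> a" "0 \<le> b" for a b :: real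
    using mult_nonneg_nonneg[OF that] by (simp add: power2_diff)
  then show "\<bar>distortion p\<bar> \<le> \<bar>L1.dist_sq p + L2.dist_sq p\<bar>" for p
    by (simp add: distortion_def L1.dist_sq_def L2.dist_sq_def)
qed

text \<open>\<open>d\<^sup>2 - e\<^sup>2 = (d - e) (d + e)\<close>, and \<open>d + e \<le> 2 d + \<bar>d - e\<bar>\<close> controls the second factor
  without a bound on the moments of \<open>e\<close>.\<close>

lemma kernel_error_le:
  "kernel_error\<^sup>2 \<le> sqrt quartic_cost *
     sqrt (128 * l2_inner (N \<Otimes>\<^sub>M N) L1.dist_sq L1.dist_sq + 8 * quartic_cost)"
proof -
  let ?P = "N \<Otimes>\<^sub>M N"
  define D where "D p = d (\<pi> (fst p)) (\<pi> (snd p))" for p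
  define E where "E p = e (\<rho> (fst p)) (\<rho> (snd p))" for p
  define S where "S p = (D p + E p)\<^sup>2" for p
  have nn: "0 \<le> D p" "0 \<le> E p" for p by (simp_all add: D_def E_def)
  have [measurable]: "D \<in> borel_measurable ?P" "E \<in> borel_measurable ?P"
    unfolding D_def[abs_def] E_def[abs_def] by (rule L1.dist2_measurable L2.dist2_measurable)+
  have S: "S \<in> L2_space ?P"
  proof (rule L2_bound)
    show "S \<in> borel_measurable ?P" unfolding S_def by measurable
    show "(\<lambda>p. 2 * (L1.dist_sq p + L2.dist_sq p)) \<in> L2_space ?P"
      by (intro L2_scale L2_add L1.dist_sq_pair_L2 L2.dist_sq_pair_L2)
    have "(a + b)\<^sup>2 \<le> 2 * (a\<^sup>2 + b\<^sup>2)" for a b :: real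
      using sum_squares_bound[of a b] by (simp add: power2_sum)
    from this[of "D p" "E p" for p] show "\<bar>S p\<bar> \<le> \<bar>2 * (L1.dist_sq p + L2.dist_sq p)\<bar>" for p
      by (simp add: S_def L1.dist_sq_def L2.dist_sq_def D_def E_def)
  qed
  have "l2_inner ?P S S \<le> (\<integral>p. 128 * (L1.dist_sq p * L1.dist_sq p) + 8 * (distortion p * distortion p) \<partial>?P)"
    unfolding l2_inner_def
  proof (rule integral_mono)
    show "integrable ?P (\<lambda>p. S p * S p)" by (intro L2_integrable_mult S)
    show "integrable ?P (\<lambda>p. 128 * (L1.dist_sq p * L1.dist_sq p) + 8 * (distortion p * distortion p))"
      by (intro Bochner_Integration.integrable_add integrable_mult_right L2_integrable_mult
          L1.dist_sq_pair_L2 distortion_L2)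
    fix p
    have pow4: "x\<^sup>2 * x\<^sup>2 = x ^ 4" for x :: real by (simp add: power2_eq_square power4_eq_xxxx)
    have "D p + E p \<le> 2 * D p + \<bar>D p - E p\<bar>" by simp
    then have "(D p + E p) ^ 4 \<le> (2 * D p + \<bar>D p - E p\<bar>) ^ 4" using nn by (intro power_mono) auto
    \<comment> \<open>Origin of the constants 128 = 8 * 2^4 and 8.\<close>
    also have "\<dots> \<le> 8 * ((2 * D p) ^ 4 + \<bar>D p - E p\<bar> ^ 4)" using nn by (intro power4_add_le) auto
    also have "\<dots> = 128 * D p ^ 4 + 8 * (D p - E p) ^ 4" by (simp add: power_mult_distrib)
    finally show "S p * S p \<le> 128 * (L1.dist_sq p * L1.dist_sq p) + 8 * (distortion p * distortion p)"
      unfolding S_def L1.dist_sq_def distortion_def D_def[symmetric] E_def[symmetric] pow4 .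
  qed
  also have "\<dots> = 128 * l2_inner ?P L1.dist_sq L1.dist_sq + 8 * quartic_cost"
    unfolding l2_inner_def
    by (subst Bochner_Integration.integral_add)
      (auto intro!: integrable_mult_right L2_integrable_mult L1.dist_sq_pair_L2 distortion_L2)
  finally have S_le: "l2_inner ?P S S \<le> 128 * l2_inner ?P L1.dist_sq L1.dist_sq + 8 * quartic_cost" .
  have "kernel_error\<^sup>2 = l2_inner ?P (\<lambda>p. L1.kern p - L2.kern p) (\<lambda>p. L1.kern p - L2.kern p)"
    unfolding kernel_error_def by (intro real_sqrt_pow2 l2.nonneg l2.diff_mem L1.kernel_L2 L2.kernel_L2)
  \<comment> \<open>The factor 1/4 is the square of the 1/2 in \<open>mds_kernel\<close>, and (D^2 -
    E^2)^2 = (D - E)^2 (D + E)^2.\<close>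
  also have "\<dots> = (1 / 4) * l2_inner ?P distortion S"
  proof -
    have eq: "(L1.kern p - L2.kern p) * (L1.kern p - L2.kern p) = (1 / 4) * (distortion p * S p)" for p
      unfolding L1.kern_eq L2.kern_eq L1.dist_sq_def L2.dist_sq_def distortion_def S_def
        D_def[symmetric] E_def[symmetric] by (simp add: power2_eq_square algebra_simps)
    show ?thesis by (simp only: l2_inner_def eq integral_mult_right_zero)
  qed
  also have "\<dots> \<le> 1 * \<bar>l2_inner ?P distortion S\<bar>" by simp
  also have "\<dots> \<le> sqrt quartic_cost * sqrt (l2_inner ?P S S)"
    using l2_abs_le[OF distortion_L2 S] by simp
  also have "\<dots> \<le> sqrt quartic_cost * sqrt (128 * l2_inner ?P L1.dist_sq L1.dist_sq + 8 * quartic_cost)"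
    using S_le l2.nonneg[OF distortion_L2] by (intro mult_left_mono real_sqrt_le_mono) auto
  finally show ?thesis .
qed

text \<open>\<open>centered_form\<close> depends on \<open>N\<close> only, so both kernels are
  centered by the same projection and their forms subtract to the form of the difference
  kernel.\<close>

lemma two_spectral_systems_lift:
  assumes "positive_eigenvalues \<mu> (mds_op d \<mu>) lam" "orthonormal_eigenfunctions \<mu> (mds_op d \<mu>) lam u"
    and "positive_eigenvalues \<nu> (mds_op e \<nu>) lam'" "orthonormal_eigenfunctions \<nu> (mds_op e \<nu>) lam' u'"
  shows "two_spectral_systems (L2_space N) (l2_inner N)
    (L1.centered_form L1.kern) lam (L1.lifted_eigenfunction lam u)
    (L1.centered_form L2.kern) lam' (L2.lifted_eigenfunction lam' u') kernel_error"
proof (intro two_spectral_systems.intro two_spectral_systems_axioms.intro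
    L1.spectral_system_lift L2.spectral_system_lift assms)
  fix f g
  assume f: "f \<in> L2_space N" "l2_inner N f f \<le> 1" and g: "g \<in> L2_space N" "l2_inner N g g \<le> 1"
  have "\<bar>L1.centered_form L1.kern f g - L1.centered_form L2.kern f g\<bar>
    \<le> kernel_error * (sqrt (l2_inner N f f) * sqrt (l2_inner N g g))"
    using L1.centered_form_abs_le[OF l2.diff_mem[OF L1.kernel_L2 L2.kernel_L2] f(1) g(1)]
    by (simp add: L1.centered_form_diff_kernel[OF L1.kernel_L2 L2.kernel_L2 f(1) g(1)] kernel_error_def)
  also have "\<dots> \<le> kernel_error * (1 * 1)"
    using f g l2.nonneg[OF f(1)] l2.nonneg[OF g(1)] l2.nonneg[OF l2.diff_mem[OF L1.kernel_L2 L2.kernel_L2]]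
    by (intro mult_left_mono[OF mult_mono]) (simp_all add: kernel_error_def)
  finally show "\<bar>L1.centered_form L1.kern f g - L1.centered_form L2.kern f g\<bar> \<le> kernel_error" by simp
qed

text \<open>\<open>S\<close> stands for the Borel sets of the product topology rather than a product
  sigma-algebra, hence the explicit measurability of the two projections.\<close>

lemma GW_cost_distr:
  assumes \<phi>: "(\<lambda>z. (\<pi> z, \<rho> z)) \<in> measurable N S"
    and fst: "fst \<in> measurable S \<mu>" and snd: "snd \<in> measurable S \<nu>"
  shows "GW_cost 4 d e (distr N S (\<lambda>z. (\<pi> z, \<rho> z))) = ennreal quartic_cost"
proof -
  let ?f = "\<lambda>z. (\<pi> z, \<rho> z)"
  interpret b1: mds_lift \<mu> X d \<mu> "\<lambda>x. x" by (rule L1.base)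
  interpret b2: mds_lift \<nu> Y e \<nu> "\<lambda>x. x" by (rule L2.base)
  interpret G: prob_space "distr N S ?f" by (rule L1.prob_space_distr[OF \<phi>])
  have [measurable]: "(\<lambda>q. d (fst (fst q)) (fst (snd q))) \<in> borel_measurable (S \<Otimes>\<^sub>M S)"
  proof -
    have "(\<lambda>q. (fst (fst q), fst (snd q))) \<in> measurable (S \<Otimes>\<^sub>M S) (\<mu> \<Otimes>\<^sub>M \<mu>)"
      by (rule measurable_Pair[OF measurable_compose[OF measurable_fst fst] measurable_compose[OF measurable_snd fst]])
    from measurable_compose[OF this b1.dist2_measurable] show ?thesis by (simp only: fst_conv snd_conv)
  qed
  have [measurable]: "(\<lambda>q. e (snd (fst q)) (snd (snd q))) \<in> borel_measurable (S \<Otimes>\<^sub>M S)"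
  proof -
    have "(\<lambda>q. (snd (fst q), snd (snd q))) \<in> measurable (S \<Otimes>\<^sub>M S) (\<nu> \<Otimes>\<^sub>M \<nu>)"
      by (rule measurable_Pair[OF measurable_compose[OF measurable_fst snd] measurable_compose[OF measurable_snd snd]])
    from measurable_compose[OF this b2.dist2_measurable] show ?thesis by (simp only: fst_conv snd_conv)
  qed
  have [measurable]: "(\<lambda>(x, y). (?f x, ?f y)) \<in> measurable (N \<Otimes>\<^sub>M N) (S \<Otimes>\<^sub>M S)"
    unfolding case_prod_unfold
    by (rule measurable_Pair[OF measurable_compose[OF measurable_fst \<phi>] measurable_compose[OF measurable_snd \<phi>]])
  have "distr N S ?f \<Otimes>\<^sub>M distr N S ?f = distr (N \<Otimes>\<^sub>M N) (S \<Otimes>\<^sub>M S) (\<lambda>(x, y). (?f x, ?f y))"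
    by (rule pair_measure_distr[OF \<phi> \<phi>]) unfold_locales
  then have "GW_cost 4 d e (distr N S ?f) =
      (\<integral>\<^sup>+ q. ennreal (\<bar>d (fst (fst q)) (fst (snd q)) - e (snd (fst q)) (snd (snd q))\<bar> powr 4)
        \<partial>(distr (N \<Otimes>\<^sub>M N) (S \<Otimes>\<^sub>M S) (\<lambda>(x, y). (?f x, ?f y))))"
    by (simp add: GW_cost_def case_prod_unfold)
  also have "\<dots> = (\<integral>\<^sup>+ p. ennreal (distortion p * distortion p) \<partial>(N \<Otimes>\<^sub>M N))"
  proof (subst nn_integral_distr)
    have pow4: "\<bar>x\<bar> powr 4 = x\<^sup>2 * x\<^sup>2" for x :: real
      by (cases "x = 0") (simp_all add: power2_eq_square power4_eq_xxxx powr_numeral)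
    show "(\<integral>\<^sup>+ p. ennreal (\<bar>d (fst (fst ((\<lambda>(x, y). (?f x, ?f y)) p))) (fst (snd ((\<lambda>(x, y). (?f x, ?f y)) p)))
        - e (snd (fst ((\<lambda>(x, y). (?f x, ?f y)) p))) (snd (snd ((\<lambda>(x, y). (?f x, ?f y)) p)))\<bar> powr 4) \<partial>(N \<Otimes>\<^sub>M N))
      = (\<integral>\<^sup>+ p. ennreal (distortion p * distortion p) \<partial>(N \<Otimes>\<^sub>M N))"
      by (intro nn_integral_cong) (simp add: case_prod_unfold distortion_def pow4)
  qed measurable
  also have "\<dots> = ennreal quartic_cost"
    unfolding l2_inner_def
    by (rule nn_integral_eq_integral) (auto intro: L2_integrable_mult distortion_L2)
  finally show ?thesis .
qed

end

lemma L2_norm_eq: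
  fixes F :: "'z \<Rightarrow> real ^ 'm::finite"
  assumes "\<And>a. (\<lambda>z. F z $ a) \<in> L2_space N"
  shows "L2_norm N F = ennreal (sqrt (\<Sum>a\<in>UNIV. l2_inner N (\<lambda>z. F z $ a) (\<lambda>z. F z $ a)))"
proof -
  have int: "integrable N (\<lambda>z. F z $ a * F z $ a)" for a by (intro L2_integrable_mult assms)
  have "(\<integral>\<^sup>+ z. ennreal ((norm (F z))\<^sup>2) \<partial>N) = (\<integral>\<^sup>+ z. ennreal (\<Sum>a\<in>UNIV. F z $ a * F z $ a) \<partial>N)"
    by (simp add: norm_vec_def L2_set_def sum_nonneg power2_eq_square)
  also have "\<dots> = ennreal (\<integral>z. (\<Sum>a\<in>UNIV. F z $ a * F z $ a) \<partial>N)"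
    by (intro nn_integral_eq_integral Bochner_Integration.integrable_sum int) (simp add: sum_nonneg)
  also have "(\<integral>z. (\<Sum>a\<in>UNIV. F z $ a * F z $ a) \<partial>N) = (\<Sum>a\<in>UNIV. l2_inner N (\<lambda>z. F z $ a) (\<lambda>z. F z $ a))"
    unfolding l2_inner_def by (intro Bochner_Integration.integral_sum int)
  finally show ?thesis
    using assms by (simp add: L2_norm_def ennreal_rpow_def powr_half_sqrt sum_nonneg l2.nonneg)
qed

lemma L2_norm_cong:
  "(\<And>z. z \<in> space N \<Longrightarrow> F z = G z) \<Longrightarrow> L2_norm N F = L2_norm N G"
  unfolding L2_norm_def by (simp cong: nn_integral_cong)

lemma GW_eq_minimizer:
  assumes "is_arg_min (GW_cost p d e) (\<lambda>\<gamma>. \<gamma> \<in> couplings X d \<mu> Y e \<nu>) \<gamma>"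
  shows "GW p X d \<mu> Y e \<nu> = ennreal_rpow (GW_cost p d e \<gamma>) (1 / p)"
proof -
  have "(INF \<gamma>\<in>couplings X d \<mu> Y e \<nu>. GW_cost p d e \<gamma>) = GW_cost p d e \<gamma>"
    using assms by (intro antisym INF_lower INF_greatest) (auto simp: is_arg_min_def not_less)
  then show ?thesis by (simp add: GW_def)
qed

lemma ennreal_rpow_tendsto_0:
  fixes c :: "nat \<Rightarrow> real"
  assumes c: "\<And>n. 0 \<le> c n" and lim: "(\<lambda>n. ennreal_rpow (ennreal (c n)) (1 / 4)) \<longlonglongrightarrow> 0"
  shows "c \<longlonglongrightarrow> 0"
proof -
  have "(\<lambda>n. ennreal (c n powr (1 / 4))) \<longlonglongrightarrow> ennreal 0"
    using lim c by (simp add: ennreal_rpow_def)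
  then have "(\<lambda>n. c n powr (1 / 4)) \<longlonglongrightarrow> 0"
    by (subst (asm) tendsto_ennreal_iff) auto
  then have "(\<lambda>n. (c n powr (1 / 4)) ^ 4) \<longlonglongrightarrow> 0 ^ 4" by (rule tendsto_power)
  moreover have "(c n powr (1 / 4)) ^ 4 = c n" for n
    using c[of n] by (cases "c n = 0") (simp_all add: powr_power)
  ultimately show ?thesis by simp
qed

section \<open>Convergence of the MDS maps\<close>

theorem theorem5p4:
  fixes X :: "'a set" and d :: "'a \<Rightarrow> 'a \<Rightarrow> real" and \<mu> :: "'a measure"
    and Xn :: "nat \<Rightarrow> 'b set" and dn :: "nat \<Rightarrow> 'b \<Rightarrow> 'b \<Rightarrow> real" and \<mu>n :: "nat \<Rightarrow> 'b measure"
    and \<gamma>n :: "nat \<Rightarrow> ('a \<times> 'b) measure" and \<gamma> :: "('a \<times> (nat \<Rightarrow> 'b)) measure"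
    and m :: nat and idx :: "'m::finite \<Rightarrow> nat"
    and M :: "'a \<Rightarrow> real ^ 'm" and Mn :: "nat \<Rightarrow> 'b \<Rightarrow> real ^ 'm"
    and lam :: "nat \<Rightarrow> real"
  assumes "mm_space X d \<mu>" and "finite_fourth_moment X d \<mu>"
    and "\<And>n. mm_space (Xn n) (dn n) (\<mu>n n)"
    and "\<And>n. finite_fourth_moment (Xn n) (dn n) (\<mu>n n)"
    and "(\<lambda>n. GW 4 X d \<mu> (Xn n) (dn n) (\<mu>n n)) \<longlonglongrightarrow> 0"
    and "\<And>n. is_arg_min (GW_cost 4 d (dn n))
               (\<lambda>\<gamma>. \<gamma> \<in> couplings X d \<mu> (Xn n) (dn n) (\<mu>n n)) (\<gamma>n n)"
    and "prob_space \<gamma>"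
    and "sets \<gamma> = sets (borel_sigma (prod_topology (Metric_space.mtopology X d)
           (product_topology (\<lambda>n. Metric_space.mtopology (Xn n) (dn n)) UNIV)))"
    and "\<And>n. distr \<gamma> (borel_sigma (prod_topology (Metric_space.mtopology X d)
               (Metric_space.mtopology (Xn n) (dn n)))) (\<lambda>z. (fst z, snd z n)) = \<gamma>n n"
    and "bij_betw idx UNIV {1..m}"
    and "mds_map idx X d \<mu> M"
    and "\<And>n. mds_map idx (Xn n) (dn n) (\<mu>n n) (Mn n)"
    and "positive_eigenvalues \<mu> (mds_op d \<mu>) lam"
    and "lam m > lam (m + 1)"
  shows "(\<forall>n. \<exists>Q. is_arg_min (\<lambda>Q. L2_norm \<gamma> (\<lambda>z. M (fst z) - Q *v Mn n (snd z n)))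
                  orthogonal_matrix Q) \<and>
         (\<lambda>n. INF Q\<in>{Q. orthogonal_matrix Q}.
            L2_norm \<gamma> (\<lambda>z. M (fst z) - Q *v Mn n (snd z n))) \<longlonglongrightarrow> 0 \<and>
         ((\<forall>j\<in>{1..m}. eigen_multiplicity \<mu> (mds_op d \<mu>) (lam j) = 1) \<longrightarrow>
           (\<exists>D. (\<forall>n. sign_diagonal (D n)) \<and>
             (\<lambda>n. L2_norm \<gamma> (\<lambda>z. M (fst z) - D n *v Mn n (snd z n))) \<longlonglongrightarrow> 0))"
proof -
  let ?TX = "Metric_space.mtopology X d" and ?TY = "\<lambda>n. Metric_space.mtopology (Xn n) (dn n)"
  let ?S = "\<lambda>n. borel_sigma (prod_topology ?TX (?TY n))"
  obtain lam1 u where lam1: "positive_eigenvalues \<mu> (mds_op d \<mu>) lam1"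
    and u: "orthonormal_eigenfunctions \<mu> (mds_op d \<mu>) lam1 u"
    and M: "\<And>x. x \<in> X \<Longrightarrow> M x = (\<chi> i. sqrt (lam1 (idx i)) * u (idx i) x)"
    using assms(11) unfolding mds_map_def by blast
  have "\<exists>l w. positive_eigenvalues (\<mu>n n) (mds_op (dn n) (\<mu>n n)) l \<and>
        orthonormal_eigenfunctions (\<mu>n n) (mds_op (dn n) (\<mu>n n)) l w \<and>
        (\<forall>x\<in>Xn n. Mn n x = (\<chi> i. sqrt (l (idx i)) * w (idx i) x))" for n
    using assms(12)[of n] unfolding mds_map_def .
  then obtain lam' u' where lam': "\<And>n. positive_eigenvalues (\<mu>n n) (mds_op (dn n) (\<mu>n n)) (lam' n)"
    and u': "\<And>n. orthonormal_eigenfunctions (\<mu>n n) (mds_op (dn n) (\<mu>n n)) (lam' n) (u' n)"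
    and Mn: "\<And>n x. x \<in> Xn n \<Longrightarrow> Mn n x = (\<chi> i. sqrt (lam' n (idx i)) * u' n (idx i) x)"
    by metis
  have idx: "bij_betw idx UNIV {1..m}" by (rule assms(10))
  have im: "idx a \<in> {1..m}" for a using idx by (auto simp: bij_betw_def)
  have inv1: "inv idx (idx a) = a" for a using idx by (simp add: bij_betw_def)
  have inv2: "idx (inv idx i) = i" if "i \<in> {1..m}" for i
    using idx that by (simp add: bij_betw_def f_inv_into_f)
  have m: "1 \<le> m" using im[of undefined] by simp
  have lam_eq: "lam1 j = lam j" if "1 \<le> j" for j
    by (rule positive_eigenvalues_unique[OF lam1 assms(13) that])
  have gap: "lam1 (Suc m) < lam1 m" using assms(14) lam_eq[of m] lam_eq[of "Suc m"] m by simp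
  have lam1_pos: "0 < lam1 j" if "j \<in> {1..m}" for j
  proof -
    have "0 \<le> lam1 (Suc m)" using lam1 by (simp add: positive_eigenvalues_def)
    also note gap
    also have "lam1 m \<le> lam1 j" using that lam1 by (simp add: positive_eigenvalues_def)
    finally show ?thesis .
  qed

  have sets_\<mu>: "sets \<mu> = sets (borel_sigma ?TX)" using assms(1) by (simp add: mm_space_def)
  have sets_\<mu>n: "sets (\<mu>n n) = sets (borel_sigma (?TY n))" for n using assms(3) by (simp add: mm_space_def)
  have fst_S: "fst \<in> measurable (?S n) \<mu>" for n
    unfolding measurable_cong_sets[OF refl sets_\<mu>]
    by (intro continuous_map_measurable continuous_map_fst)
  have snd_S: "snd \<in> measurable (?S n) (\<mu>n n)" for n
    unfolding measurable_cong_sets[OF refl sets_\<mu>n]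
    by (intro continuous_map_measurable continuous_map_snd)
  have \<phi>: "(\<lambda>z. (fst z, snd z n)) \<in> measurable \<gamma> (?S n)" for n
  proof -
    have "continuous_map (prod_topology ?TX (product_topology ?TY UNIV)) (?TY n) ((\<lambda>w. w n) \<circ> snd)"
      by (rule continuous_map_compose[OF continuous_map_snd continuous_map_product_projection]) simp
    then have "continuous_map (prod_topology ?TX (product_topology ?TY UNIV)) (prod_topology ?TX (?TY n))
        (\<lambda>z. (fst z, snd z n))"
      by (intro continuous_map_pairedI continuous_map_fst) (simp add: o_def)
    then show ?thesis
      unfolding measurable_cong_sets[OF assms(8) refl] by (rule continuous_map_measurable)
  qed
  have coupling: "\<gamma>n n \<in> couplings X d \<mu> (Xn n) (dn n) (\<mu>n n)" for n
    using assms(6)[of n] by (simp add: is_arg_min_def)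
  have fst_\<gamma>: "fst \<in> measurable \<gamma> \<mu>"
    using measurable_compose[OF \<phi> fst_S] by simp
  have snd_\<gamma>: "(\<lambda>z. snd z n) \<in> measurable \<gamma> (\<mu>n n)" for n
    using measurable_compose[OF \<phi> snd_S, of n] by simp
  \<comment> \<open>Any index yields the first marginal; 0 is an arbitrary choice.\<close>
  have "distr (distr \<gamma> (?S 0) (\<lambda>z. (fst z, snd z 0))) \<mu> fst = \<mu>"
    using coupling[of 0] by (simp add: couplings_def assms(9))
  then have distr_fst: "distr \<gamma> \<mu> fst = \<mu>"
    by (simp add: distr_distr[OF fst_S \<phi>] o_def)
  have "distr (distr \<gamma> (?S n) (\<lambda>z. (fst z, snd z n))) (\<mu>n n) snd = \<mu>n n" for n
    using coupling[of n] by (simp add: couplings_def assms(9))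
  then have distr_snd: "distr \<gamma> (\<mu>n n) (\<lambda>z. snd z n) = \<mu>n n" for n
    by (simp add: distr_distr[OF snd_S \<phi>] o_def)

  interpret L1: mds_lift \<gamma> X d \<mu> fst
    by (intro mds_lift.intro mds_lift_axioms.intro assms fst_\<gamma> distr_fst)
  have lift: "mds_lift \<gamma> (Xn n) (dn n) (\<mu>n n) (\<lambda>z. snd z n)" for n
    by (intro mds_lift.intro mds_lift_axioms.intro assms snd_\<gamma> distr_snd)
  define v where "v = L1.lifted_eigenfunction lam1 u"
  define v' where "v' n = mds_lift.lifted_eigenfunction (\<lambda>z :: 'a \<times> (nat \<Rightarrow> 'b). snd z n) (lam' n) (u' n)" for n
  define B' where "B' n = L1.centered_form (mds_lift.kern (dn n) (\<lambda>z. snd z n))" for n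
  define K where "K = l2_inner (\<gamma> \<Otimes>\<^sub>M \<gamma>) L1.dist_sq L1.dist_sq"
  \<comment> \<open>The locale of pairs is available for one \<open>n\<close> at a time; the
    existential statement exports its constants so that sequences can be chosen.\<close>
  have "\<exists>c \<epsilon>. 0 \<le> c \<and> GW_cost 4 d (dn n) (\<gamma>n n) = ennreal c \<and> 0 \<le> \<epsilon> \<and>
      \<epsilon>\<^sup>2 \<le> sqrt c * sqrt (128 * K + 8 * c) \<and>
      two_spectral_systems (L2_space \<gamma>) (l2_inner \<gamma>) (L1.centered_form L1.kern) lam1 v (B' n) (lam' n) (v' n) \<epsilon>" for n
  proof -
    interpret P: mds_lift_pair \<gamma> X d \<mu> fst "Xn n" "dn n" "\<mu>n n" "\<lambda>z. snd z n"
      by (rule mds_lift_pair.intro[OF L1.mds_lift_axioms lift])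
    have "GW_cost 4 d (dn n) (\<gamma>n n) = ennreal P.quartic_cost"
      using P.GW_cost_distr[OF \<phi> fst_S snd_S] by (simp add: assms(9))
    moreover have "0 \<le> P.quartic_cost" by (intro l2.nonneg P.distortion_L2)
    moreover have "0 \<le> P.kernel_error"
      unfolding P.kernel_error_def by (intro real_sqrt_ge_zero l2.nonneg l2.diff_mem L1.kernel_L2 P.L2.kernel_L2)
    moreover note P.kernel_error_le[folded K_def]
      P.two_spectral_systems_lift[OF lam1 u lam' u', folded v_def v'_def B'_def]
    ultimately show ?thesis by blast
  qed
  then obtain c \<epsilon> where c: "\<And>n. 0 \<le> c n" "\<And>n. GW_cost 4 d (dn n) (\<gamma>n n) = ennreal (c n)"
    and \<epsilon>: "\<And>n. 0 \<le> \<epsilon> n" "\<And>n. (\<epsilon> n)\<^sup>2 \<le> sqrt (c n) * sqrt (128 * K + 8 * c n)"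
    and two: "\<And>n. two_spectral_systems (L2_space \<gamma>) (l2_inner \<gamma>) (L1.centered_form L1.kern) lam1 v
      (B' n) (lam' n) (v' n) (\<epsilon> n)"
    by metis
  have "c \<longlonglongrightarrow> 0"
    using assms(5) c by (intro ennreal_rpow_tendsto_0) (simp_all add: GW_eq_minimizer[OF assms(6)])
  then have "(\<lambda>n. sqrt (sqrt (c n) * sqrt (128 * K + 8 * c n))) \<longlonglongrightarrow> sqrt (sqrt 0 * sqrt (128 * K + 8 * 0))"
    by (intro tendsto_intros)
  then have "(\<lambda>n. sqrt (sqrt (c n) * sqrt (128 * K + 8 * c n))) \<longlonglongrightarrow> 0" by simp
  moreover have "\<bar>\<epsilon> n\<bar> \<le> sqrt (sqrt (c n) * sqrt (128 * K + 8 * c n))" for n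
    using \<epsilon>[of n] by (simp add: real_le_rsqrt)
  ultimately have eps: "\<epsilon> \<longlonglongrightarrow> 0" by (rule tendsto_zero_bound)
  interpret C: spectral_convergence "L2_space \<gamma>" "l2_inner \<gamma>" "L1.centered_form L1.kern" lam1 v B' lam' v' \<epsilon>
    by (intro spectral_convergence.intro spectral_convergence_axioms.intro two eps)
      (unfold v_def, rule L1.spectral_system_lift[OF lam1 u])

  \<comment> \<open>Coordinates are indexed by the finite type, eigenfunctions by numbers;
    \<open>inv idx\<close> reads row \<open>a\<close> of \<open>Q\<close> as a sequence of
    coefficients.\<close>
  define G where "G n Q a = C.F m (idx a) (\<lambda>i. Q $ a $ inv idx i) n" for n and Q :: "real ^ 'm ^ 'm" and a
  define q where "q n Q = (\<Sum>a\<in>UNIV. l2_inner \<gamma> (G n Q a) (G n Q a))" for n Q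
  let ?L = "\<lambda>n Q. L2_norm \<gamma> (\<lambda>z. M (fst z) - Q *v Mn n (snd z n))"
  have v'_mem: "v' n i \<in> L2_space \<gamma>" if "1 \<le> i" for n i
  proof -
    interpret two_spectral_systems "L2_space \<gamma>" "l2_inner \<gamma>" "L1.centered_form L1.kern" lam1 v
      "B' n" "lam' n" "v' n" "\<epsilon> n" by (rule two)
    show ?thesis using that by (rule S2.v_mem)
  qed
  have L_eq: "?L n Q = ennreal (sqrt (q n Q))" for n Q
  proof -
    interpret Ln: mds_lift \<gamma> "Xn n" "dn n" "\<mu>n n" "\<lambda>z. snd z n" by (rule lift)
    have "?L n Q = L2_norm \<gamma> (\<lambda>z. \<chi> a. G n Q a z)"
    proof (rule L2_norm_cong)
      fix z assume z: "z \<in> space \<gamma>"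
      \<comment> \<open>If the eigenvalue is 0, \<open>u j\<close> and \<open>v j\<close> may
        differ, but both sides vanish with the square root.\<close>
      have 1: "sqrt (lam1 j) * u j (fst z) = sqrt (lam1 j) * v j z" if "1 \<le> j" for j
        using lam1 that by (auto simp: v_def L1.lifted_eigenfunction_def positive_eigenvalues_def
            intro: antisym)
      have 2: "sqrt (lam' n j) * u' n j (snd z n) = sqrt (lam' n j) * v' n j z" if "1 \<le> j" for j
        using lam'[of n] that by (auto simp: v'_def Ln.lifted_eigenfunction_def positive_eigenvalues_def
            intro: antisym)
      have "(\<Sum>b\<in>UNIV. Q $ a $ b * (sqrt (lam' n (idx b)) * u' n (idx b) (snd z n)))
          = (\<Sum>i=1..m. (Q $ a $ inv idx i * sqrt (lam' n i)) * v' n i z)" for a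
        unfolding sum.reindex_bij_betw[OF idx, symmetric]
        using im 2 by (intro sum.cong refl) (simp add: inv1 mult.assoc)
      then show "M (fst z) - Q *v Mn n (snd z n) = (\<chi> a. G n Q a z)"
        using M[OF L1.proj_space[OF z]] Mn[OF Ln.proj_space[OF z]] im 1
        by (simp add: vec_eq_iff matrix_vector_mult_def G_def C.F_def)
    qed
    also have "\<dots> = ennreal (sqrt (q n Q))"
    proof -
      have "G n Q a \<in> L2_space \<gamma>" for a
        unfolding G_def C.F_def using im
        by (intro l2.residual_mem L2_scale C.v_mem v'_mem) auto
      then show ?thesis by (subst L2_norm_eq) (simp_all add: q_def)
    qed
    finally show ?thesis .
  qed
  have q_nonneg: "0 \<le> q n Q" for n Q
    unfolding q_def l2_inner_def by (intro sum_nonneg Bochner_Integration.integral_nonneg) simp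
  \<comment> \<open>By \<open>F_norm\<close> the squared distance is a polynomial in the entries of
    \<open>Q\<close>; its minimum over the compact orthogonal group is therefore attained.\<close>
  have q_cont: "continuous_on S (q n)" for n S
  proof -
    have "q n = (\<lambda>Q. \<Sum>a\<in>UNIV. lam1 (idx a) * (1 - (\<Sum>i=1..m. (C.A n (idx a) i)\<^sup>2))
      + (\<Sum>i=1..m. (sqrt (lam1 (idx a)) * C.A n (idx a) i - Q $ a $ inv idx i * sqrt (lam' n i))\<^sup>2))"
      unfolding q_def G_def using im lam1_pos by (intro ext sum.cong refl C.F_norm) auto
    then show ?thesis by (simp only:) (intro continuous_intros)
  qed
  \<comment> \<open>Any matrices entrywise asymptotic to the inner products will do, which serves
    the orthogonal and the sign case alike.\<close>
  have q_limit: "(\<lambda>n. ?L n (R n)) \<longlonglongrightarrow> 0"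
    if R: "\<And>a b. (\<lambda>n. R n $ a $ b - C.A n (idx a) (idx b)) \<longlonglongrightarrow> 0" for R
  proof -
    have "(\<lambda>n. q n (R n)) \<longlonglongrightarrow> (\<Sum>a\<in>(UNIV :: 'm set). 0)"
      unfolding q_def G_def
    proof (intro tendsto_sum C.F_limit[where R = "\<lambda>n i. R n $ a $ inv idx i" for a] gap im)
      show "(\<lambda>n. R n $ a $ inv idx i - C.A n (idx a) i) \<longlonglongrightarrow> 0" if "i \<in> {1..m}" for a i
        using R[of a "inv idx i"] inv2[OF that] by simp
    qed
    then have "(\<lambda>n. ennreal (sqrt (q n (R n)))) \<longlonglongrightarrow> ennreal (sqrt 0)"
      by (intro tendsto_ennrealI tendsto_real_sqrt) simp
    then show ?thesis by (simp add: L_eq)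
  qed

  have minimizer: "\<exists>Q. is_arg_min (?L n) orthogonal_matrix Q" for n
  proof -
    have "{Q :: real ^ 'm ^ 'm. orthogonal_matrix Q} \<noteq> {}" using orthogonal_matrix_id by blast
    from continuous_attains_inf[OF compact_orthogonal this q_cont]
    obtain Q where Q: "orthogonal_matrix Q" "\<And>R. orthogonal_matrix R \<Longrightarrow> q n Q \<le> q n R" by blast
    have "?L n Q \<le> ?L n R" if "orthogonal_matrix R" for R
      using Q(2)[OF that] by (simp add: L_eq ennreal_leI)
    with Q(1) show ?thesis by (auto simp: is_arg_min_def not_less intro!: exI[of _ Q])
  qed
  have inf_limit: "(\<lambda>n. INF Q\<in>{Q. orthogonal_matrix Q}. ?L n Q) \<longlonglongrightarrow> 0"
  proof -
    obtain Q :: "nat \<Rightarrow> real ^ 'm ^ 'm" where Q: "\<And>n. orthogonal_matrix (Q n)"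
      "\<And>a b. (\<lambda>n. Q n $ a $ b - C.A n (idx a) (idx b)) \<longlonglongrightarrow> 0"
      using C.orthogonal_limit[OF idx gap] by metis
    show ?thesis
    proof (rule tendsto_sandwich[OF _ _ tendsto_const q_limit[OF Q(2)]])
      show "\<forall>\<^sub>F n in sequentially. (INF Q\<in>{Q. orthogonal_matrix Q}. ?L n Q) \<le> ?L n (Q n)"
        using Q(1) by (intro always_eventually allI INF_lower) simp
    qed simp
  qed
  have signs: "\<exists>D. (\<forall>n. sign_diagonal (D n)) \<and> (\<lambda>n. ?L n (D n)) \<longlonglongrightarrow> 0"
    if simple: "\<forall>j\<in>{1..m}. eigen_multiplicity \<mu> (mds_op d \<mu>) (lam j) = 1"
  proof -
    have gaps: "lam1 (Suc j) < lam1 j" if "j \<in> {1..m}" for j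
      using simple that lam1_pos[OF that] by (intro simple_eigenvalues_gap[OF lam1]) (auto simp: lam_eq)
    define D :: "nat \<Rightarrow> real ^ 'm ^ 'm" where
      "D n = (\<chi> a b. if a = b then (if 0 \<le> C.A n (idx a) (idx a) then 1 else -1) else 0)" for n
    have "idx a = idx b \<longleftrightarrow> a = b" for a b using inv1 by metis
    then have "(\<lambda>n. D n $ a $ b - C.A n (idx a) (idx b)) \<longlonglongrightarrow> 0" for a b
      using C.sign_limit[OF gaps im im, of a b] by (simp add: D_def)
    then have "(\<lambda>n. ?L n (D n)) \<longlonglongrightarrow> 0" by (rule q_limit)
    moreover have "sign_diagonal (D n)" for n by (simp add: sign_diagonal_def D_def)
    ultimately show ?thesis by blast
  qed
  from minimizer inf_limit signs show ?thesis by blast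
qed

end
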